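(* Consider a regime-switching pervasive factor model with break fraction $\theta\in(0,1)$ and dimension $p=p_n\to\infty$, satisfying assumptions (F1)–(F4) listed in the context. Let $(y_t)$ be its $p^{-1/2}$-rescaled PCA-score series and $J_n$ the associated regularized QML objective with ridge parameter $\varepsilon$ (see context). Then, for every $\varepsilon>0$, every sequence of untrimmed regularized QML breakpoint estimators $\widehat\theta_n\in\arg\min_{\nu\in\mathcal D_n}J_n(\nu)$ satisfies $\widehat\theta_n\to\theta$ as $n\to\infty$.
   Context: Model. Let $p=p_n\to\infty$ as $n\to\infty$, $\theta\in(0,1)$ fixed, $\tau=\lfloor\theta n\rfloor$. For each $n$ the data $x_1,\dots,x_n\in\mathbb R^p$ satisfy $x_t=\Lambda_\le f_t+e_t$ for $1\le t\le\tau$ and $x_t=\Lambda_>f_t+e_t$ for $\tau<t\le n$, where $\Lambda_\le\in\mathbb R^{p\times q_\le}$, $\Lambda_>\in\mathbb R^{p\times q_>}$ are deterministic (depending on $n$) with $q_\le,q_>$ fixed; $f_t\in\mathbb R^{q_\le}$ for $t\le\tau$, $f_t\in\mathbb R^{q_>}$ for $t>\tau$; $e_t\in\mathbb R^p$ is an arbitrary error vector. All of $\Lambda_\bullet,f_t,e_t$ may depend on $n$. No stochastic model is imposed. For $0\le a<b\le1$ let $I(a,b)=\{\lfloor an\rfloor+1,\dots,\lfloor bn\rfloor\}$ and $E_{a:b}=\frac1{|I(a,b)|}\sum_{t\in I(a,b)}e_te_t^\top$. $\|\cdot\|$ is the operator norm, $\|\cdot\|_F$ the Frobenius norm. Assumptions.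 (F1) $\frac1p[\Lambda_\le\ \Lambda_>]^\top[\Lambda_\le\ \Lambda_>]\to\Sigma_\Lambda\succeq0$ in $\mathbb R^{(q_\le+q_>)\times(q_\le+q_>)}$ as $n\to\infty$ (so $p=p_n\to\infty$); set $q:=\operatorname{rank}(\Sigma_\Lambda)$. (F2) There are positive definite $\Sigma_{F_\le},\Sigma_{F_>}$ such that for all $0\le a<b\le\theta$ and $\theta\le c<d\le1$, as $n\to\infty$: $\frac1{|I(a,b)|}\sum_{t\in I(a,b)}f_tf_t^\top\to\Sigma_{F_\le}$ and $\frac1{|I(c,d)|}\sum_{t\in I(c,d)}f_tf_t^\top\to\Sigma_{F_>}$. (F3) With $\Sigma_\bullet^{\rm sig}:=\Lambda_\bullet\Sigma_{F_\bullet}\Lambda_\bullet^\top$ for $\bullet\in\{\le,>\}$: $\liminf_{n\to\infty}\frac1{p_n}\|\Sigma_\le^{\rm sig}-\Sigma_>^{\rm sig}\|_F>0$. (F4) For every fixed $0\le a<b\le1$: $\lim_{n\to\infty}\frac1{p_n}\|E_{a:b}\|=0$. PCA scores. Let $\widehat U\in\mathbb R^{p\times q}$ have as columns orthonormal leading $q$ eigenvectors (any choice) of $\frac1n\sum_{t=1}^nx_tx_t^\top$ (for $n$ large enough that $p_n\ge q$), and $y_t:=\frac1{\sqrt p}\widehat U^\top x_t\in\mathbb R^q$. Put $\widehat\Sigma_{a:b}:=\frac1{|I(a,b)|}\sum_{t\in I(a,b)}y_ty_t^\top$. QML objective. $J_n(\nu):=\nu\log\det(\widehat\Sigma_{0:\nu}+\varepsilon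 I_q)+(1-\nu)\log\det(\widehat\Sigma_{\nu:1}+\varepsilon I_q)$ for $\nu\in\mathcal D_n:=\{k/n:1\le k\le n-1\}$. *)

theory Defs
  imports
    "Jordan_Normal_Form.DL_Rank"
    "Jordan_Normal_Form.Char_Poly"
    "HOL-Library.Extended_Real"
    "HOL-Library.Liminf_Limsup"
begin

definition vec_norm2 :: "real vec \<Rightarrow> real" where
  "vec_norm2 v = sqrt (v \<bullet> v)"

(* The unit ball, rather than the unit sphere, keeps the supremum over a nonempty set
   when the matrix has no columns. *)
definition op_norm :: "real mat \<Rightarrow> real" where
  "op_norm A = (SUP v \<in> {v \<in> carrier_vec (dim_col A). vec_norm2 v \<le> 1}. vec_norm2 (A *\<^sub>v v))"

definition frob_norm :: "real mat \<Rightarrow> real" where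
  "frob_norm A = sqrt (\<Sum>i<dim_row A. \<Sum>j<dim_col A. (A $$ (i, j))\<^sup>2)"

definition mat_rank :: "real mat \<Rightarrow> nat" where
  "mat_rank A = vec_space.rank (dim_row A) A"

definition pos_semidef :: "nat \<Rightarrow> real mat \<Rightarrow> bool" where
  "pos_semidef d A \<longleftrightarrow> A \<in> carrier_mat d d \<and> transpose_mat A = A \<and>
     (\<forall>v \<in> carrier_vec d. v \<bullet> (A *\<^sub>v v) \<ge> 0)"

definition pos_def :: "nat \<Rightarrow> real mat \<Rightarrow> bool" where
  "pos_def d A \<longleftrightarrow> A \<in> carrier_mat d d \<and> transpose_mat A = A \<and>
     (\<forall>v \<in> carrier_vec d. v \<noteq> 0\<^sub>v d \<longrightarrow> v \<bullet> (A *\<^sub>v v) > 0)"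

(* Entrywise convergence; it is only used for sequences of matrices of the fixed
   dimension of the limit, where it agrees with convergence in any norm. *)
definition mat_tendsto :: "(nat \<Rightarrow> real mat) \<Rightarrow> real mat \<Rightarrow> bool" where
  "mat_tendsto A L \<longleftrightarrow>
     (\<forall>i<dim_row L. \<forall>j<dim_col L. (\<lambda>n. A n $$ (i, j)) \<longlonglongrightarrow> L $$ (i, j))"

(* The horizontal block matrix [A B]. *)
definition hcat :: "real mat \<Rightarrow> real mat \<Rightarrow> real mat" where
  "hcat A B = mat (dim_row A) (dim_col A + dim_col B)
     (\<lambda>(i, j). if j < dim_col A then A $$ (i, j) else B $$ (i, j - dim_col A))"

definition break_index :: "real \<Rightarrow> nat \<Rightarrow> nat" where
  "break_index \<theta> n = nat \<lfloor>\<theta> * real n\<rfloor>"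

definition time_block :: "nat \<Rightarrow> real \<Rightarrow> real \<Rightarrow> nat set" where
  "time_block n a b = {nat \<lfloor>a * real n\<rfloor> + 1 .. nat \<lfloor>b * real n\<rfloor>}"

(* The average over t in S of the outer products z_t z_t^T, for vectors of dimension d;
   it is the zero matrix if S is empty. *)
definition second_moment :: "nat \<Rightarrow> nat set \<Rightarrow> (nat \<Rightarrow> real vec) \<Rightarrow> real mat" where
  "second_moment d S z = mat d d (\<lambda>(i, j). (\<Sum>t\<in>S. z t $ i * z t $ j) / real (card S))"

(* The columns of U are orthonormal eigenvectors of the d x d matrix M for q largest
   eigenvalues counted with multiplicity: mu 0, ..., mu (d - 1) lists all roots of the
   characteristic polynomial, with q largest ones in front, and column j belongs to mu j.
   Neither the choice among tied eigenvalues nor the order of the columns is prescribed. *)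
definition leading_eigenvectors :: "nat \<Rightarrow> nat \<Rightarrow> real mat \<Rightarrow> real mat \<Rightarrow> bool" where
  "leading_eigenvectors d q M U \<longleftrightarrow>
     U \<in> carrier_mat d q \<and> transpose_mat U * U = 1\<^sub>m q \<and>
     (\<exists>\<mu> :: nat \<Rightarrow> real.
        char_poly M = (\<Prod>j<d. [:- \<mu> j, 1:]) \<and>
        (\<forall>i<q. \<forall>j\<in>{q..<d}. \<mu> j \<le> \<mu> i) \<and>
        (\<forall>j<q. M *\<^sub>v col U j = \<mu> j \<cdot>\<^sub>v col U j))"

definition pca_score :: "nat \<Rightarrow> real mat \<Rightarrow> (nat \<Rightarrow> real vec) \<Rightarrow> nat \<Rightarrow> real vec" where
  "pca_score d U x t = (1 / sqrt (real d)) \<cdot>\<^sub>v (transpose_mat U *\<^sub>v x t)"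

definition qml_objective :: "nat \<Rightarrow> real \<Rightarrow> nat \<Rightarrow> (nat \<Rightarrow> real vec) \<Rightarrow> real \<Rightarrow> real" where
  "qml_objective q \<epsilon> n y \<nu> =
     \<nu> * ln (det (second_moment q (time_block n 0 \<nu>) y + \<epsilon> \<cdot>\<^sub>m 1\<^sub>m q)) +
     (1 - \<nu>) * ln (det (second_moment q (time_block n \<nu> 1) y + \<epsilon> \<cdot>\<^sub>m 1\<^sub>m q))"

definition break_candidates :: "nat \<Rightarrow> real set" where
  "break_candidates n = {real k / real n | k. 1 \<le> k \<and> k \<le> n - 1}"

end

theory Submission
  imports Defs "Jordan_Normal_Form.Schur_Decomposition"
begin

text \<open>Write both regimes as one factor model \<open>x = L g + e\<close> with \<open>L = [\<Lambda>\<^sub>1 \<Lambda>\<^sub>2]\<close>. The Gram matrix of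
  \<open>L / sqrt p\<close> tends to a matrix of rank \<open>q\<close> and the error covariance is \<open>o(p)\<close>, so the sample covariance
  has only \<open>q\<close> eigenvalues that are not \<open>o(p)\<close>, and the leading eigenvectors capture all columns of
  \<open>L / sqrt p\<close> asymptotically. Hence the score loadings \<open>C = U\<^sup>T L / sqrt p\<close> satisfy \<open>C\<^sup>T C \<rightarrow> \<Sigma>\<^sub>\<Lambda>\<close>.
  The Frobenius distance between the two signal covariances depends on the loadings only through
  their Gram matrix, so (F3) carries over to the score covariances \<open>V\<^sub>1, V\<^sub>2\<close> of the two regimes.

  If \<open>\<theta>hat\<close> does not tend to \<open>\<theta>\<close>, choose a subsequence along which \<open>C\<close> converges and
  \<open>\<theta>hat \<rightarrow> s \<noteq> \<theta>\<close>. The objective at \<open>\<theta>\<close> tends to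
  \<open>\<theta> ln det (V\<^sub>1 + \<epsilon>) + (1 - \<theta>) ln det (V\<^sub>2 + \<epsilon>)\<close>. At \<open>\<theta>hat\<close> one of the two blocks mixes \<open>V\<^sub>1 \<noteq> V\<^sub>2\<close>, so by
  strict concavity of \<open>ln det\<close> the limit inferior is larger, which contradicts minimality.\<close>

section \<open>Inner products and homogeneous linear systems\<close>

text \<open>The columns of \<open>U\<close> are not unique: eigenvalues may tie, and eigenvectors
  may turn with \<open>n\<close>. So the score loadings \<open>C\<close> need not converge; only
  \<open>C^T C\<close> does. This forces the compactness argument and the detour of (F3) through a
  Gram matrix. For the same reason there is no limiting eigenvector to compare \<open>U\<close>
  with. Instead, the part of a loading outside the span of \<open>U\<close> is shown to be small: a
  direction orthogonal to \<open>U\<close> carries little variance of \<open>x\<close>, while a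
  large residual would carry much of it, the factor covariances being positive definite.

  The search is untrimmed, so one block may have a vanishing share of the sample. The moment limits
  are therefore derived for sums divided by \<open>n\<close>. At the boundary the ridge supplies
  only a lower bound, which is enough at a minimizer.

  Vectors are functions of which the indices below \<open>d\<close> are read: carrier conditions
  disappear, and the dimension \<open>p n\<close> may vary with \<open>n\<close>. The type
  \<open>mat\<close> is kept for determinants, rank and definiteness.\<close>

definition ip :: "nat \<Rightarrow> (nat \<Rightarrow> real) \<Rightarrow> (nat \<Rightarrow> real) \<Rightarrow> real" where
  "ip d u v = (\<Sum>i<d. u i * v i)"

lemma ip_commute: "ip d u v = ip d v u"
  by (simp add: ip_def mult.commute)

lemma ip_add_left: "ip d (\<lambda>i. u i + w i) v = ip d u v + ip d w v"
  by (simp add: ip_def distrib_right sum.distrib)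

lemma ip_diff_left: "ip d (\<lambda>i. u i - w i) v = ip d u v - ip d w v"
  by (simp add: ip_def left_diff_distrib sum_subtractf)

lemma ip_diff_right: "ip d v (\<lambda>i. u i - w i) = ip d v u - ip d v w"
  by (simp add: ip_def right_diff_distrib sum_subtractf)

lemma ip_sum_left: "ip d (\<lambda>i. \<Sum>k\<in>K. c k * u k i) v = (\<Sum>k\<in>K. c k * ip d (u k) v)"
  unfolding ip_def sum_distrib_right sum_distrib_left
  by (subst sum.swap) (simp add: mult.assoc)

lemma ip_sum_right: "ip d v (\<lambda>i. \<Sum>k\<in>K. c k * u k i) = (\<Sum>k\<in>K. c k * ip d v (u k))"
  using ip_sum_left[of d c u K v] by (simp add: ip_commute)

lemma ip_nonneg: "0 \<le> ip d u u"
  by (simp add: ip_def sum_nonneg)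

lemma ip_self_eq_0D: "ip d u u = 0 \<Longrightarrow> i < d \<Longrightarrow> u i = 0"
  unfolding ip_def by (subst (asm) sum_nonneg_eq_0_iff) auto

lemma ip_cong: "(\<And>i. i < d \<Longrightarrow> u i = u' i) \<Longrightarrow> (\<And>i. i < d \<Longrightarrow> v i = v' i) \<Longrightarrow> ip d u v = ip d u' v'"
  by (simp add: ip_def)

text \<open>The vector \<open>?V u - ?S v\<close> is \<open>?V\<close> times the part of
  \<open>u\<close> orthogonal to \<open>v\<close>, and its squared norm is
  \<open>?V * (?V * ?U - ?S\<^sup>2)\<close>. Cancelling \<open>?V\<close> needs
  \<open>?V > 0\<close>, hence the case split; over an infinite \<open>A\<close> all sums are
  0.\<close>

lemma sum_Cauchy_Schwarz:
  fixes u v :: "'a \<Rightarrow> real"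
  shows "(\<Sum>i\<in>A. u i * v i)\<^sup>2 \<le> (\<Sum>i\<in>A. (u i)\<^sup>2) * (\<Sum>i\<in>A. (v i)\<^sup>2)"
proof -
  let ?U = "\<Sum>i\<in>A. (u i)\<^sup>2" and ?V = "\<Sum>i\<in>A. (v i)\<^sup>2" and ?S = "\<Sum>i\<in>A. u i * v i"
  have "(\<Sum>i\<in>A. (?V * u i - ?S * v i)\<^sup>2) = ?V * (?V * ?U - ?S\<^sup>2)"
  proof -
    have "(\<Sum>i\<in>A. (?V * u i - ?S * v i)\<^sup>2)
       = (\<Sum>i\<in>A. ?V\<^sup>2 * (u i)\<^sup>2 - 2 * ?V * ?S * (u i * v i) + ?S\<^sup>2 * (v i)\<^sup>2)"
      by (intro sum.cong) (auto simp: power2_eq_square algebra_simps)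
    also have "\<dots> = ?V\<^sup>2 * ?U - 2 * ?V * ?S * ?S + ?S\<^sup>2 * ?V"
      by (simp add: sum.distrib sum_subtractf sum_distrib_left)
    finally show ?thesis by (simp add: power2_eq_square algebra_simps)
  qed
  moreover have "0 \<le> (\<Sum>i\<in>A. (?V * u i - ?S * v i)\<^sup>2)" by (intro sum_nonneg) auto
  ultimately have pos: "0 \<le> ?V * (?V * ?U - ?S\<^sup>2)" by simp
  show ?thesis
  proof (cases "?V = 0")
    case True
    show ?thesis
    proof (cases "finite A")
      case fin: True
      have "\<forall>i\<in>A. (v i)\<^sup>2 = 0"
        using True sum_nonneg_eq_0_iff[OF fin, of "\<lambda>i. (v i)\<^sup>2"] by auto
      then have "?S = 0" by (intro sum.neutral) auto
      then show ?thesis using True by simp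
    qed simp
  next
    case False
    have "?V \<ge> 0" by (intro sum_nonneg) auto
    with False have "?V > 0" by simp
    then show ?thesis using pos by (simp add: zero_le_mult_iff algebra_simps)
  qed
qed

lemma ip_Cauchy_Schwarz: "(ip d u v)\<^sup>2 \<le> ip d u u * ip d v v"
  using sum_Cauchy_Schwarz[of u v "{..<d}"] by (simp add: ip_def power2_eq_square)

text \<open>Pythagoras. The right side is the gap in Bessel's inequality, so equality there puts
  \<open>v\<close> into the span of the \<open>u j\<close>.\<close>

lemma orth_residual_norm:
  assumes fin: "finite J"
    and orth: "\<And>i j. i \<in> J \<Longrightarrow> j \<in> J \<Longrightarrow> ip d (u i) (u j) = (if i = j then 1 else 0)"
  shows "ip d (\<lambda>i. v i - (\<Sum>j\<in>J. ip d v (u j) * u j i)) (\<lambda>i. v i - (\<Sum>j\<in>J. ip d v (u j) * u j i))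
     = ip d v v - (\<Sum>j\<in>J. (ip d v (u j))\<^sup>2)"
proof -
  let ?P = "\<lambda>i. \<Sum>j\<in>J. ip d v (u j) * u j i"
  have vP: "ip d v ?P = (\<Sum>j\<in>J. (ip d v (u j))\<^sup>2)"
    by (simp add: ip_sum_right power2_eq_square)
  have "ip d ?P ?P = (\<Sum>j\<in>J. ip d v (u j) * ip d (u j) ?P)"
    by (rule ip_sum_left)
  also have "\<dots> = (\<Sum>j\<in>J. (ip d v (u j))\<^sup>2)"
  proof (intro sum.cong refl)
    fix j assume j: "j \<in> J"
    have "ip d (u j) ?P = (\<Sum>k\<in>J. ip d v (u k) * ip d (u j) (u k))"
      by (rule ip_sum_right)
    also have "\<dots> = (\<Sum>k\<in>J. if j = k then ip d v (u k) else 0)"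
      by (intro sum.cong refl) (use j orth in auto)
    also have "\<dots> = ip d v (u j)" using fin j by simp
    finally show "ip d v (u j) * ip d (u j) ?P = (ip d v (u j))\<^sup>2"
      by (simp add: power2_eq_square)
  qed
  finally have PP: "ip d ?P ?P = (\<Sum>j\<in>J. (ip d v (u j))\<^sup>2)" .
  have "ip d ?P v = ip d v ?P" by (rule ip_commute)
  then show ?thesis using vP PP by (simp add: ip_diff_left ip_diff_right)
qed

lemma ip_orth_residual:
  assumes "finite J"
    and "\<And>i j. i \<in> J \<Longrightarrow> j \<in> J \<Longrightarrow> ip d (u i) (u j) = (if i = j then 1 else 0)"
    and "k \<in> J"
  shows "ip d (\<lambda>i. v i - (\<Sum>j\<in>J. ip d v (u j) * u j i)) (u k) = 0"
proof -
  have "(\<Sum>j\<in>J. ip d v (u j) * ip d (u j) (u k)) = (\<Sum>j\<in>J. if j = k then ip d v (u j) else 0)"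
    by (intro sum.cong refl) (use assms in auto)
  also have "\<dots> = ip d v (u k)" using assms by simp
  finally show ?thesis by (simp add: ip_diff_left ip_sum_left)
qed

text \<open>Gaussian elimination: an equation with a nonzero coefficient at \<open>k0\<close> is
  solved for that unknown, which uses up one equation and one unknown.\<close>

lemma homogeneous_system_nontrivial:
  fixes a :: "'i \<Rightarrow> 'k \<Rightarrow> real"
  assumes "finite I" "finite K" "card I < card K"
  shows "\<exists>c. (\<exists>k\<in>K. c k \<noteq> 0) \<and> (\<forall>i\<in>I. (\<Sum>k\<in>K. a i k * c k) = 0)"
  using assms
proof (induction I arbitrary: a K rule: finite_induct)
  case empty
  then obtain k where "k \<in> K" by fastforce
  then show ?case by (intro exI[of _ "\<lambda>_. 1"]) auto
next
  case (insert i I)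
  show ?case
  proof (cases "\<forall>k\<in>K. a i k = 0")
    case True
    have "card I < card K" using insert by simp
    from insert.IH[OF insert.prems(1) this, of a] obtain c where
      "\<exists>k\<in>K. c k \<noteq> 0" "\<forall>i\<in>I. (\<Sum>k\<in>K. a i k * c k) = 0" by auto
    moreover have "(\<Sum>k\<in>K. a i k * c k) = 0" using True by (intro sum.neutral) auto
    ultimately show ?thesis by auto
  next
    case False
    then obtain k0 where k0: "k0 \<in> K" "a i k0 \<noteq> 0" by auto
    let ?K = "K - {k0}"
    let ?a = "\<lambda>j k. a j k - a j k0 * a i k / a i k0"
    have "card I < card ?K" using insert k0 by simp
    from insert.IH[OF _ this, of ?a] insert.prems obtain c where
      c: "\<exists>k\<in>?K. c k \<noteq> 0" "\<forall>j\<in>I. (\<Sum>k\<in>?K. ?a j k * c k) = 0" by auto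
    define s where "s = (\<Sum>k\<in>?K. a i k * c k)"
    \<comment> \<open>Back substitution: this value of the eliminated unknown makes equation
      \<open>i\<close> hold.\<close>
    define c' where "c' = c(k0 := - s / a i k0)"
    have split: "(\<Sum>k\<in>K. a j k * c' k) = (\<Sum>k\<in>?K. a j k * c k) - a j k0 * s / a i k0" for j
    proof -
      have "(\<Sum>k\<in>K. a j k * c' k) = a j k0 * c' k0 + (\<Sum>k\<in>?K. a j k * c' k)"
        using insert.prems k0 by (simp add: sum.remove)
      moreover have "(\<Sum>k\<in>?K. a j k * c' k) = (\<Sum>k\<in>?K. a j k * c k)"
        by (intro sum.cong) (auto simp: c'_def)
      ultimately show ?thesis by (simp add: c'_def)
    qed
    have "(\<Sum>k\<in>K. a j k * c' k) = 0" if "j \<in> I" for j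
    proof -
      have "(\<Sum>k\<in>?K. ?a j k * c k) = (\<Sum>k\<in>?K. a j k * c k - (a j k0 / a i k0) * (a i k * c k))"
        by (intro sum.cong refl) (simp add: algebra_simps)
      also have "\<dots> = (\<Sum>k\<in>?K. a j k * c k) - a j k0 * s / a i k0"
        by (simp add: s_def sum_subtractf sum_distrib_left sum_divide_distrib)
      finally show ?thesis using split c(2) that by simp
    qed
    moreover have "(\<Sum>k\<in>K. a i k * c' k) = 0"
      using split[of i] k0 by (simp add: s_def)
    moreover have "\<exists>k\<in>K. c' k \<noteq> 0" using c(1) by (auto simp: c'_def)
    ultimately show ?thesis by (intro exI[of _ c']) auto
  qed
qed

section \<open>Real symmetric matrices\<close>

text \<open>Gram-Schmidt on a basis that starts with \<open>v\<close> keeps \<open>v\<close> in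
  front. It yields orthogonal vectors of arbitrary length, so each is normalized; \<open>v\<close>
  has length 1 already.\<close>

lemma exists_orthogonal_mat_first_col:
  fixes v :: "real vec"
  assumes v: "v \<in> carrier_vec n" and v1: "v \<bullet> v = 1" and n: "n \<noteq> 0"
  shows "\<exists>W. W \<in> carrier_mat n n \<and> transpose_mat W * W = 1\<^sub>m n \<and> col W 0 = v"
proof -
  interpret cof_vec_space n "TYPE(real)" .
  have v0: "v \<noteq> 0\<^sub>v n" using v1 v by auto
  define b where "b = basis_completion v"
  from basis_completion[OF v v0, folded b_def]
  have dist_b: "distinct b" and indep: "\<not> lin_dep (set b)" and b: "set b \<subseteq> carrier_vec n"
    and hdb: "hd b = v" and len_b: "length b = n" by auto
  from hdb len_b n obtain vs where bv: "b = v # vs" by (cases b, auto)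
  define ws where "ws = gram_schmidt n b"
  from gram_schmidt_result[OF b dist_b indep refl, folded ws_def]
  have ws: "set ws \<subseteq> carrier_vec n" "corthogonal ws" "length ws = n" by (auto simp: len_b)
  from gram_schmidt_hd[OF v, of vs, folded bv] have hdws: "hd ws = v" unfolding ws_def .
  have wc: "ws ! i \<in> carrier_vec n" if "i < n" for i using ws that by auto
  have orth: "(ws ! i \<bullet> ws ! j = 0) = (i \<noteq> j)" if "i < n" "j < n" for i j
    using corthogonalD[OF ws(2), of i j] ws(3) that by (simp add: conjugate_vec_def scalar_prod_def)
  define us where "us = map (\<lambda>w. (1 / sqrt (w \<bullet> w)) \<cdot>\<^sub>v w) ws"
  define W where "W = mat_of_cols n us"
  have W: "W \<in> carrier_mat n n" unfolding W_def us_def by (auto simp: ws(3)[symmetric])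
  have colW: "col W i = (1 / sqrt (ws ! i \<bullet> ws ! i)) \<cdot>\<^sub>v ws ! i" if "i < n" for i
    using that ws wc[OF that] unfolding W_def us_def by (subst col_mat_of_cols) auto
  have "transpose_mat W * W = 1\<^sub>m n"
  proof (rule eq_matI)
    fix i j assume "i < dim_row (1\<^sub>m n :: real mat)" "j < dim_col (1\<^sub>m n :: real mat)"
    then have ij: "i < n" "j < n" by auto
    have "ws ! i \<bullet> ws ! i \<ge> 0" by (simp add: scalar_prod_def sum_nonneg)
    then have "ws ! i \<bullet> ws ! i > 0" using orth[OF ij(1) ij(1)] by simp
    then have "sqrt (ws ! i \<bullet> ws ! i) * sqrt (ws ! i \<bullet> ws ! i) = ws ! i \<bullet> ws ! i" "sqrt (ws ! i \<bullet> ws ! i) \<noteq> 0"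
      by auto
    then have s: "1 / sqrt (ws ! i \<bullet> ws ! i) * (1 / sqrt (ws ! i \<bullet> ws ! i) * (ws ! i \<bullet> ws ! i)) = 1"
      by (simp add: divide_simps)
    have "(transpose_mat W * W) $$ (i, j) = col W i \<bullet> col W j" using W ij by simp
    also have "\<dots> = (if i = j then 1 else 0)"
      using orth[OF ij] s wc[OF ij(1)] wc[OF ij(2)] by (auto simp: colW ij)
    finally show "(transpose_mat W * W) $$ (i, j) = 1\<^sub>m n $$ (i, j)" using ij by simp
  qed (use W in auto)
  moreover have "col W 0 = v"
  proof -
    have "ws ! 0 = v" using hdws ws(3) n by (cases ws) auto
    then show ?thesis using colW[of 0] n v1 by simp
  qed
  ultimately show ?thesis using W by blast
qed

lemma symmetric_mat_index:
  "A \<in> carrier_mat n n \<Longrightarrow> transpose_mat A = A \<Longrightarrow> i < n \<Longrightarrow> j < n \<Longrightarrow> A $$ (i, j) = A $$ (j, i)"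
  by (metis carrier_matD index_transpose_mat(1))

lemma unit_eigenvector_exists:
  fixes A :: "real mat"
  assumes A: "A \<in> carrier_mat n n" and root: "poly (char_poly A) e = 0"
  shows "\<exists>v \<in> carrier_vec n. v \<bullet> v = 1 \<and> A *\<^sub>v v = e \<cdot>\<^sub>v v"
proof -
  have "eigenvalue A e" using eigenvalue_root_char_poly[OF A] root by simp
  then obtain u where u: "u \<in> carrier_vec n" "u \<noteq> 0\<^sub>v n" "A *\<^sub>v u = e \<cdot>\<^sub>v u"
    using A by (auto simp: eigenvalue_def eigenvector_def)
  have "u \<bullet> u \<noteq> 0"
    using conjugate_square_eq_0_vec[OF u(1)] u(2) by (simp add: conjugate_vec_def scalar_prod_def)
  moreover have "u \<bullet> u \<ge> 0" by (simp add: scalar_prod_def sum_nonneg)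
  ultimately have pos: "u \<bullet> u > 0" by simp
  define c where "c = 1 / sqrt (u \<bullet> u)"
  have "c * (c * (u \<bullet> u)) = 1"
    using pos real_sqrt_mult_self[of "u \<bullet> u"] by (simp add: c_def field_simps)
  then have "(c \<cdot>\<^sub>v u) \<bullet> (c \<cdot>\<^sub>v u) = 1" using u by simp
  moreover have "A *\<^sub>v (c \<cdot>\<^sub>v u) = e \<cdot>\<^sub>v (c \<cdot>\<^sub>v u)"
    using u A by (simp add: mult_mat_vec smult_smult_assoc mult.commute)
  ultimately show ?thesis using u by (intro bexI[of _ "c \<cdot>\<^sub>v u"]) auto
qed

lemma similar_orthogonal:
  fixes A :: "real mat"
  assumes A: "A \<in> carrier_mat n n" and W: "W \<in> carrier_mat n n" and WW: "transpose_mat W * W = 1\<^sub>m n"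
  shows "char_poly (transpose_mat W * A * W) = char_poly A" "W * transpose_mat W = 1\<^sub>m n"
    "W * (transpose_mat W * A * W) * transpose_mat W = A"
proof -
  have Wt: "transpose_mat W \<in> carrier_mat n n" using W by simp
  show WW': "W * transpose_mat W = 1\<^sub>m n" by (rule mat_mult_left_right_inverse[OF Wt W WW])
  have "similar_mat_wit (transpose_mat W * A * W) A (transpose_mat W) W"
    by (rule similar_mat_witI[of _ _ n]) (use A W Wt WW WW' in auto)
  then show "char_poly (transpose_mat W * A * W) = char_poly A"
    by (intro char_poly_similar) (auto simp: similar_mat_def)
  have "W * (transpose_mat W * A * W) * transpose_mat W = (W * transpose_mat W) * A * (W * transpose_mat W)"
    using W Wt A by (simp add: assoc_mult_mat[of _ n n _ n _ n])
  then show "W * (transpose_mat W * A * W) * transpose_mat W = A" using WW' A by simp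
qed

text \<open>Deflation. Conjugation by an orthogonal matrix whose first column is a unit eigenvector
  makes the first column a multiple of a unit vector, by symmetry the first row too, and a smaller
  symmetric block remains. The diagonal follows the order of \<open>es\<close>, so a prescribed
  numbering of the eigenvalues survives.\<close>

lemma real_symmetric_diagonalization:
  fixes A :: "real mat"
  assumes "A \<in> carrier_mat n n" "transpose_mat A = A" "char_poly A = (\<Prod>e\<leftarrow>es. [:- e, 1:])"
  shows "\<exists>W. W \<in> carrier_mat n n \<and> transpose_mat W * W = 1\<^sub>m n \<and> length es = n \<and>
     transpose_mat W * A * W = mat n n (\<lambda>(i, j). if i = j then es ! i else 0)"
  using assms
proof (induction es arbitrary: n A)
  case Nil
  then have n: "n = 0" using degree_monic_char_poly[of A n] by auto
  show ?case by (rule exI[of _ "1\<^sub>m 0"]) (use Nil n in auto)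
next
  case (Cons e es n A)
  note A = Cons.prems(1) and sym = Cons.prems(2)
  have mon: "monic (\<Prod>e\<leftarrow>es. [:- e, 1:])" by (rule monic_prod_list) auto
  have "degree (char_poly A) = Suc (degree (\<Prod>e\<leftarrow>es. [:- e, 1:]))"
    unfolding Cons.prems(3) list.map prod_list.Cons by (subst degree_mult_eq) (use mon in auto)
  with degree_monic_char_poly[OF A] obtain m where n: "n = Suc m" by metis
  obtain v where v: "v \<in> carrier_vec n" "v \<bullet> v = 1" "A *\<^sub>v v = e \<cdot>\<^sub>v v"
    using unit_eigenvector_exists[OF A, of e] Cons.prems(3) by auto
  obtain W where W: "W \<in> carrier_mat n n" and WW: "transpose_mat W * W = 1\<^sub>m n" and W0: "col W 0 = v"
    using exists_orthogonal_mat_first_col[OF v(1,2)] n by auto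
  define B where "B = transpose_mat W * A * W"
  have B: "B \<in> carrier_mat n n" using W A by (simp add: B_def)
  have Bsym: "transpose_mat B = B"
  proof -
    have "transpose_mat B = transpose_mat W * transpose_mat (transpose_mat W * A)"
      unfolding B_def by (rule transpose_mult[of _ n n _ n]) (use W A in auto)
    also have "transpose_mat (transpose_mat W * A) = transpose_mat A * transpose_mat (transpose_mat W)"
      by (rule transpose_mult[of _ n n _ n]) (use W A in auto)
    also have "\<dots> = A * W" using sym by simp
    finally show ?thesis unfolding B_def using assoc_mult_mat[of "transpose_mat W" n n A n W n] W A by simp
  qed
  have B0: "B $$ (i, 0) = (if i = 0 then e else 0)" if i: "i < n" for i
  proof -
    have "B = transpose_mat W * (A * W)" unfolding B_def using W A by (simp add: assoc_mult_mat[of _ n n _ n _ n])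
    then have "B $$ (i, 0) = col W i \<bullet> col (A * W) 0" using W A i n by simp
    also have "col (A * W) 0 = e \<cdot>\<^sub>v v" using col_mult2[OF A W, of 0] n v(3) W0 by simp
    also have "col W i \<bullet> (e \<cdot>\<^sub>v v) = e * (col W i \<bullet> col W 0)" using W v W0 i by simp
    also have "col W i \<bullet> col W 0 = (transpose_mat W * W) $$ (i, 0)" using W i n by simp
    also have "\<dots> = (if i = 0 then 1 else 0)" unfolding WW using i n by simp
    finally show ?thesis by simp
  qed
  note Bij = symmetric_mat_index[OF B Bsym]
  define A3 where "A3 = mat m m (\<lambda>(i, j). B $$ (Suc i, Suc j))"
  have A3: "A3 \<in> carrier_mat m m" by (simp add: A3_def)
  have A3sym: "transpose_mat A3 = A3"
    by (rule eq_matI) (auto simp: A3_def n Bij)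
  let ?E = "mat 1 1 (\<lambda>_. e)"
  have Bblock: "B = four_block_mat ?E (0\<^sub>m 1 m) (0\<^sub>m m 1) A3"
  proof (rule eq_matI)
    fix i j assume "i < dim_row (four_block_mat ?E (0\<^sub>m 1 m) (0\<^sub>m m 1) A3)"
      "j < dim_col (four_block_mat ?E (0\<^sub>m 1 m) (0\<^sub>m m 1) A3)"
    then have ij: "i < n" "j < n" using A3 n by auto
    show "B $$ (i, j) = four_block_mat ?E (0\<^sub>m 1 m) (0\<^sub>m m 1) A3 $$ (i, j)"
      using ij A3 n B0[of i] B0[of j] Bij[of i j]
      by (cases i; cases j) (auto simp: A3_def)
  qed (use B A3 n in auto)
  have "char_poly B = char_poly ?E * char_poly A3"
    unfolding Bblock by (rule char_poly_four_block_zeros_col) (use A3 in auto)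
  moreover have "char_poly ?E = [:- e, 1:]" by (simp add: char_poly_defs det_def sign_def)
  moreover have "char_poly B = char_poly A" unfolding B_def by (rule similar_orthogonal(1)[OF A W WW])
  \<comment> \<open>Cancelling the factor of \<open>e\<close> leaves the remaining list for the
    smaller block, as the induction hypothesis demands.\<close>
  ultimately have "[:- e, 1:] * char_poly A3 = [:- e, 1:] * (\<Prod>e\<leftarrow>es. [:- e, 1:])"
    using Cons.prems(3) by simp
  then have "char_poly A3 = (\<Prod>e\<leftarrow>es. [:- e, 1:])" by (simp only: mult_cancel_left) simp
  from Cons.IH[OF A3 A3sym this] obtain V where V: "V \<in> carrier_mat m m"
    and VV: "transpose_mat V * V = 1\<^sub>m m" and len: "length es = m"
    and VAV: "transpose_mat V * A3 * V = mat m m (\<lambda>(i, j). if i = j then es ! i else 0)" by auto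
  define Z where "Z = four_block_mat (1\<^sub>m 1) (0\<^sub>m 1 m) (0\<^sub>m m 1) V"
  have Z: "Z \<in> carrier_mat n n"
    using four_block_carrier_mat[OF one_carrier_mat[of 1] V, of "0\<^sub>m 1 m" "0\<^sub>m m 1"] n by (simp add: Z_def)
  have Zt: "transpose_mat Z = four_block_mat (1\<^sub>m 1) (0\<^sub>m 1 m) (0\<^sub>m m 1) (transpose_mat V)"
    unfolding Z_def by (subst transpose_four_block_mat[of _ 1 1 _ m _ m]) (use V in auto)
  have ZZ: "transpose_mat Z * Z = 1\<^sub>m n"
  proof -
    have "transpose_mat Z * Z = four_block_mat (1\<^sub>m 1) (0\<^sub>m 1 m) (0\<^sub>m m 1) (transpose_mat V * V)"
      unfolding Zt unfolding Z_def
      by (subst mult_four_block_mat[of _ 1 1 _ m _ m _ _ 1 _ m]) (use V in auto)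
    then show ?thesis unfolding VV n by (simp add: four_block_one_mat)
  qed
  have ZBZ: "transpose_mat Z * B * Z = mat n n (\<lambda>(i, j). if i = j then (e # es) ! i else 0)"
  proof -
    have "transpose_mat Z * B = four_block_mat ?E (0\<^sub>m 1 m) (0\<^sub>m m 1) (transpose_mat V * A3)"
      unfolding Zt Bblock
      by (subst mult_four_block_mat[of _ 1 1 _ m _ m _ _ 1 _ m]) (use V A3 in auto)
    also have "\<dots> * Z = four_block_mat ?E (0\<^sub>m 1 m) (0\<^sub>m m 1) (transpose_mat V * A3 * V)"
      unfolding Z_def
      by (subst mult_four_block_mat[of _ 1 1 _ m _ m _ _ 1 _ m]) (use V A3 in auto)
    also have "\<dots> = mat n n (\<lambda>(i, j). if i = j then (e # es) ! i else 0)"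
      unfolding VAV by (rule eq_matI) (auto simp: n nth_Cons')
    finally show ?thesis .
  qed
  show ?case
  proof (intro exI[of _ "W * Z"] conjI)
    have t: "transpose_mat (W * Z) = transpose_mat Z * transpose_mat W"
      by (rule transpose_mult[of _ n n _ n]) (use W Z in auto)
    show "W * Z \<in> carrier_mat n n" using W Z by simp
    have "transpose_mat (W * Z) * (W * Z) = transpose_mat Z * (transpose_mat W * W) * Z"
      unfolding t using W Z by (simp add: assoc_mult_mat[of _ n n _ n _ n])
    then show "transpose_mat (W * Z) * (W * Z) = 1\<^sub>m n" unfolding WW using Z ZZ by simp
    show "length (e # es) = n" using len n by simp
    have "transpose_mat (W * Z) * A * (W * Z) = transpose_mat Z * B * Z"
      unfolding t B_def using W Z A by (simp add: assoc_mult_mat[of _ n n _ n _ n])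
    then show "transpose_mat (W * Z) * A * (W * Z) = mat n n (\<lambda>(i, j). if i = j then (e # es) ! i else 0)"
      unfolding ZBZ .
  qed
qed

text \<open>Over the complex numbers the polynomial splits. For an eigenvector
  \<open>x + i y\<close> with eigenvalue \<open>a\<close>, the symmetry
  \<open>y^T A x = x^T A y\<close> reads \<open>Im a * (|x|^2 + |y|^2) = 0\<close>. So all roots are
  real, and the factorization descends because the embedding of real into complex polynomials is
  injective.\<close>

lemma real_symmetric_char_poly_splits:
  fixes A :: "real mat"
  assumes A: "A \<in> carrier_mat n n" and sym: "transpose_mat A = A"
  shows "\<exists>es. char_poly A = (\<Prod>e\<leftarrow>es. [:- e, 1:])"
proof -
  let ?C = "map_mat complex_of_real A"
  have C: "?C \<in> carrier_mat n n" using A by simp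
  obtain as where as: "char_poly ?C = (\<Prod>a\<leftarrow>as. [:- a, 1:])"
    using char_poly_factorized[OF C] by auto
  note Aij = symmetric_mat_index[OF A sym]
  have real: "Im a = 0" if a: "a \<in> set as" for a
  proof -
    have "poly (char_poly ?C) a = 0" unfolding as using a by (induction as) auto
    then have "eigenvalue ?C a" using eigenvalue_root_char_poly[OF C] by simp
    then obtain v where v: "v \<in> carrier_vec n" "v \<noteq> 0\<^sub>v n" "?C *\<^sub>v v = a \<cdot>\<^sub>v v"
      using C by (auto simp: eigenvalue_def eigenvector_def)
    define x y where "x = (\<lambda>i. Re (v $ i))" and "y = (\<lambda>i. Im (v $ i))"
    have row: "(\<Sum>j<n. complex_of_real (A $$ (i, j)) * v $ j) = a * v $ i" if i: "i < n" for i
    proof -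
      have "(?C *\<^sub>v v) $ i = (\<Sum>j<n. complex_of_real (A $$ (i, j)) * v $ j)"
        using A v(1) i by (simp add: scalar_prod_def atLeast0LessThan)
      then show ?thesis using v i by simp
    qed
    have Ax: "(\<Sum>j<n. A $$ (i, j) * x j) = Re a * x i - Im a * y i" if "i < n" for i
      using arg_cong[OF row[OF that], of Re] by (simp add: x_def y_def)
    have Ay: "(\<Sum>j<n. A $$ (i, j) * y j) = Re a * y i + Im a * x i" if "i < n" for i
      using arg_cong[OF row[OF that], of Im] by (simp add: x_def y_def)
    have "(\<Sum>i<n. y i * (\<Sum>j<n. A $$ (i, j) * x j)) = (\<Sum>i<n. x i * (\<Sum>j<n. A $$ (i, j) * y j))"
      unfolding sum_distrib_left
      by (subst sum.swap) (intro sum.cong refl, auto simp: Aij)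
    then have "(\<Sum>i<n. y i * (Re a * x i - Im a * y i)) = (\<Sum>i<n. x i * (Re a * y i + Im a * x i))"
      by (simp add: Ax Ay)
    then have "0 = (\<Sum>i<n. x i * (Re a * y i + Im a * x i) - y i * (Re a * x i - Im a * y i))"
      by (simp add: sum_subtractf)
    also have "\<dots> = Im a * (\<Sum>i<n. (x i)\<^sup>2 + (y i)\<^sup>2)"
      unfolding sum_distrib_left by (intro sum.cong refl) (simp add: power2_eq_square algebra_simps)
    finally have z: "Im a = 0 \<or> (\<Sum>i<n. (x i)\<^sup>2 + (y i)\<^sup>2) = 0" by simp
    have "(\<Sum>i<n. (x i)\<^sup>2 + (y i)\<^sup>2) \<noteq> 0"
    proof
      assume "(\<Sum>i<n. (x i)\<^sup>2 + (y i)\<^sup>2) = 0"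
      then have "\<forall>i<n. (x i)\<^sup>2 + (y i)\<^sup>2 = 0" by (subst (asm) sum_nonneg_eq_0_iff) auto
      then have "\<forall>i<n. v $ i = 0" by (simp add: x_def y_def complex_eq_iff sum_power2_eq_zero_iff)
      then show False using v by auto
    qed
    with z show ?thesis by simp
  qed
  interpret h: map_poly_inj_idom_hom complex_of_real ..
  have "map_poly complex_of_real (char_poly A) = char_poly ?C"
    by (simp add: of_real_hom.char_poly_hom[OF A])
  also have "\<dots> = (\<Prod>a\<leftarrow>as. map_poly complex_of_real [:- Re a, 1:])"
    unfolding as using real by (intro arg_cong[where f = prod_list] map_cong refl) (auto simp: complex_eq_iff)
  also have "\<dots> = map_poly complex_of_real (\<Prod>e\<leftarrow>map Re as. [:- e, 1:])"
    by (simp add: h.hom_prod_list comp_def)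
  finally have "char_poly A = (\<Prod>e\<leftarrow>map Re as. [:- e, 1:])"
    by (rule injD[OF h.inj_f])
  then show ?thesis by blast
qed

text \<open>The spectral decomposition. The middle clause resolves the identity; it yields Parseval
  and allows a multiple of the identity to be added to \<open>A\<close> by shifting
  \<open>\<mu>\<close>.\<close>

definition eigenbasis :: "nat \<Rightarrow> (nat \<Rightarrow> nat \<Rightarrow> real) \<Rightarrow> (nat \<Rightarrow> real) \<Rightarrow> (nat \<Rightarrow> nat \<Rightarrow> real) \<Rightarrow> bool" where
  "eigenbasis n A \<mu> w \<longleftrightarrow>
     (\<forall>i<n. \<forall>j<n. ip n (w i) (w j) = (if i = j then 1 else 0)) \<and>
     (\<forall>i<n. \<forall>j<n. (\<Sum>k<n. w k i * w k j) = (if i = j then 1 else 0)) \<and>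
     (\<forall>i<n. \<forall>j<n. A i j = (\<Sum>k<n. \<mu> k * w k i * w k j))"

lemma eigenbasis_orthonormal:
  "eigenbasis n A \<mu> w \<Longrightarrow> i < n \<Longrightarrow> j < n \<Longrightarrow> ip n (w i) (w j) = (if i = j then 1 else 0)"
  by (simp add: eigenbasis_def)

lemma eigenbasis_complete:
  "eigenbasis n A \<mu> w \<Longrightarrow> i < n \<Longrightarrow> j < n \<Longrightarrow> (\<Sum>k<n. w k i * w k j) = (if i = j then 1 else 0)"
  by (simp add: eigenbasis_def)

lemma eigenbasis_expansion:
  "eigenbasis n A \<mu> w \<Longrightarrow> i < n \<Longrightarrow> j < n \<Longrightarrow> A i j = (\<Sum>k<n. \<mu> k * w k i * w k j)"
  by (simp add: eigenbasis_def)

text \<open>The numbering of the eigenvalues is kept: in \<open>leading_eigenvectors\<close> one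
  index names both an eigenvalue and a column of \<open>U\<close>, and a reordering would lose this
  link.\<close>

lemma eigenbasis_of_char_poly:
  fixes A :: "real mat"
  assumes A: "A \<in> carrier_mat n n" and sym: "transpose_mat A = A"
    and cp: "char_poly A = (\<Prod>j<n. [:- \<mu> j, 1:])"
  shows "\<exists>w. eigenbasis n (\<lambda>i j. A $$ (i, j)) \<mu> w"
proof -
  have "char_poly A = (\<Prod>e\<leftarrow>map \<mu> [0..<n]. [:- e, 1:])"
    unfolding cp by (simp add: interv_sum_list_conv_sum_set_nat prod.list_conv_set_nth atLeast0LessThan comp_def)
  from real_symmetric_diagonalization[OF A sym this] obtain W where W: "W \<in> carrier_mat n n"
    and WW: "transpose_mat W * W = 1\<^sub>m n"
    and D: "transpose_mat W * A * W = mat n n (\<lambda>(i, j). if i = j then map \<mu> [0..<n] ! i else 0)" by auto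
  have WW': "W * transpose_mat W = 1\<^sub>m n" by (rule similar_orthogonal(2)[OF A W WW])
  define w where "w = (\<lambda>k i. W $$ (i, k))"
  have o: "ip n (w i) (w j) = (if i = j then 1 else 0)" if "i < n" "j < n" for i j
    using arg_cong[OF WW, of "\<lambda>M. M $$ (i, j)"] W that
    by (simp add: scalar_prod_def ip_def w_def atLeast0LessThan)
  have c: "(\<Sum>k<n. w k i * w k j) = (if i = j then 1 else 0)" if "i < n" "j < n" for i j
    using arg_cong[OF WW', of "\<lambda>M. M $$ (i, j)"] W that
    by (simp add: scalar_prod_def ip_def w_def atLeast0LessThan)
  have e: "A $$ (i, j) = (\<Sum>k<n. \<mu> k * w k i * w k j)" if ij: "i < n" "j < n" for i j
  proof -
    let ?D = "mat n n (\<lambda>(i, j). if i = j then map \<mu> [0..<n] ! i else 0)"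
    have "(W * ?D) $$ (i, k) = \<mu> k * W $$ (i, k)" if k: "k < n" for k
    proof -
      have "(W * ?D) $$ (i, k) = (\<Sum>l<n. W $$ (i, l) * ?D $$ (l, k))"
        using W ij k by (simp add: scalar_prod_def atLeast0LessThan)
      also have "\<dots> = (\<Sum>l<n. if l = k then W $$ (i, k) * \<mu> k else 0)"
        by (intro sum.cong refl) (use k in auto)
      finally show ?thesis using k by simp
    qed
    then have "(W * ?D * transpose_mat W) $$ (i, j) = (\<Sum>k<n. \<mu> k * W $$ (i, k) * W $$ (j, k))"
      using W ij by (simp add: scalar_prod_def atLeast0LessThan del: index_mult_mat(1) add: index_mult_mat(1)[of i "W * ?D"])
    then show ?thesis using similar_orthogonal(3)[OF A W WW] D by (simp add: w_def)
  qed
  show ?thesis unfolding eigenbasis_def using o c e by blast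
qed

lemma eigenbasis_exists:
  fixes A :: "real mat"
  assumes A: "A \<in> carrier_mat n n" and sym: "transpose_mat A = A"
  shows "\<exists>\<mu> w. eigenbasis n (\<lambda>i j. A $$ (i, j)) \<mu> w"
proof -
  obtain es where es: "char_poly A = (\<Prod>e\<leftarrow>es. [:- e, 1:])"
    using real_symmetric_char_poly_splits[OF A sym] by auto
  have "length es = n" using real_symmetric_diagonalization[OF A sym es] by auto
  then have "char_poly A = (\<Prod>j<n. [:- (es ! j), 1:])"
    unfolding es by (simp add: prod.list_conv_set_nth atLeast0LessThan)
  from eigenbasis_of_char_poly[OF A sym this] show ?thesis by blast
qed

section \<open>Quadratic forms, definiteness and determinants through the spectral
  decomposition\<close>

definition qform :: "nat \<Rightarrow> (nat \<Rightarrow> nat \<Rightarrow> real) \<Rightarrow> (nat \<Rightarrow> real) \<Rightarrow> real" where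
  "qform d A v = (\<Sum>i<d. \<Sum>j<d. v i * A i j * v j)"

lemma qform_mat: "A \<in> carrier_mat d d \<Longrightarrow> v \<in> carrier_vec d \<Longrightarrow>
    v \<bullet> (A *\<^sub>v v) = qform d (\<lambda>i j. A $$ (i, j)) (\<lambda>i. v $ i)"
  by (simp add: qform_def scalar_prod_def atLeast0LessThan sum_distrib_left mult.assoc)

lemma qform_eigenbasis:
  assumes "eigenbasis n A \<mu> w"
  shows "qform n A v = (\<Sum>k<n. \<mu> k * (ip n (w k) v)\<^sup>2)"
proof -
  have "qform n A v = (\<Sum>i<n. \<Sum>j<n. \<Sum>k<n. \<mu> k * (w k i * v i) * (w k j * v j))"
    unfolding qform_def
  proof (intro sum.cong refl)
    fix i j assume "i \<in> {..<n}" "j \<in> {..<n}"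
    then show "v i * A i j * v j = (\<Sum>k<n. \<mu> k * (w k i * v i) * (w k j * v j))"
      by (simp add: eigenbasis_expansion[OF assms] sum_distrib_left sum_distrib_right algebra_simps)
  qed
  also have "\<dots> = (\<Sum>i<n. \<Sum>k<n. \<Sum>j<n. \<mu> k * (w k i * v i) * (w k j * v j))"
    by (intro sum.cong refl sum.swap)
  also have "\<dots> = (\<Sum>k<n. \<Sum>i<n. \<Sum>j<n. \<mu> k * (w k i * v i) * (w k j * v j))"
    by (rule sum.swap)
  also have "\<dots> = (\<Sum>k<n. \<mu> k * (ip n (w k) v)\<^sup>2)"
    by (intro sum.cong refl) (simp add: ip_def power2_eq_square sum_product, simp add: sum_distrib_left mult.assoc)
  finally show ?thesis .
qed

text \<open>The same \<open>w\<close> diagonalizes the identity, with all eigenvalues equal to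
  1.\<close>

lemma eigenbasis_Parseval:
  assumes "eigenbasis n A \<mu> w"
  shows "(\<Sum>k<n. (ip n (w k) v)\<^sup>2) = ip n v v"
proof -
  have "eigenbasis n (\<lambda>i j. if i = j then 1 else 0) (\<lambda>_. 1) w"
    using assms by (simp add: eigenbasis_def)
  from qform_eigenbasis[OF this, of v]
  have "(\<Sum>k<n. (ip n (w k) v)\<^sup>2) = (\<Sum>i<n. \<Sum>j<n. v i * (if i = j then 1 else 0) * v j)"
    by (simp add: qform_def)
  also have "\<dots> = (\<Sum>i<n. \<Sum>j<n. if i = j then v i * v j else 0)"
    by (intro sum.cong refl) auto
  also have "\<dots> = ip n v v" by (simp add: ip_def)
  finally show ?thesis .
qed

lemma eigenbasis_qform_basis:
  assumes "eigenbasis n A \<mu> w" "k < n"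
  shows "qform n A (w k) = \<mu> k"
proof -
  have "qform n A (w k) = (\<Sum>l<n. if l = k then \<mu> l else 0)"
    unfolding qform_eigenbasis[OF assms(1)]
    by (intro sum.cong refl) (use assms eigenbasis_orthonormal[OF assms(1)] in auto)
  then show ?thesis using assms(2) by simp
qed

lemma det_eigenbasis:
  assumes A: "A \<in> carrier_mat n n" and eb: "eigenbasis n (\<lambda>i j. A $$ (i, j)) \<mu> w"
  shows "det A = (\<Prod>k<n. \<mu> k)"
proof -
  define W where "W = mat n n (\<lambda>(i, k). w k i)"
  define D where "D = mat n n (\<lambda>(i, j). if i = j then \<mu> i else 0)"
  have W: "W \<in> carrier_mat n n" and D: "D \<in> carrier_mat n n" by (auto simp: W_def D_def)
  have WW: "transpose_mat W * W = 1\<^sub>m n"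
    by (rule eq_matI) (auto simp: W_def scalar_prod_def atLeast0LessThan eigenbasis_orthonormal[OF eb, unfolded ip_def])
  have WD: "W * D = mat n n (\<lambda>(i, k). \<mu> k * w k i)"
  proof (rule eq_matI)
    fix i k assume "i < dim_row (mat n n (\<lambda>(i, k). \<mu> k * w k i))" "k < dim_col (mat n n (\<lambda>(i, k). \<mu> k * w k i))"
    then have ik: "i < n" "k < n" by auto
    have "(W * D) $$ (i, k) = (\<Sum>l<n. w l i * (if l = k then \<mu> l else 0))"
      using ik by (simp add: W_def D_def scalar_prod_def atLeast0LessThan)
    also have "\<dots> = (\<Sum>l<n. if l = k then \<mu> k * w k i else 0)" by (intro sum.cong) auto
    finally show "(W * D) $$ (i, k) = mat n n (\<lambda>(i, k). \<mu> k * w k i) $$ (i, k)" using ik by simp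
  qed (auto simp: W_def D_def)
  have "A = W * D * transpose_mat W"
    unfolding WD by (rule eq_matI)
      (use A in \<open>auto simp: W_def scalar_prod_def atLeast0LessThan eigenbasis_expansion[OF eb]\<close>)
  then have "det A = det W * det D * det (transpose_mat W)"
    using W D by (simp add: det_mult[of _ n])
  also have "\<dots> = det (transpose_mat W * W) * det D"
    using W by (simp add: det_mult[of _ n])
  also have "\<dots> = det D" by (simp add: WW)
  also have "\<dots> = prod_list (diag_mat D)"
    by (rule det_upper_triangular[OF _ D]) (auto simp: upper_triangular_def D_def)
  also have "\<dots> = (\<Prod>k<n. \<mu> k)"
    by (simp add: diag_mat_def D_def prod.list_conv_set_nth atLeast0LessThan)
  finally show ?thesis .
qed

lemma pos_semidef_qform_nonneg:
  assumes "pos_semidef d A"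
  shows "0 \<le> qform d (\<lambda>i j. A $$ (i, j)) v"
proof -
  have "0 \<le> vec d v \<bullet> (A *\<^sub>v vec d v)" using assms by (simp add: pos_semidef_def)
  also have "\<dots> = qform d (\<lambda>i j. A $$ (i, j)) (\<lambda>i. vec d v $ i)"
    using assms by (intro qform_mat) (auto simp: pos_semidef_def)
  also have "\<dots> = qform d (\<lambda>i j. A $$ (i, j)) v" by (simp add: qform_def)
  finally show ?thesis .
qed

lemma pos_def_qform_pos:
  assumes "pos_def d A" "k < d" "v k \<noteq> 0"
  shows "0 < qform d (\<lambda>i j. A $$ (i, j)) v"
proof -
  have "vec d v \<noteq> 0\<^sub>v d" using assms(2,3) by (metis index_vec index_zero_vec(1))
  then have "0 < vec d v \<bullet> (A *\<^sub>v vec d v)" using assms by (simp add: pos_def_def)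
  also have "\<dots> = qform d (\<lambda>i j. A $$ (i, j)) (\<lambda>i. vec d v $ i)"
    using assms by (intro qform_mat) (auto simp: pos_def_def)
  also have "\<dots> = qform d (\<lambda>i j. A $$ (i, j)) v" by (simp add: qform_def)
  finally show ?thesis .
qed

lemma pos_defI:
  assumes "A \<in> carrier_mat d d" "\<And>i j. i < d \<Longrightarrow> j < d \<Longrightarrow> A $$ (i, j) = A $$ (j, i)"
    and "\<And>v k. k < d \<Longrightarrow> v k \<noteq> 0 \<Longrightarrow> 0 < qform d (\<lambda>i j. A $$ (i, j)) v"
  shows "pos_def d A"
  unfolding pos_def_def
proof (intro conjI ballI impI)
  show "transpose_mat A = A" using assms(1,2) by (intro eq_matI) auto
  fix v :: "real vec" assume v: "v \<in> carrier_vec d" "v \<noteq> 0\<^sub>v d"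
  then obtain k where "k < d" "v $ k \<noteq> 0" by (metis eq_vecI carrier_vecD index_zero_vec)
  from assms(3)[of k "\<lambda>i. v $ i", OF this] show "0 < v \<bullet> (A *\<^sub>v v)"
    using qform_mat[OF assms(1) v(1)] by simp
qed (use assms in auto)

lemma pos_def_eigenvalues_pos:
  assumes "pos_def d A" "eigenbasis d (\<lambda>i j. A $$ (i, j)) \<mu> w" "k < d"
  shows "0 < \<mu> k"
proof -
  have "ip d (w k) (w k) = 1" using eigenbasis_orthonormal[OF assms(2,3,3)] by simp
  then have "\<exists>i<d. w k i \<noteq> 0" unfolding ip_def by (metis (no_types, lifting) lessThan_iff mult_zero_left sum.neutral zero_neq_one)
  then show ?thesis
    using pos_def_qform_pos[OF assms(1)] eigenbasis_qform_basis[OF assms(2,3)] by metis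
qed

lemma pos_def_lower_bound:
  assumes "pos_def d A"
  shows "\<exists>\<delta>>0. \<forall>v. \<delta> * ip d v v \<le> qform d (\<lambda>i j. A $$ (i, j)) v"
proof -
  obtain \<mu> w where eb: "eigenbasis d (\<lambda>i j. A $$ (i, j)) \<mu> w"
    using eigenbasis_exists assms unfolding pos_def_def by blast
  \<comment> \<open>The least eigenvalue, capped at 1; the 1 keeps the set nonempty when
    \<open>d = 0\<close>.\<close>
  define \<delta> where "\<delta> = Min (insert 1 (\<mu> ` {..<d}))"
  have "\<delta> > 0" unfolding \<delta>_def using pos_def_eigenvalues_pos[OF assms eb] by (subst Min_gr_iff) auto
  moreover have "\<delta> \<le> \<mu> k" if "k < d" for k unfolding \<delta>_def using that by (intro Min_le) auto
  then have "\<delta> * ip d v v \<le> qform d (\<lambda>i j. A $$ (i, j)) v" for v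
    unfolding qform_eigenbasis[OF eb] eigenbasis_Parseval[OF eb, symmetric] sum_distrib_left
    by (intro sum_mono mult_right_mono) auto
  ultimately show ?thesis by blast
qed

lemma pos_def_det_pos:
  assumes "pos_def d A"
  shows "0 < det A"
proof -
  have A: "A \<in> carrier_mat d d" using assms by (simp add: pos_def_def)
  obtain \<mu> w where eb: "eigenbasis d (\<lambda>i j. A $$ (i, j)) \<mu> w"
    using eigenbasis_exists assms unfolding pos_def_def by blast
  show ?thesis unfolding det_eigenbasis[OF A eb]
    using pos_def_eigenvalues_pos[OF assms eb] by (intro prod_pos) auto
qed

text \<open>The ridge moves every eigenvalue \<open>\<mu> k \<ge> 0\<close> to
  \<open>\<mu> k + \<epsilon>\<close>. The bound does not depend on \<open>A\<close>, so it survives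
  when a short block has an unbounded average.\<close>

lemma det_pos_semidef_plus_scalar:
  assumes "pos_semidef d A" "0 \<le> \<epsilon>"
  shows "\<epsilon> ^ d \<le> det (A + \<epsilon> \<cdot>\<^sub>m 1\<^sub>m d)"
proof -
  have A: "A \<in> carrier_mat d d" using assms by (simp add: pos_semidef_def)
  obtain \<mu> w where eb: "eigenbasis d (\<lambda>i j. A $$ (i, j)) \<mu> w"
    using eigenbasis_exists assms(1) unfolding pos_semidef_def by blast
  have \<mu>: "0 \<le> \<mu> k" if "k < d" for k
    using pos_semidef_qform_nonneg[OF assms(1)] eigenbasis_qform_basis[OF eb that] by metis
  have "eigenbasis d (\<lambda>i j. (A + \<epsilon> \<cdot>\<^sub>m 1\<^sub>m d) $$ (i, j)) (\<lambda>k. \<mu> k + \<epsilon>) w"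
    using eb A unfolding eigenbasis_def
    by (auto simp: distrib_right sum.distrib mult.assoc simp flip: sum_distrib_left)
  then have "det (A + \<epsilon> \<cdot>\<^sub>m 1\<^sub>m d) = (\<Prod>k<d. \<mu> k + \<epsilon>)" using A by (intro det_eigenbasis) auto
  moreover have "(\<Prod>k<d. \<epsilon>) \<le> (\<Prod>k<d. \<mu> k + \<epsilon>)"
    using \<mu> assms(2) by (intro prod_mono) auto
  ultimately show ?thesis by simp
qed

lemma pos_semidef_plus_scalar_pos_def:
  assumes "pos_semidef d A" "0 < \<epsilon>"
  shows "pos_def d (A + \<epsilon> \<cdot>\<^sub>m 1\<^sub>m d)"
proof (rule pos_defI)
  have A: "A \<in> carrier_mat d d" and s: "transpose_mat A = A" using assms by (auto simp: pos_semidef_def)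
  show "A + \<epsilon> \<cdot>\<^sub>m 1\<^sub>m d \<in> carrier_mat d d" using A by simp
  show "(A + \<epsilon> \<cdot>\<^sub>m 1\<^sub>m d) $$ (i, j) = (A + \<epsilon> \<cdot>\<^sub>m 1\<^sub>m d) $$ (j, i)" if "i < d" "j < d" for i j
    using that A symmetric_mat_index[OF A s that] by auto
  fix v :: "nat \<Rightarrow> real" and k assume k: "k < d" "v k \<noteq> 0"
  have "qform d (\<lambda>i j. (A + \<epsilon> \<cdot>\<^sub>m 1\<^sub>m d) $$ (i, j)) v
      = (\<Sum>i<d. \<Sum>j<d. v i * A $$ (i, j) * v j + (if i = j then \<epsilon> * (v i * v j) else 0))"
    unfolding qform_def using A by (intro sum.cong refl) (auto simp: algebra_simps)
  also have "\<dots> = qform d (\<lambda>i j. A $$ (i, j)) v + \<epsilon> * ip d v v"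
    by (simp add: sum.distrib qform_def ip_def sum_distrib_left)
  also have "\<dots> > 0"
  proof -
    have "ip d v v \<noteq> 0" using ip_self_eq_0D[of d v k] k by auto
    then have "0 < ip d v v" using ip_nonneg[of d v] by simp
    then show ?thesis using pos_semidef_qform_nonneg[OF assms(1), of v] assms(2) by (simp add: add_nonneg_pos)
  qed
  finally show "0 < qform d (\<lambda>i j. (A + \<epsilon> \<cdot>\<^sub>m 1\<^sub>m d) $$ (i, j)) v" .
qed

section \<open>Concavity of the log-determinant and leading eigenvectors\<close>

text \<open>In terms of eigenvalues this is \<open>ln \<mu> \<le> \<mu> - 1\<close>, summed.
  Equality holds only at \<open>\<mu> = 1\<close>, and an \<open>X\<close> other than the identity
  has an eigenvalue different from 1.\<close>

lemma ln_det_le_trace: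
  assumes "pos_def d X"
  shows "ln (det X) \<le> (\<Sum>i<d. X $$ (i, i)) - real d"
    and "X \<noteq> 1\<^sub>m d \<Longrightarrow> ln (det X) < (\<Sum>i<d. X $$ (i, i)) - real d"
proof -
  have X: "X \<in> carrier_mat d d" using assms by (simp add: pos_def_def)
  obtain \<mu> w where eb: "eigenbasis d (\<lambda>i j. X $$ (i, j)) \<mu> w"
    using eigenbasis_exists assms unfolding pos_def_def by blast
  note \<mu> = pos_def_eigenvalues_pos[OF assms eb]
  have "(\<Sum>i<d. X $$ (i, i)) = (\<Sum>i<d. \<Sum>k<d. \<mu> k * (w k i * w k i))"
    by (simp add: eigenbasis_expansion[OF eb] mult.assoc)
  also have "\<dots> = (\<Sum>k<d. \<mu> k * ip d (w k) (w k))"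
    unfolding ip_def sum_distrib_left by (rule sum.swap)
  also have "\<dots> = (\<Sum>k<d. \<mu> k)" by (simp add: eigenbasis_orthonormal[OF eb])
  finally have tr: "(\<Sum>i<d. X $$ (i, i)) - real d = (\<Sum>k<d. \<mu> k - 1)"
    by (simp add: sum_subtractf)
  have ln: "ln (det X) = (\<Sum>k<d. ln (\<mu> k))"
    unfolding det_eigenbasis[OF X eb] by (rule ln_prod) (use \<mu> in force)+
  show "ln (det X) \<le> (\<Sum>i<d. X $$ (i, i)) - real d"
    unfolding tr ln by (intro sum_mono ln_le_minus_one) (use \<mu> in auto)
  assume ne: "X \<noteq> 1\<^sub>m d"
  have "\<exists>k<d. \<mu> k \<noteq> 1"
  proof (rule ccontr)
    assume "\<not> (\<exists>k<d. \<mu> k \<noteq> 1)"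
    then have "X = 1\<^sub>m d"
      using X by (intro eq_matI) (auto simp: eigenbasis_expansion[OF eb] eigenbasis_complete[OF eb])
    with ne show False by simp
  qed
  then obtain k where k: "k < d" "\<mu> k \<noteq> 1" by auto
  show "ln (det X) < (\<Sum>i<d. X $$ (i, i)) - real d"
    unfolding tr ln
  proof (rule sum_strict_mono_ex1)
    have "ln (\<mu> k) \<noteq> \<mu> k - 1" using ln_eq_minus_one[OF \<mu>[OF k(1)]] k(2) by blast
    moreover have "ln (\<mu> k) \<le> \<mu> k - 1" using \<mu>[OF k(1)] by (rule ln_le_minus_one)
    ultimately show "\<exists>k\<in>{..<d}. ln (\<mu> k) < \<mu> k - 1" using k by (intro bexI[of _ k]) auto
  qed (use \<mu> in \<open>auto intro: ln_le_minus_one\<close>)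
qed

lemma pos_def_congruence:
  assumes A: "pos_def d A" and T: "T \<in> carrier_mat d d" and S: "S \<in> carrier_mat d d" and ST: "S * T = 1\<^sub>m d"
  shows "pos_def d (T * A * transpose_mat T)"
proof -
  have Ac: "A \<in> carrier_mat d d" and As: "transpose_mat A = A" using A by (auto simp: pos_def_def)
  have TS: "transpose_mat T * transpose_mat S = 1\<^sub>m d"
    using arg_cong[OF ST, of transpose_mat] transpose_mult[OF S T] by simp
  have TS': "transpose_mat S * transpose_mat T = 1\<^sub>m d"
    using arg_cong[OF mat_mult_left_right_inverse[OF S T ST], of transpose_mat] transpose_mult[OF T S] by simp
  have "transpose_mat (T * A * transpose_mat T) = T * transpose_mat (T * A)"
    using transpose_mult[of "T * A" d d "transpose_mat T" d] T Ac by simp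
  also have "transpose_mat (T * A) = A * transpose_mat T"
    using transpose_mult[OF T Ac] As by simp
  also have "T * (A * transpose_mat T) = T * A * transpose_mat T"
    using assoc_mult_mat[OF T Ac, of "transpose_mat T" d] T by simp
  finally have sym: "transpose_mat (T * A * transpose_mat T) = T * A * transpose_mat T" .
  have "0 < v \<bullet> ((T * A * transpose_mat T) *\<^sub>v v)" if v: "v \<in> carrier_vec d" "v \<noteq> 0\<^sub>v d" for v
  proof -
    let ?u = "transpose_mat T *\<^sub>v v"
    have u: "?u \<in> carrier_vec d" using T v by simp
    have "?u \<noteq> 0\<^sub>v d"
    proof
      assume "?u = 0\<^sub>v d"
      then have "transpose_mat S *\<^sub>v ?u = 0\<^sub>v d" using S by (intro eq_vecI) auto
      then have "v = 0\<^sub>v d"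
        using assoc_mult_mat_vec[of "transpose_mat S" d d "transpose_mat T" d v] S T v TS' by simp
      with v show False by simp
    qed
    then have "0 < ?u \<bullet> (A *\<^sub>v ?u)" using A u by (simp add: pos_def_def)
    also have "\<dots> = v \<bullet> (T *\<^sub>v (A *\<^sub>v ?u))"
      using transpose_vec_mult_scalar[of T d d "A *\<^sub>v ?u" v] T Ac u v by simp
    also have "T *\<^sub>v (A *\<^sub>v ?u) = (T * A * transpose_mat T) *\<^sub>v v"
      using T Ac u v by (simp add: assoc_mult_mat_vec[of _ d d _ d])
    finally show ?thesis .
  qed
  then show ?thesis unfolding pos_def_def using sym T Ac by auto
qed

text \<open>With the orthogonal matrix \<open>W\<close> of eigenvectors,
  \<open>S = W diag (sqrt \<mu>)\<close> satisfies \<open>A = S S^T\<close>, and \<open>T\<close> is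
  its inverse.\<close>

lemma pos_def_reduce_to_one:
  assumes A: "pos_def d A"
  shows "\<exists>T S. T \<in> carrier_mat d d \<and> S \<in> carrier_mat d d \<and> S * T = 1\<^sub>m d \<and> T * A * transpose_mat T = 1\<^sub>m d"
proof -
  have Ac: "A \<in> carrier_mat d d" using A by (auto simp: pos_def_def)
  obtain \<mu> w where eb: "eigenbasis d (\<lambda>i j. A $$ (i, j)) \<mu> w"
    using eigenbasis_exists A unfolding pos_def_def by blast
  note \<mu> = pos_def_eigenvalues_pos[OF A eb]
  define T where "T = mat d d (\<lambda>(k, i). w k i / sqrt (\<mu> k))"
  define S where "S = mat d d (\<lambda>(i, k). w k i * sqrt (\<mu> k))"
  have T: "T \<in> carrier_mat d d" and S: "S \<in> carrier_mat d d" by (auto simp: T_def S_def)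
  have ST: "S * T = 1\<^sub>m d"
  proof (rule eq_matI)
    fix i j assume "i < dim_row (1\<^sub>m d :: real mat)" "j < dim_col (1\<^sub>m d :: real mat)"
    then have ij: "i < d" "j < d" by auto
    have "(S * T) $$ (i, j) = (\<Sum>k<d. (w k i * sqrt (\<mu> k)) * (w k j / sqrt (\<mu> k)))"
      using ij by (simp add: S_def T_def scalar_prod_def atLeast0LessThan)
    also have "\<dots> = (\<Sum>k<d. w k i * w k j)"
      by (intro sum.cong refl) (use \<mu> in \<open>auto simp: less_imp_neq[symmetric]\<close>)
    finally show "(S * T) $$ (i, j) = 1\<^sub>m d $$ (i, j)" using ij by (simp add: eigenbasis_complete[OF eb])
  qed (auto simp: S_def T_def)
  have ASS: "A = S * transpose_mat S"
  proof (rule eq_matI)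
    fix i j assume "i < dim_row (S * transpose_mat S)" "j < dim_col (S * transpose_mat S)"
    then have ij: "i < d" "j < d" by (auto simp: S_def)
    have "(S * transpose_mat S) $$ (i, j) = (\<Sum>k<d. (w k i * sqrt (\<mu> k)) * (w k j * sqrt (\<mu> k)))"
      using ij by (simp add: S_def scalar_prod_def atLeast0LessThan)
    also have "\<dots> = (\<Sum>k<d. \<mu> k * w k i * w k j)"
    proof (intro sum.cong refl)
      fix k assume "k \<in> {..<d}"
      then have "sqrt (\<mu> k) * sqrt (\<mu> k) = \<mu> k" using \<mu>[of k] by simp
      then show "(w k i * sqrt (\<mu> k)) * (w k j * sqrt (\<mu> k)) = \<mu> k * w k i * w k j"
        by (metis mult.assoc mult.commute)
    qed
    finally show "A $$ (i, j) = (S * transpose_mat S) $$ (i, j)" using ij by (simp add: eigenbasis_expansion[OF eb])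
  qed (use Ac in \<open>auto simp: S_def\<close>)
  have TS: "T * S = 1\<^sub>m d" by (rule mat_mult_left_right_inverse[OF S T ST])
  have "T * A * transpose_mat T = (T * S) * (transpose_mat S * transpose_mat T)"
    unfolding ASS using T S by (simp add: assoc_mult_mat[of _ d d _ d _ d])
  also have "transpose_mat S * transpose_mat T = transpose_mat (T * S)"
    using transpose_mult[OF T S] by simp
  finally have "T * A * transpose_mat T = 1\<^sub>m d" unfolding TS by simp
  with T S ST show ?thesis by blast
qed

lemma pos_def_convex_combination:
  assumes "pos_def d A" "pos_def d B" "0 < t" "t < 1"
  shows "pos_def d (t \<cdot>\<^sub>m A + (1 - t) \<cdot>\<^sub>m B)"
proof (rule pos_defI)
  have A: "A \<in> carrier_mat d d" "transpose_mat A = A" and B: "B \<in> carrier_mat d d" "transpose_mat B = B"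
    using assms by (auto simp: pos_def_def)
  show "t \<cdot>\<^sub>m A + (1 - t) \<cdot>\<^sub>m B \<in> carrier_mat d d" using A B by simp
  show "(t \<cdot>\<^sub>m A + (1 - t) \<cdot>\<^sub>m B) $$ (i, j) = (t \<cdot>\<^sub>m A + (1 - t) \<cdot>\<^sub>m B) $$ (j, i)" if "i < d" "j < d" for i j
    using that A B symmetric_mat_index[OF A that] symmetric_mat_index[OF B that] by auto
  fix v :: "nat \<Rightarrow> real" and k assume k: "k < d" "v k \<noteq> 0"
  have "qform d (\<lambda>i j. (t \<cdot>\<^sub>m A + (1 - t) \<cdot>\<^sub>m B) $$ (i, j)) v
      = t * qform d (\<lambda>i j. A $$ (i, j)) v + (1 - t) * qform d (\<lambda>i j. B $$ (i, j)) v"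
    unfolding qform_def sum_distrib_left sum.distrib[symmetric]
    by (intro sum.cong refl) (use A B in \<open>auto simp: algebra_simps\<close>)
  also have "\<dots> > 0"
    using pos_def_qform_pos[OF assms(1), of k v] pos_def_qform_pos[OF assms(2), of k v] k assms(3,4) by (simp add: add_pos_pos)
  finally show "0 < qform d (\<lambda>i j. (t \<cdot>\<^sub>m A + (1 - t) \<cdot>\<^sub>m B) $$ (i, j)) v" .
qed

text \<open>After a congruence taking the convex combination to the identity, the claim becomes
  \<open>ln (det X) \<le> tr X - d\<close> at both points.\<close>

lemma ln_det_strict_concave:
  assumes pA: "pos_def d A" and pB: "pos_def d B" and t: "0 < t" "t < 1" and ne: "A \<noteq> B"
  shows "t * ln (det A) + (1 - t) * ln (det B) < ln (det (t \<cdot>\<^sub>m A + (1 - t) \<cdot>\<^sub>m B))"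
proof -
  let ?K = "t \<cdot>\<^sub>m A + (1 - t) \<cdot>\<^sub>m B"
  have A: "A \<in> carrier_mat d d" and B: "B \<in> carrier_mat d d" using pA pB by (auto simp: pos_def_def)
  have pK: "pos_def d ?K" by (rule pos_def_convex_combination[OF pA pB t])
  obtain T S where T: "T \<in> carrier_mat d d" and S: "S \<in> carrier_mat d d" and ST: "S * T = 1\<^sub>m d"
    and TK: "T * ?K * transpose_mat T = 1\<^sub>m d" using pos_def_reduce_to_one[OF pK] by blast
  let ?X = "T * A * transpose_mat T" and ?Y = "T * B * transpose_mat T"
  have pX: "pos_def d ?X" and pY: "pos_def d ?Y"
    using pos_def_congruence[OF pA T S ST] pos_def_congruence[OF pB T S ST] .
  have X: "?X \<in> carrier_mat d d" and Y: "?Y \<in> carrier_mat d d" using pX pY by (auto simp: pos_def_def)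
  have "T * ?K = t \<cdot>\<^sub>m (T * A) + (1 - t) \<cdot>\<^sub>m (T * B)"
    using mult_add_distrib_mat[OF T, of "t \<cdot>\<^sub>m A" d "(1 - t) \<cdot>\<^sub>m B"] A B T
    by (simp add: mult_smult_distrib[of T d d])
  also have "\<dots> * transpose_mat T = t \<cdot>\<^sub>m ?X + (1 - t) \<cdot>\<^sub>m ?Y"
    using add_mult_distrib_mat[of "t \<cdot>\<^sub>m (T * A)" d d "(1 - t) \<cdot>\<^sub>m (T * B)" "transpose_mat T" d] A B T
    by (simp add: mult_smult_assoc_mat[of _ d d])
  finally have XY: "t \<cdot>\<^sub>m ?X + (1 - t) \<cdot>\<^sub>m ?Y = 1\<^sub>m d" using TK by simp
  have XYe: "t * ?X $$ (i, j) + (1 - t) * ?Y $$ (i, j) = 1\<^sub>m d $$ (i, j)" if "i < d" "j < d" for i j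
  proof -
    have "t * P $$ (i, j) + (1 - t) * Q $$ (i, j) = 1\<^sub>m d $$ (i, j)"
      if "P \<in> carrier_mat d d" "Q \<in> carrier_mat d d" "t \<cdot>\<^sub>m P + (1 - t) \<cdot>\<^sub>m Q = 1\<^sub>m d" for P Q
      using that(1,2) \<open>i < d\<close> \<open>j < d\<close> by (auto simp flip: that(3))
    from this[OF X Y XY] show ?thesis .
  qed
  have tr: "t * (\<Sum>i<d. ?X $$ (i, i)) + (1 - t) * (\<Sum>i<d. ?Y $$ (i, i)) = real d"
  proof -
    have "t * (\<Sum>i<d. ?X $$ (i, i)) + (1 - t) * (\<Sum>i<d. ?Y $$ (i, i))
       = (\<Sum>i<d. t * ?X $$ (i, i) + (1 - t) * ?Y $$ (i, i))"
      by (simp add: sum.distrib sum_distrib_left del: index_mult_mat(1))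
    also have "\<dots> = (\<Sum>i<d. 1)" by (intro sum.cong refl) (use XYe in auto)
    finally show ?thesis by simp
  qed
  \<comment> \<open>Strictness needs one of the two points to differ from the identity. If
    \<open>?X\<close> were the identity, \<open>?Y\<close> would be too, since their combination is,
    and undoing the congruence would give \<open>A = B\<close>.\<close>
  have X1: "?X \<noteq> 1\<^sub>m d"
  proof
    assume X1: "?X = 1\<^sub>m d"
    have "?Y = ?X"
    proof (rule eq_matI)
      fix i j assume "i < dim_row ?X" "j < dim_col ?X"
      then have ij: "i < d" "j < d" using X by auto
      have "(1 - t) * ?Y $$ (i, j) = (1 - t) * 1\<^sub>m d $$ (i, j)"
        using XYe[OF ij] unfolding X1 by (simp add: algebra_simps del: index_mult_mat(1))
      then show "?Y $$ (i, j) = ?X $$ (i, j)" unfolding X1 using t by (simp del: index_mult_mat(1))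
    qed (use X Y in auto)
    moreover have "S * (T * M * transpose_mat T) * transpose_mat S = M" if M: "M \<in> carrier_mat d d" for M
    proof -
      have "S * (T * M * transpose_mat T) * transpose_mat S = (S * T) * M * (transpose_mat T * transpose_mat S)"
        using S T M by (simp add: assoc_mult_mat[of _ d d _ d _ d])
      also have "transpose_mat T * transpose_mat S = 1\<^sub>m d"
        using transpose_mult[OF S T] ST by simp
      finally show ?thesis unfolding ST using M by simp
    qed
    ultimately have "A = B" using A B by metis
    with ne show False by simp
  qed
  have dT: "det (T * M * transpose_mat T) = (det T)\<^sup>2 * det M" if "M \<in> carrier_mat d d" for M
    using that T by (simp add: det_mult[of _ d] det_transpose[of _ d] power2_eq_square)
  \<comment> \<open>The congruence adds the same \<open>ln c\<close> to all three log-determinants;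
    as the weights sum to 1, it cancels.\<close>
  define c where "c = (det T)\<^sup>2"
  have cK: "c * det ?K = 1"
    using dT[of ?K] TK A B by (simp add: c_def)
  have "c > 0" using cK by (auto simp: c_def)
  have lnX: "ln (det ?X) = ln c + ln (det A)" and lnY: "ln (det ?Y) = ln c + ln (det B)"
    using dT[OF A] dT[OF B] \<open>c > 0\<close> pos_def_det_pos[OF pA] pos_def_det_pos[OF pB]
    by (auto simp: c_def ln_mult)
  have lnK: "ln c + ln (det ?K) = 0"
    using cK \<open>c > 0\<close> pos_def_det_pos[OF pK] by (metis ln_mult_pos ln_one)
  have "t * ln (det ?X) + (1 - t) * ln (det ?Y)
      < t * ((\<Sum>i<d. ?X $$ (i, i)) - real d) + (1 - t) * ((\<Sum>i<d. ?Y $$ (i, i)) - real d)"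
    using ln_det_le_trace(2)[OF pX X1] ln_det_le_trace(1)[OF pY] t
    by (intro add_less_le_mono mult_strict_left_mono mult_left_mono) auto
  also have "\<dots> = (t * (\<Sum>i<d. ?X $$ (i, i)) + (1 - t) * (\<Sum>i<d. ?Y $$ (i, i))) - real d"
    by (simp add: algebra_simps del: index_mult_mat(1))
  also have "\<dots> = 0" unfolding tr by simp
  finally show ?thesis unfolding lnX lnY using lnK by (simp add: algebra_simps)
qed

text \<open>Eigenvectors \<open>u j\<close> with eigenvalue above \<open>m\<close> lie in the span of the equally many \<open>w k\<close> with
  \<open>\<mu> k > m\<close>. Summing all squared inner products shows that equality holds in every Bessel inequality,
  so the two families span the same space.\<close>

lemma qform_orthogonal_leading_eigenvectors:
  assumes eb: "eigenbasis d A \<mu> w" and qd: "q \<le> d"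
    and orth: "\<And>i j. i < q \<Longrightarrow> j < q \<Longrightarrow> ip d (u i) (u j) = (if i = j then 1 else 0)"
    and ev: "\<And>j i. j < q \<Longrightarrow> i < d \<Longrightarrow> (\<Sum>l<d. A i l * u j l) = \<mu> j * u j i"
    and tail: "\<And>j. q \<le> j \<Longrightarrow> j < d \<Longrightarrow> \<mu> j \<le> m"
    and v: "\<And>j. j < q \<Longrightarrow> ip d v (u j) = 0"
  shows "qform d A v \<le> m * ip d v v"
proof -
  \<comment> \<open>Both \<open>u j\<close> and \<open>w j\<close> belong to \<open>\<mu> j\<close>,
    so one index set serves both families and their sizes agree.\<close>
  define J where "J = {j. j < q \<and> m < \<mu> j}"
  have Jq: "\<And>j. j \<in> J \<Longrightarrow> j < q" and Jd: "\<And>j. j \<in> J \<Longrightarrow> j < d" and fJ: "finite J" and JJ: "J \<subseteq> {..<d}"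
    using qd by (auto simp: J_def)
  have wu: "ip d (w k) (u j) = 0" if "k < d" "k \<notin> J" "j \<in> J" for j k
  proof -
    have "(\<Sum>i<d. A i l * w k i) = \<mu> k * w k l" if l: "l < d" for l
    proof -
      have "(\<Sum>i<d. A i l * w k i) = (\<Sum>i<d. \<Sum>h<d. (\<mu> h * w h l) * (w h i * w k i))"
        using l by (intro sum.cong refl) (simp add: eigenbasis_expansion[OF eb] sum_distrib_left sum_distrib_right algebra_simps)
      also have "\<dots> = (\<Sum>h<d. (\<mu> h * w h l) * ip d (w h) (w k))"
        unfolding ip_def sum_distrib_left by (rule sum.swap)
      also have "\<dots> = (\<Sum>h<d. if h = k then \<mu> h * w h l else 0)"
        by (intro sum.cong refl) (use \<open>k < d\<close> eigenbasis_orthonormal[OF eb] in auto)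
      finally show ?thesis using \<open>k < d\<close> by simp
    qed
    then have "\<mu> k * ip d (w k) (u j) = (\<Sum>l<d. (\<Sum>i<d. A i l * w k i) * u j l)"
      by (simp add: ip_def sum_distrib_left mult.assoc)
    also have "\<dots> = (\<Sum>l<d. \<Sum>i<d. w k i * (A i l * u j l))"
      by (simp add: sum_distrib_left sum_distrib_right algebra_simps)
    also have "\<dots> = (\<Sum>i<d. w k i * (\<Sum>l<d. A i l * u j l))"
      unfolding sum_distrib_left by (rule sum.swap)
    also have "\<dots> = \<mu> j * ip d (w k) (u j)"
      using ev[OF Jq[OF \<open>j \<in> J\<close>]] by (simp add: ip_def sum_distrib_left algebra_simps)
    finally have "(\<mu> k - \<mu> j) * ip d (w k) (u j) = 0" by (simp add: algebra_simps)
    \<comment> \<open>Indeed \<open>\<mu> k \<le> m < \<mu> j\<close>: for \<open>k < q\<close>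
      because \<open>k\<close> is outside \<open>J\<close>, for larger \<open>k\<close> by
      \<open>tail\<close>.\<close>
    moreover have "\<mu> k \<noteq> \<mu> j"
      using that tail[of k] by (cases "k < q") (auto simp: J_def)
    ultimately show ?thesis by simp
  qed
  have Pars: "(\<Sum>k\<in>J. (ip d (w k) (u j))\<^sup>2) = 1" if j: "j \<in> J" for j
  proof -
    have "(\<Sum>k\<in>J. (ip d (w k) (u j))\<^sup>2) = (\<Sum>k<d. (ip d (w k) (u j))\<^sup>2)"
      using JJ wu j by (intro sum.mono_neutral_left) auto
    then show ?thesis using eigenbasis_Parseval[OF eb, of "u j"] orth Jq j by simp
  qed
  let ?R = "\<lambda>k i. w k i - (\<Sum>j\<in>J. ip d (w k) (u j) * u j i)"
  have R: "ip d (?R k) (?R k) = 1 - (\<Sum>j\<in>J. (ip d (w k) (u j))\<^sup>2)" if k: "k \<in> J" for k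
    using orth_residual_norm[OF fJ, of d u "w k"] orth Jq eigenbasis_orthonormal[OF eb] Jd k by simp
  have "(\<Sum>k\<in>J. ip d (?R k) (?R k)) = real (card J) - (\<Sum>k\<in>J. \<Sum>j\<in>J. (ip d (w k) (u j))\<^sup>2)"
    by (simp add: R sum_subtractf)
  also have "(\<Sum>k\<in>J. \<Sum>j\<in>J. (ip d (w k) (u j))\<^sup>2) = real (card J)"
    by (subst sum.swap) (simp add: Pars)
  finally have "(\<Sum>k\<in>J. ip d (?R k) (?R k)) = 0" by simp
  then have R0: "ip d (?R k) (?R k) = 0" if "k \<in> J" for k
    using that fJ by (subst (asm) sum_nonneg_eq_0_iff) (auto simp: ip_nonneg)
  have wv: "ip d (w k) v = 0" if k: "k \<in> J" for k
  proof -
    have "ip d (w k) v = ip d (\<lambda>i. \<Sum>j\<in>J. ip d (w k) (u j) * u j i) v"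
      using ip_self_eq_0D[OF R0[OF k]] by (intro ip_cong) auto
    also have "\<dots> = 0" unfolding ip_sum_left using v Jq by (simp add: ip_commute[of d _ v])
    finally show ?thesis .
  qed
  have "qform d A v \<le> (\<Sum>k<d. m * (ip d (w k) v)\<^sup>2)"
    unfolding qform_eigenbasis[OF eb]
  proof (intro sum_mono)
    fix k assume "k \<in> {..<d}"
    then show "\<mu> k * (ip d (w k) v)\<^sup>2 \<le> m * (ip d (w k) v)\<^sup>2"
      using wv[of k] tail[of k] by (cases "k \<in> J") (auto simp: J_def not_less intro!: mult_right_mono)
  qed
  then show ?thesis by (simp add: eigenbasis_Parseval[OF eb] flip: sum_distrib_left)
qed

text \<open>One half of the min-max principle. At most \<open>q\<close> linear conditions leave a
  nonzero vector in the span of \<open>w j0\<close> and the first \<open>q\<close> eigenvectors, and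
  on this span the Rayleigh quotient is at least \<open>\<mu> j0\<close>.\<close>

lemma exists_large_qform_in_codimension:
  assumes eb: "eigenbasis d A \<mu> w" and qd: "q < d"
    and lead: "\<And>i. i < q \<Longrightarrow> \<mu> j0 \<le> \<mu> i" and j0: "q \<le> j0" "j0 < d"
    and B: "finite B" "card B \<le> q"
  shows "\<exists>z. ip d z z > 0 \<and> (\<forall>b\<in>B. ip d (c b) z = 0) \<and> \<mu> j0 * ip d z z \<le> qform d A z"
proof -
  let ?K = "insert j0 {..<q}"
  have K: "finite ?K" "card B < card ?K" "?K \<subseteq> {..<d}" using j0 B qd by auto
  obtain a where a: "\<exists>k\<in>?K. a k \<noteq> 0" "\<forall>b\<in>B. (\<Sum>k\<in>?K. ip d (c b) (w k) * a k) = 0"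
    using homogeneous_system_nontrivial[OF B(1) K(1,2), of "\<lambda>b k. ip d (c b) (w k)"] by blast
  define z where "z = (\<lambda>i. \<Sum>k\<in>?K. a k * w k i)"
  have wz: "ip d (w l) z = (if l \<in> ?K then a l else 0)" if "l < d" for l
  proof -
    have "ip d (w l) z = (\<Sum>k\<in>?K. a k * ip d (w l) (w k))" unfolding z_def by (rule ip_sum_right)
    also have "\<dots> = (\<Sum>k\<in>?K. if k = l then a l else 0)"
      by (intro sum.cong refl) (use that K(3) eigenbasis_orthonormal[OF eb] in auto)
    finally show ?thesis using K(1) by (simp only: sum.delta)
  qed
  have "\<mu> j0 * ip d z z \<le> qform d A z"
    unfolding qform_eigenbasis[OF eb] eigenbasis_Parseval[OF eb, of z, symmetric] sum_distrib_left
  proof (intro sum_mono)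
    fix k assume "k \<in> {..<d}"
    then show "\<mu> j0 * (ip d (w k) z)\<^sup>2 \<le> \<mu> k * (ip d (w k) z)\<^sup>2"
      using lead[of k] wz[of k] by (cases "k \<in> ?K") (auto intro: mult_right_mono)
  qed
  moreover have "ip d z z > 0"
  proof -
    obtain k where k: "k \<in> ?K" "a k \<noteq> 0" using a by blast
    then have "k < d" using K(3) by auto
    then have "0 < (ip d (w k) z)\<^sup>2" using wz[of k] k by auto
    also have "\<dots> \<le> (\<Sum>k<d. (ip d (w k) z)\<^sup>2)" using \<open>k < d\<close> by (intro member_le_sum) auto
    finally show ?thesis by (simp add: eigenbasis_Parseval[OF eb])
  qed
  moreover have "ip d (c b) z = 0" if "b \<in> B" for b
    using a(2) that unfolding z_def ip_sum_right by (simp add: mult.commute)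
  ultimately show ?thesis by blast
qed

section \<open>Column bases, norms and limits\<close>

text \<open>A maximal independent set of columns spans all of them. Indices are returned rather than
  vectors, because the coefficients found for the limit Gram matrix will be applied to the loadings
  with the same indices.\<close>

lemma mat_rank_column_basis:
  assumes A: "A \<in> carrier_mat n nc"
  shows "\<exists>J c. J \<subseteq> {..<nc} \<and> card J = mat_rank A \<and>
    (\<forall>k<nc. \<forall>l<n. A $$ (l, k) = (\<Sum>j\<in>J. c k j * A $$ (l, j)))"
proof -
  interpret vec_space "TYPE(real)" n .
  have cols: "set (cols A) \<subseteq> carrier_vec n" using cols_dim[of A] A by simp
  obtain S where "finite S" and max: "maximal S (\<lambda>T. T \<subseteq> set (cols A) \<and> lin_indpt T)"
    using maximal_exists_superset[of "set (cols A)" "\<lambda>T. T \<subseteq> set (cols A) \<and> lin_indpt T" "{}"]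
    by (auto simp: lin_dep_def)
  have S: "S \<subseteq> set (cols A)" "lin_indpt S" "finite S"
    using max \<open>finite S\<close> unfolding maximal_def by auto
  have Sc: "S \<subseteq> carrier_vec n" using S cols by auto
  have card: "card S = mat_rank A"
    using rank_card_indpt[OF A max] A by (simp add: mat_rank_def)
  have "\<forall>s\<in>S. \<exists>j<nc. col A j = s"
    using S(1) A by (force simp: cols_def)
  \<comment> \<open>Equal columns count once in \<open>S\<close>; \<open>g\<close> picks one index
    for each vector.\<close>
  then obtain g where g: "\<And>s. s \<in> S \<Longrightarrow> g s < nc \<and> col A (g s) = s" by metis
  have inj: "inj_on g S" by (rule inj_onI) (metis g)
  have span: "x \<in> span S" if x: "x \<in> set (cols A)" for x
  proof (rule ccontr)
    assume nx: "x \<notin> span S"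
    then have "x \<notin> S" using in_own_span[of S] Sc by auto
    with nx have "lin_indpt (S \<union> {x})"
      using lin_dep_iff_in_span[of S x] S(2) Sc cols x by auto
    then have "S \<union> {x} = S" using max x S(1) unfolding maximal_def by auto
    with \<open>x \<notin> S\<close> show False by auto
  qed
  have "\<exists>c. \<forall>l<n. A $$ (l, k) = (\<Sum>j\<in>g ` S. c j * A $$ (l, j))" if k: "k < nc" for k
  proof -
    have "col A k \<in> span S" using span k A by (simp add: cols_def)
    then obtain a where a: "lincomb a S = col A k" using finite_in_span[OF S(3)] Sc by auto
    have "A $$ (l, k) = (\<Sum>j\<in>g ` S. a (col A j) * A $$ (l, j))" if l: "l < n" for l
    proof -
      have "A $$ (l, k) = lincomb a S $ l" using a l k A by simp
      also have "\<dots> = (\<Sum>s\<in>S. a s * s $ l)" by (rule lincomb_index[OF l Sc])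
      also have "\<dots> = (\<Sum>s\<in>S. a (col A (g s)) * A $$ (l, g s))"
      proof (intro sum.cong refl)
        fix s assume "s \<in> S"
        then have "g s < nc" "col A (g s) = s" using g by auto
        moreover then have "s $ l = A $$ (l, g s)" using A l by (metis carrier_matD index_col)
        ultimately show "a s * s $ l = a (col A (g s)) * A $$ (l, g s)" by simp
      qed
      also have "\<dots> = (\<Sum>j\<in>g ` S. a (col A j) * A $$ (l, j))" using inj by (simp add: sum.reindex)
      finally show ?thesis .
    qed
    then show ?thesis by (intro exI[of _ "\<lambda>j. a (col A j)"]) blast
  qed
  then obtain c where "\<And>k l. k < nc \<Longrightarrow> l < n \<Longrightarrow> A $$ (l, k) = (\<Sum>j\<in>g ` S. c k j * A $$ (l, j))" by metis
  moreover have "g ` S \<subseteq> {..<nc}" using g by auto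
  moreover have "card (g ` S) = mat_rank A" using card card_image[OF inj] by simp
  ultimately show ?thesis by (intro exI[of _ "g ` S"] exI[of _ c]) auto
qed

section \<open>Operator norm and Frobenius norm\<close>

lemma scalar_prod_ip: "v \<in> carrier_vec d \<Longrightarrow> u \<bullet> v = ip d (\<lambda>i. u $ i) (\<lambda>i. v $ i)"
  by (simp add: scalar_prod_def ip_def atLeast0LessThan)

text \<open>A real supremum bounds its members only if the set is bounded. Row-wise Cauchy-Schwarz
  gives the Frobenius norm as a bound.\<close>

lemma bdd_above_op_norm:
  "bdd_above ((\<lambda>v. vec_norm2 (A *\<^sub>v v)) ` {v \<in> carrier_vec (dim_col A). vec_norm2 v \<le> 1})"
proof (rule bdd_aboveI2)
  fix v :: "real vec" assume "v \<in> {v \<in> carrier_vec (dim_col A). vec_norm2 v \<le> 1}"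
  then have v: "v \<in> carrier_vec (dim_col A)" "vec_norm2 v \<le> 1" by auto
  let ?n = "dim_row A" and ?m = "dim_col A"
  have vv: "ip ?m (\<lambda>i. v $ i) (\<lambda>i. v $ i) \<le> 1"
    using v(2) by (simp add: vec_norm2_def scalar_prod_ip[OF v(1)] ip_nonneg)
  have "(A *\<^sub>v v) \<bullet> (A *\<^sub>v v) = (\<Sum>i<?n. (ip ?m (\<lambda>j. A $$ (i, j)) (\<lambda>j. v $ j))\<^sup>2)"
    using v by (simp add: scalar_prod_def atLeast0LessThan ip_def power2_eq_square)
  also have "\<dots> \<le> (\<Sum>i<?n. ip ?m (\<lambda>j. A $$ (i, j)) (\<lambda>j. A $$ (i, j)) * 1)"
    by (intro sum_mono order.trans[OF ip_Cauchy_Schwarz] mult_left_mono vv ip_nonneg)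
  finally show "vec_norm2 (A *\<^sub>v v) \<le> sqrt (\<Sum>i<?n. ip ?m (\<lambda>j. A $$ (i, j)) (\<lambda>j. A $$ (i, j)) * 1)"
    unfolding vec_norm2_def by (rule real_sqrt_le_mono)
qed

lemma op_norm_nonneg: "0 \<le> op_norm A"
proof -
  have "0\<^sub>v (dim_col A) \<in> {v \<in> carrier_vec (dim_col A). vec_norm2 v \<le> 1}"
    by (simp add: vec_norm2_def)
  from cSUP_upper[OF this bdd_above_op_norm[of A]] show ?thesis
    unfolding op_norm_def vec_norm2_def
    by (rule order.trans[rotated]) (simp add: scalar_prod_def sum_nonneg)
qed

lemma qform_le_op_norm:
  assumes A: "A \<in> carrier_mat d d"
  shows "qform d (\<lambda>i j. A $$ (i, j)) v \<le> op_norm A * ip d v v"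
proof (cases "ip d v v = 0")
  case True
  then have "\<And>i. i < d \<Longrightarrow> v i = 0" using ip_self_eq_0D by blast
  then show ?thesis using True by (simp add: qform_def)
next
  case False
  then have pos: "0 < ip d v v" using ip_nonneg[of d v] by simp
  \<comment> \<open>The supremum ranges over the unit ball, so \<open>v\<close> is scaled to length
    1.\<close>
  define c where "c = sqrt (ip d v v)"
  have c: "c > 0" "c\<^sup>2 = ip d v v" using pos by (auto simp: c_def)
  define w where "w = vec d (\<lambda>i. v i / c)"
  have wc: "w \<in> carrier_vec d" by (simp add: w_def)
  have "w \<bullet> w = (\<Sum>i<d. v i * v i) / c\<^sup>2"
    by (simp add: w_def scalar_prod_def atLeast0LessThan sum_divide_distrib power2_eq_square)
  then have ww: "w \<bullet> w = 1" using c pos by (simp add: ip_def)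
  have le: "vec_norm2 (A *\<^sub>v w) \<le> op_norm A"
    unfolding op_norm_def
    by (rule cSUP_upper[OF _ bdd_above_op_norm]) (use wc A ww in \<open>auto simp: vec_norm2_def\<close>)
  let ?u = "A *\<^sub>v w"
  have uc: "?u \<in> carrier_vec d" using A wc by simp
  have "(w \<bullet> ?u)\<^sup>2 \<le> (w \<bullet> w) * (?u \<bullet> ?u)"
    using ip_Cauchy_Schwarz by (simp only: scalar_prod_ip[OF uc] scalar_prod_ip[OF wc])
  then have "\<bar>w \<bullet> ?u\<bar> \<le> vec_norm2 ?u"
    unfolding vec_norm2_def ww by (metis mult_1 real_sqrt_abs real_sqrt_le_mono)
  then have "w \<bullet> ?u \<le> op_norm A" using le by simp
  moreover have "w \<bullet> ?u = qform d (\<lambda>i j. A $$ (i, j)) v / c\<^sup>2"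
    unfolding qform_mat[OF A wc] by (simp add: qform_def w_def sum_divide_distrib power2_eq_square)
  ultimately show ?thesis using pos c(2) by (simp add: divide_le_eq)
qed

text \<open>The left side is the squared Frobenius norm of \<open>L D L^T\<close>. Expanding the
  square and summing over \<open>i\<close> and \<open>j\<close> first leaves only entries of
  \<open>L^T L\<close> beside those of \<open>D\<close>. Loadings in different dimensions with the
  same Gram matrix thus give the same value.\<close>

lemma sum_squares_congruence:
  fixes L D :: "nat \<Rightarrow> nat \<Rightarrow> real"
  shows "(\<Sum>i<d. \<Sum>j<d. (\<Sum>a<r. \<Sum>b<r. L i a * D a b * L j b)\<^sup>2) =
    (\<Sum>a<r. \<Sum>b<r. \<Sum>a'<r. \<Sum>b'<r. D a b * D a' b' * ((\<Sum>i<d. L i a * L i a') * (\<Sum>j<d. L j b * L j b')))"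
proof -
  let ?X = "\<lambda>i j a b. L i a * D a b * L j b"
  have "(\<Sum>i<d. \<Sum>j<d. (\<Sum>a<r. \<Sum>b<r. ?X i j a b)\<^sup>2)
      = (\<Sum>i<d. \<Sum>j<d. \<Sum>a<r. \<Sum>b<r. \<Sum>a'<r. \<Sum>b'<r. ?X i j a b * ?X i j a' b')"
    by (simp only: power2_eq_square sum_distrib_right) (simp only: sum_distrib_left)
  also have "\<dots> = (\<Sum>a<r. \<Sum>b<r. \<Sum>a'<r. \<Sum>b'<r. \<Sum>i<d. \<Sum>j<d. ?X i j a b * ?X i j a' b')"
  proof -
    have *: "(\<Sum>i<d. \<Sum>j<d. \<Sum>a<r. Y i j a) = (\<Sum>a<r. \<Sum>i<d. \<Sum>j<d. Y i j a)" for Y :: "nat \<Rightarrow> nat \<Rightarrow> nat \<Rightarrow> real"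
    proof -
      have "(\<Sum>i<d. \<Sum>j<d. \<Sum>a<r. Y i j a) = (\<Sum>i<d. \<Sum>a<r. \<Sum>j<d. Y i j a)"
        by (intro sum.cong refl sum.swap)
      also have "\<dots> = (\<Sum>a<r. \<Sum>i<d. \<Sum>j<d. Y i j a)" by (rule sum.swap)
      finally show ?thesis .
    qed
    show ?thesis unfolding * ..
  qed
  also have "\<dots> = (\<Sum>a<r. \<Sum>b<r. \<Sum>a'<r. \<Sum>b'<r. D a b * D a' b' * ((\<Sum>i<d. L i a * L i a') * (\<Sum>j<d. L j b * L j b')))"
    unfolding sum_product unfolding sum_distrib_left by (intro sum.cong refl) (simp add: algebra_simps)
  finally show ?thesis .
qed

text \<open>Bolzano-Weierstrass, one coordinate at a time: a further subsequence keeps the limits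
  already obtained.\<close>

lemma convergent_subseq_finite_family:
  fixes X :: "'i \<Rightarrow> nat \<Rightarrow> real"
  assumes "finite I" "\<And>i n. i \<in> I \<Longrightarrow> \<bar>X i n\<bar> \<le> B i"
  shows "\<exists>\<phi> l. strict_mono (\<phi> :: nat \<Rightarrow> nat) \<and> (\<forall>i\<in>I. (\<lambda>n. X i (\<phi> n)) \<longlonglongrightarrow> l i)"
  using assms
proof (induction I rule: finite_induct)
  case empty
  show ?case by (intro exI[of _ id]) (auto simp: strict_mono_def)
next
  case (insert i I)
  then obtain \<phi> l where \<phi>: "strict_mono (\<phi> :: nat \<Rightarrow> nat)" "\<forall>i\<in>I. (\<lambda>n. X i (\<phi> n)) \<longlonglongrightarrow> l i" by auto
  obtain \<psi> where \<psi>: "strict_mono (\<psi> :: nat \<Rightarrow> nat)" "monoseq (\<lambda>n. X i (\<phi> (\<psi> n)))"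
    using seq_monosub[of "\<lambda>n. X i (\<phi> n)"] by auto
  have "Bseq (\<lambda>n. X i (\<phi> (\<psi> n)))" using insert.prems[of i] by (intro BseqI'[of _ "B i"]) auto
  with \<psi>(2) obtain c where c: "(\<lambda>n. X i (\<phi> (\<psi> n))) \<longlonglongrightarrow> c"
    using Bseq_monoseq_convergent convergent_def by blast
  have "(\<lambda>n. X j (\<phi> (\<psi> n))) \<longlonglongrightarrow> (l(i := c)) j" if "j \<in> insert i I" for j
  proof (cases "j = i")
    case False
    then have "(\<lambda>n. X j (\<phi> n)) \<longlonglongrightarrow> l j" using that \<phi> by auto
    from LIMSEQ_subseq_LIMSEQ[OF this \<psi>(1)] show ?thesis using False by (simp add: comp_def)
  qed (use c in simp)
  moreover have "strict_mono (\<lambda>n. \<phi> (\<psi> n))" using \<phi>(1) \<psi>(1) by (simp add: strict_mono_def)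
  ultimately show ?case by (intro exI[of _ "\<lambda>n. \<phi> (\<psi> n)"] exI[of _ "l(i := c)"]) auto
qed

text \<open>Pointwise convergence of functions that are monotone in \<open>k\<close> to a continuous limit is locally
  uniform, so the argument \<open>s\<close> may vary with \<open>m\<close>.\<close>

lemma tendsto_monotone_moving_argument:
  fixes F :: "nat \<Rightarrow> nat \<Rightarrow> real" and N kk :: "nat \<Rightarrow> nat"
  assumes mono: "\<And>m k k'. k \<le> k' \<Longrightarrow> F m k \<le> F m k'"
    and ptw: "\<And>s. 0 \<le> s \<Longrightarrow> s \<le> 1 \<Longrightarrow> (\<lambda>m. F m (nat \<lfloor>s * real (N m)\<rfloor>)) \<longlonglongrightarrow> v s"
    and cont: "isCont v s"
    and N: "\<And>m. 0 < N m" and kk: "\<And>m. kk m \<le> N m"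
    and lim: "(\<lambda>m. real (kk m) / real (N m)) \<longlonglongrightarrow> s"
  shows "(\<lambda>m. F m (kk m)) \<longlonglongrightarrow> v s"
proof -
  have s: "0 \<le> s" "s \<le> 1"
    by (rule LIMSEQ_le_const[OF lim], simp, rule LIMSEQ_le_const2[OF lim]) (use N kk in \<open>auto simp: divide_le_eq\<close>)
  show ?thesis
  proof (rule LIMSEQ_I)
    fix \<epsilon> :: real assume "0 < \<epsilon>"
    then obtain \<delta> where \<delta>: "\<delta> > 0" "\<And>s'. \<bar>s' - s\<bar> < \<delta> \<Longrightarrow> \<bar>v s' - v s\<bar> < \<epsilon> / 2"
      using cont[unfolded isCont_def LIM_eq, rule_format, of "\<epsilon> / 2"] by (metis (no_types, lifting) abs_zero diff_self half_gt_zero real_norm_def)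
    \<comment> \<open>Two fixed points enclosing the moving argument, close enough to
      \<open>s\<close> for continuity; clipping keeps them in the unit interval, where
      \<open>ptw\<close> applies.\<close>
    define s1 s2 where "s1 = max 0 (s - \<delta> / 2)" and "s2 = min 1 (s + \<delta> / 2)"
    have s12: "0 \<le> s1" "s1 \<le> 1" "0 \<le> s2" "s2 \<le> 1" and v1: "\<bar>v s1 - v s\<bar> < \<epsilon> / 2" and v2: "\<bar>v s2 - v s\<bar> < \<epsilon> / 2"
      using s \<delta> by (auto simp: s1_def s2_def intro!: \<delta>(2))
    have "\<forall>\<^sub>F m in sequentially. \<bar>F m (nat \<lfloor>s1 * real (N m)\<rfloor>) - v s1\<bar> < \<epsilon> / 2"
      "\<forall>\<^sub>F m in sequentially. \<bar>F m (nat \<lfloor>s2 * real (N m)\<rfloor>) - v s2\<bar> < \<epsilon> / 2"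
      using tendstoD[OF ptw[OF s12(1,2)], of "\<epsilon> / 2"] tendstoD[OF ptw[OF s12(3,4)], of "\<epsilon> / 2"] \<open>0 < \<epsilon>\<close>
      by (auto simp: dist_real_def)
    moreover have "\<forall>\<^sub>F m in sequentially. \<bar>real (kk m) / real (N m) - s\<bar> < \<delta> / 2"
      using tendstoD[OF lim, of "\<delta> / 2"] \<delta>(1) by (auto simp: dist_real_def)
    ultimately have "\<forall>\<^sub>F m in sequentially. norm (F m (kk m) - v s) < \<epsilon>"
    proof eventually_elim
      case (elim m)
      have "s - \<delta> / 2 \<le> real (kk m) / real (N m)" "real (kk m) / real (N m) \<le> s + \<delta> / 2"
        using elim(3) by linarith+
      moreover have "real (kk m) / real (N m) \<le> 1" using kk[of m] N[of m] by simp
      ultimately have "s1 \<le> real (kk m) / real (N m)" "real (kk m) / real (N m) \<le> s2"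
        by (auto simp: s1_def s2_def)
      then have "s1 * real (N m) \<le> real (kk m)" "real (kk m) \<le> s2 * real (N m)"
        using N[of m] by (auto simp: field_simps)
      then have "nat \<lfloor>s1 * real (N m)\<rfloor> \<le> kk m" "kk m \<le> nat \<lfloor>s2 * real (N m)\<rfloor>"
        by (auto intro: le_nat_floor) linarith
      then have "F m (nat \<lfloor>s1 * real (N m)\<rfloor>) \<le> F m (kk m)" "F m (kk m) \<le> F m (nat \<lfloor>s2 * real (N m)\<rfloor>)"
        by (auto intro: mono)
      then show ?case using elim(1,2) v1 v2 by (simp add: abs_if split: if_splits)
    qed
    then show "\<exists>n0. \<forall>n\<ge>n0. norm (F n (kk n) - v s) < \<epsilon>" by (simp add: eventually_sequentially)
  qed
qed

section \<open>Continuity and concavity of the ridge-regularized log-determinant\<close>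

lemma det_tendsto:
  fixes Z :: "nat \<Rightarrow> real mat"
  assumes "\<And>m. Z m \<in> carrier_mat d d" "Z' \<in> carrier_mat d d"
    and "\<And>i j. i < d \<Longrightarrow> j < d \<Longrightarrow> (\<lambda>m. Z m $$ (i, j)) \<longlonglongrightarrow> Z' $$ (i, j)"
  shows "(\<lambda>m. det (Z m)) \<longlonglongrightarrow> det Z'"
  unfolding det_def'[OF assms(1)] det_def'[OF assms(2)]
proof (intro tendsto_sum tendsto_mult tendsto_const tendsto_prod assms(3))
  fix p i assume "p \<in> {p. p permutes {0..<d}}" "i \<in> {0..<d}"
  then show "i < d" "p i < d" using permutes_in_image[of p "{0..<d}" i] by auto
qed

definition ridge_ln_det :: "nat \<Rightarrow> real \<Rightarrow> real mat \<Rightarrow> real" where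
  "ridge_ln_det d \<epsilon> A = ln (det (A + \<epsilon> \<cdot>\<^sub>m 1\<^sub>m d))"

lemma ridge_ln_det_tendsto:
  assumes Z: "\<And>m. Z m \<in> carrier_mat d d" and Z': "pos_semidef d Z'" and \<epsilon>: "0 < \<epsilon>"
    and lim: "\<And>i j. i < d \<Longrightarrow> j < d \<Longrightarrow> (\<lambda>m. Z m $$ (i, j)) \<longlonglongrightarrow> Z' $$ (i, j)"
  shows "(\<lambda>m. ridge_ln_det d \<epsilon> (Z m)) \<longlonglongrightarrow> ridge_ln_det d \<epsilon> Z'"
  unfolding ridge_ln_det_def
proof (rule tendsto_ln)
  have Z'c: "Z' \<in> carrier_mat d d" using Z' by (simp add: pos_semidef_def)
  show "(\<lambda>m. det (Z m + \<epsilon> \<cdot>\<^sub>m 1\<^sub>m d)) \<longlonglongrightarrow> det (Z' + \<epsilon> \<cdot>\<^sub>m 1\<^sub>m d)"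
  proof (rule det_tendsto)
    fix i j assume ij: "i < d" "j < d"
    have "(\<lambda>m. Z m $$ (i, j) + (\<epsilon> \<cdot>\<^sub>m 1\<^sub>m d) $$ (i, j)) \<longlonglongrightarrow> Z' $$ (i, j) + (\<epsilon> \<cdot>\<^sub>m 1\<^sub>m d) $$ (i, j)"
      by (intro tendsto_add lim ij tendsto_const)
    moreover have "(Z m + \<epsilon> \<cdot>\<^sub>m 1\<^sub>m d) $$ (i, j) = Z m $$ (i, j) + (\<epsilon> \<cdot>\<^sub>m 1\<^sub>m d) $$ (i, j)" for m
      using ij Z[of m] by simp
    moreover have "(Z' + \<epsilon> \<cdot>\<^sub>m 1\<^sub>m d) $$ (i, j) = Z' $$ (i, j) + (\<epsilon> \<cdot>\<^sub>m 1\<^sub>m d) $$ (i, j)"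
      using ij Z'c by simp
    ultimately show "(\<lambda>m. (Z m + \<epsilon> \<cdot>\<^sub>m 1\<^sub>m d) $$ (i, j)) \<longlonglongrightarrow> (Z' + \<epsilon> \<cdot>\<^sub>m 1\<^sub>m d) $$ (i, j)" by (simp only:)
  qed (use Z Z'c in auto)
  show "det (Z' + \<epsilon> \<cdot>\<^sub>m 1\<^sub>m d) \<noteq> 0"
    using pos_def_det_pos[OF pos_semidef_plus_scalar_pos_def[OF Z' \<epsilon>]] by simp
qed

text \<open>The case \<open>a = 0\<close> covers a break candidate at the boundary, where the block average \<open>Z m\<close>
  may be unbounded and only the lower bound \<open>det (Z m + \<epsilon> 1) \<ge> \<epsilon> ^ d\<close> is available.\<close>

lemma weighted_ridge_ln_det_lower_limit:
  assumes Z: "\<And>m. pos_semidef d (Z m)" and Z': "pos_semidef d Z'" and \<epsilon>: "0 < \<epsilon>"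
    and a: "\<And>m. 0 \<le> a m" "a \<longlonglongrightarrow> a'"
    and lim: "\<And>i j. i < d \<Longrightarrow> j < d \<Longrightarrow> (\<lambda>m. a m * Z m $$ (i, j)) \<longlonglongrightarrow> a' * Z' $$ (i, j)"
  shows "\<exists>l. l \<longlonglongrightarrow> a' * ridge_ln_det d \<epsilon> Z' \<and> (\<forall>m. l m \<le> a m * ridge_ln_det d \<epsilon> (Z m)) \<and>
    (0 < a' \<longrightarrow> l = (\<lambda>m. a m * ridge_ln_det d \<epsilon> (Z m)))"
proof (cases "a' = 0")
  case True
  have "a m * (real d * ln \<epsilon>) \<le> a m * ridge_ln_det d \<epsilon> (Z m)" for m
  proof (rule mult_left_mono[OF _ a(1)])
    have "0 < \<epsilon> ^ d" using \<epsilon> by simp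
    then have "ln (\<epsilon> ^ d) \<le> ridge_ln_det d \<epsilon> (Z m)"
      unfolding ridge_ln_det_def using det_pos_semidef_plus_scalar[OF Z, of \<epsilon> m] \<epsilon> by (intro ln_mono) auto
    then show "real d * ln \<epsilon> \<le> ridge_ln_det d \<epsilon> (Z m)" using \<epsilon> by (simp add: ln_realpow)
  qed
  moreover have "(\<lambda>m. a m * (real d * ln \<epsilon>)) \<longlonglongrightarrow> a' * (real d * ln \<epsilon>)"
    by (intro tendsto_mult a(2) tendsto_const)
  ultimately show ?thesis using True by (intro exI[of _ "\<lambda>m. a m * (real d * ln \<epsilon>)"]) auto
next
  case False
  have "0 \<le> a'" by (rule LIMSEQ_le_const[OF a(2)]) (use a(1) in auto)
  have ev: "\<forall>\<^sub>F m in sequentially. a m \<noteq> 0" by (rule tendsto_imp_eventually_ne[OF a(2) False])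
  have "(\<lambda>m. Z m $$ (i, j)) \<longlonglongrightarrow> Z' $$ (i, j)" if ij: "i < d" "j < d" for i j
  proof -
    have "(\<lambda>m. a m * Z m $$ (i, j) / a m) \<longlonglongrightarrow> a' * Z' $$ (i, j) / a'"
      by (intro tendsto_divide lim ij a(2) False)
    moreover have "\<forall>\<^sub>F m in sequentially. a m * Z m $$ (i, j) / a m = Z m $$ (i, j)"
      using ev by eventually_elim simp
    ultimately show ?thesis using Lim_transform_eventually False by fastforce
  qed
  then have "(\<lambda>m. ridge_ln_det d \<epsilon> (Z m)) \<longlonglongrightarrow> ridge_ln_det d \<epsilon> Z'"
    using Z by (intro ridge_ln_det_tendsto Z' \<epsilon>) (auto simp: pos_semidef_def)
  then have "(\<lambda>m. a m * ridge_ln_det d \<epsilon> (Z m)) \<longlonglongrightarrow> a' * ridge_ln_det d \<epsilon> Z'"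
    by (intro tendsto_mult a(2))
  then show ?thesis by (intro exI[of _ "\<lambda>m. a m * ridge_ln_det d \<epsilon> (Z m)"]) auto
qed

lemma ridge_ln_det_strict_concave:
  assumes A: "pos_semidef d A" and B: "pos_semidef d B" and ne: "A \<noteq> B" and \<epsilon>: "0 < \<epsilon>" and t: "0 < t" "t < 1"
  shows "t * ridge_ln_det d \<epsilon> A + (1 - t) * ridge_ln_det d \<epsilon> B < ridge_ln_det d \<epsilon> (t \<cdot>\<^sub>m A + (1 - t) \<cdot>\<^sub>m B)"
proof -
  have Ac: "A \<in> carrier_mat d d" and Bc: "B \<in> carrier_mat d d" using A B by (auto simp: pos_semidef_def)
  have ne': "A + \<epsilon> \<cdot>\<^sub>m 1\<^sub>m d \<noteq> B + \<epsilon> \<cdot>\<^sub>m 1\<^sub>m d"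
  proof
    assume eq: "A + \<epsilon> \<cdot>\<^sub>m 1\<^sub>m d = B + \<epsilon> \<cdot>\<^sub>m 1\<^sub>m d"
    have "A = B"
    proof (rule eq_matI)
      fix i j assume "i < dim_row B" "j < dim_col B"
      then show "A $$ (i, j) = B $$ (i, j)"
        using Ac Bc arg_cong[OF eq, of "\<lambda>M. M $$ (i, j)"] by (auto split: if_splits)
    qed (use Ac Bc in auto)
    with ne show False by simp
  qed
  have "t \<cdot>\<^sub>m (A + \<epsilon> \<cdot>\<^sub>m 1\<^sub>m d) + (1 - t) \<cdot>\<^sub>m (B + \<epsilon> \<cdot>\<^sub>m 1\<^sub>m d) = t \<cdot>\<^sub>m A + (1 - t) \<cdot>\<^sub>m B + \<epsilon> \<cdot>\<^sub>m 1\<^sub>m d"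
    using Ac Bc by (intro eq_matI) (auto simp: algebra_simps)
  then show ?thesis
    using ln_det_strict_concave[OF pos_semidef_plus_scalar_pos_def[OF A \<epsilon>] pos_semidef_plus_scalar_pos_def[OF B \<epsilon>] t ne']
    by (simp add: ridge_ln_det_def)
qed

section \<open>Residuals of the PCA projection\<close>

lemma qform_second_moment:
  "qform d (\<lambda>i j. (\<Sum>t\<in>T. x t i * x t j) / c) v = (\<Sum>t\<in>T. (ip d v (x t))\<^sup>2) / c"
proof -
  have "qform d (\<lambda>i j. (\<Sum>t\<in>T. x t i * x t j) / c) v
      = (\<Sum>i<d. \<Sum>j<d. \<Sum>t\<in>T. (v i * x t i) * (v j * x t j) / c)"
    unfolding qform_def
    by (intro sum.cong refl) (simp add: sum_distrib_left sum_distrib_right sum_divide_distrib algebra_simps)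
  also have "\<dots> = (\<Sum>i<d. \<Sum>t\<in>T. \<Sum>j<d. (v i * x t i) * (v j * x t j) / c)"
    by (intro sum.cong refl sum.swap)
  also have "\<dots> = (\<Sum>t\<in>T. \<Sum>i<d. \<Sum>j<d. (v i * x t i) * (v j * x t j) / c)"
    by (rule sum.swap)
  also have "\<dots> = (\<Sum>t\<in>T. (ip d v (x t))\<^sup>2) / c"
    by (simp add: ip_def power2_eq_square sum_product sum_divide_distrib)
  finally show ?thesis .
qed

lemma square_add_le: "((a::real) + b)\<^sup>2 \<le> 2 * a\<^sup>2 + 2 * b\<^sup>2"
  using zero_le_power2[of "a - b"] by (simp add: power2_eq_square algebra_simps)

text \<open>The \<open>q + 1\<close> leading eigenvectors of the sample covariance \<open>M\<close> span a vector orthogonal to all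
  the \<open>q\<close> basis loadings, hence almost orthogonal to all loadings. This bounds the eigenvalues
  after the first \<open>q\<close>, and therefore also \<open>M\<close> in the direction of a residual.\<close>

lemma pca_residual_bound:
  fixes x e g L :: "nat \<Rightarrow> nat \<Rightarrow> real"
  assumes T: "finite T" and N: "0 < N"
    and x: "\<And>t i. t \<in> T \<Longrightarrow> i < d \<Longrightarrow> x t i = (\<Sum>k<r. L k i * g t k) + e t i"
    and eb: "eigenbasis d (\<lambda>i j. (\<Sum>t\<in>T. x t i * x t j) / N) \<mu> w" and qd: "q < d"
    and lead: "\<And>i j. i < q \<Longrightarrow> q \<le> j \<Longrightarrow> j < d \<Longrightarrow> \<mu> j \<le> \<mu> i"
    and orth: "\<And>i j. i < q \<Longrightarrow> j < q \<Longrightarrow> ip d (u i) (u j) = (if i = j then 1 else 0)"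
    and ev: "\<And>j i. j < q \<Longrightarrow> i < d \<Longrightarrow> (\<Sum>l<d. (\<Sum>t\<in>T. x t i * x t l) / N * u j l) = \<mu> j * u j i"
    and err: "\<And>v. (\<Sum>t\<in>T. (ip d v (e t))\<^sup>2) / N \<le> \<eta> * ip d v v" and \<eta>: "0 \<le> \<eta>"
    and fac: "(\<Sum>t\<in>T. \<Sum>k<r. (g t k)\<^sup>2) / N \<le> \<gamma>"
    and low: "\<And>a. \<delta> * ip r a a \<le> (\<Sum>t\<in>T. (ip r a (g t))\<^sup>2) / N" and \<delta>: "0 < \<delta>"
    and B: "finite B" "card B \<le> q"
    and apx: "\<And>k. k < r \<Longrightarrow> ip d (\<lambda>i. L k i - (\<Sum>b\<in>B. c k b * L b i)) (\<lambda>i. L k i - (\<Sum>b\<in>B. c k b * L b i)) \<le> \<zeta>"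
    and \<zeta>: "0 \<le> \<zeta>" and k: "k < r"
  shows "ip d (\<lambda>i. L k i - (\<Sum>j<q. ip d (L k) (u j) * u j i)) (\<lambda>i. L k i - (\<Sum>j<q. ip d (L k) (u j) * u j i))
    \<le> (4 * (real r * \<gamma> * \<zeta> + \<eta>) + 2 * \<eta>) / \<delta>"
proof -
  let ?M = "\<lambda>i j. (\<Sum>t\<in>T. x t i * x t j) / N"
  have ipx: "ip d v (x t) = ip r (\<lambda>k. ip d (L k) v) (g t) + ip d v (e t)" if "t \<in> T" for v t
  proof -
    have "ip d v (x t) = ip d (\<lambda>i. (\<Sum>k<r. g t k * L k i) + e t i) v"
      unfolding ip_commute[of d v] by (intro ip_cong refl) (simp add: x[OF that] mult.commute)
    also have "\<dots> = (\<Sum>k<r. g t k * ip d (L k) v) + ip d (e t) v"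
      by (simp add: ip_add_left ip_sum_left)
    finally show ?thesis by (simp add: ip_def mult.commute)
  qed
  have "0 \<le> (\<Sum>t\<in>T. \<Sum>k<r. (g t k)\<^sup>2) / N" using N by (intro divide_nonneg_pos sum_nonneg) auto
  then have \<gamma>: "0 \<le> \<gamma>" using fac by linarith
  \<comment> \<open>The inequality
    \<open>(a + b)\<^sup>2 \<le> 2 * a\<^sup>2 + 2 * b\<^sup>2\<close> separates signal from error.
    In a unit direction orthogonal to all \<open>L b\<close>, each of the \<open>r\<close> loadings
    has squared component at most \<open>\<zeta>\<close>, against mean squared factors
    \<open>\<gamma>\<close>; the error contributes at most \<open>\<eta>\<close>.\<close>
  define m where "m = 2 * (real r * \<gamma> * \<zeta> + \<eta>)"
  have m0: "0 \<le> m" using \<gamma> \<zeta> \<eta> by (simp add: m_def)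
  have tail: "\<mu> j \<le> m" if jd: "q \<le> j" "j < d" for j
  proof -
    obtain z where z: "0 < ip d z z" "\<And>b. b \<in> B \<Longrightarrow> ip d (L b) z = 0" "\<mu> j * ip d z z \<le> qform d ?M z"
      using exists_large_qform_in_codimension[OF eb qd lead[OF _ jd] jd B, of L] by blast
    have Lz: "(ip d (L k) z)\<^sup>2 \<le> \<zeta> * ip d z z" if "k < r" for k
    proof -
      have "ip d (L k) z = ip d (\<lambda>i. L k i - (\<Sum>b\<in>B. c k b * L b i)) z"
        by (simp add: ip_diff_left ip_sum_left z(2))
      then show ?thesis
        using order.trans[OF ip_Cauchy_Schwarz mult_right_mono[OF apx[OF that] ip_nonneg]] by simp
    qed
    have gz: "(ip r (\<lambda>k. ip d (L k) z) (g t))\<^sup>2 \<le> real r * \<zeta> * ip d z z * (\<Sum>k<r. (g t k)\<^sup>2)" for t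
    proof -
      have "(ip r (\<lambda>k. ip d (L k) z) (g t))\<^sup>2 \<le> (\<Sum>k<r. (ip d (L k) z)\<^sup>2) * (\<Sum>k<r. (g t k)\<^sup>2)"
        unfolding ip_def[of r] by (rule sum_Cauchy_Schwarz)
      also have "\<dots> \<le> (\<Sum>k<r. \<zeta> * ip d z z) * (\<Sum>k<r. (g t k)\<^sup>2)"
        using Lz by (intro mult_right_mono sum_mono sum_nonneg) auto
      finally show ?thesis by (simp add: mult.assoc)
    qed
    have "qform d ?M z \<le> (\<Sum>t\<in>T. 2 * (real r * \<zeta> * ip d z z * (\<Sum>k<r. (g t k)\<^sup>2)) + 2 * (ip d z (e t))\<^sup>2) / N"
      unfolding qform_second_moment
    proof (intro divide_right_mono sum_mono)
      fix t assume "t \<in> T"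
      show "(ip d z (x t))\<^sup>2 \<le> 2 * (real r * \<zeta> * ip d z z * (\<Sum>k<r. (g t k)\<^sup>2)) + 2 * (ip d z (e t))\<^sup>2"
        unfolding ipx[OF \<open>t \<in> T\<close>]
        using square_add_le[of "ip r (\<lambda>k. ip d (L k) z) (g t)" "ip d z (e t)"] gz[of t] by linarith
    qed (use N in simp)
    also have "\<dots> = 2 * (real r * \<zeta> * ip d z z * ((\<Sum>t\<in>T. \<Sum>k<r. (g t k)\<^sup>2) / N)) + 2 * ((\<Sum>t\<in>T. (ip d z (e t))\<^sup>2) / N)"
      by (simp add: sum.distrib sum_distrib_left add_divide_distrib sum_divide_distrib)
    also have "\<dots> \<le> 2 * (real r * \<zeta> * ip d z z * \<gamma>) + 2 * (\<eta> * ip d z z)"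
      using \<zeta> by (intro add_mono mult_left_mono fac err mult_nonneg_nonneg ip_nonneg) auto
    also have "\<dots> = m * ip d z z" by (simp add: m_def algebra_simps)
    finally have "\<mu> j * ip d z z \<le> m * ip d z z" using z(3) by linarith
    then show ?thesis using z(1) by simp
  qed
  let ?v = "\<lambda>i. L k i - (\<Sum>j<q. ip d (L k) (u j) * u j i)"
  let ?n = "ip d ?v ?v"
  have vu: "ip d ?v (u j) = 0" if "j < q" for j
    by (rule ip_orth_residual) (use orth that in auto)
  have qv: "qform d ?M ?v \<le> m * ?n"
    by (rule qform_orthogonal_leading_eigenvectors[OF eb _ orth ev tail vu]) (use qd in auto)
  \<comment> \<open>\<open>ip r ?a (g t)\<close> is the signal part of \<open>ip d ?v (x t)\<close>.
    The entry at \<open>k\<close> is the squared residual norm, since the residual is orthogonal to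
    the projection of \<open>L k\<close>.\<close>
  let ?a = "\<lambda>l. ip d (L l) ?v"
  have ak: "?a k = ?n"
  proof -
    have "ip d ?v (\<lambda>i. \<Sum>j<q. ip d (L k) (u j) * u j i) = 0" unfolding ip_sum_right by (simp add: vu)
    then show ?thesis unfolding ip_commute[of d "L k"] by (simp only: ip_diff_right)
  qed
  have "\<delta> * ?n\<^sup>2 \<le> \<delta> * ip r ?a ?a"
  proof (intro mult_left_mono)
    show "?n\<^sup>2 \<le> ip r ?a ?a"
      unfolding ak[symmetric] ip_def[of r] power2_eq_square using k by (intro member_le_sum) auto
  qed (use \<delta> in simp)
  also have "\<dots> \<le> (\<Sum>t\<in>T. (ip r ?a (g t))\<^sup>2) / N" by (rule low)
  \<comment> \<open>Now the signal is written as data minus error, the reverse of the split that led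
    to \<open>m\<close>.\<close>
  also have "\<dots> \<le> (\<Sum>t\<in>T. 2 * (ip d ?v (x t))\<^sup>2 + 2 * (ip d ?v (e t))\<^sup>2) / N"
  proof (intro divide_right_mono sum_mono)
    fix t assume "t \<in> T"
    show "(ip r ?a (g t))\<^sup>2 \<le> 2 * (ip d ?v (x t))\<^sup>2 + 2 * (ip d ?v (e t))\<^sup>2"
      using square_add_le[of "ip d ?v (x t)" "- ip d ?v (e t)"] ipx[OF \<open>t \<in> T\<close>, of ?v] by simp
  qed (use N in simp)
  also have "\<dots> = 2 * qform d ?M ?v + 2 * ((\<Sum>t\<in>T. (ip d ?v (e t))\<^sup>2) / N)"
    unfolding qform_second_moment
    by (simp add: sum.distrib sum_distrib_left add_divide_distrib sum_divide_distrib)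
  also have "\<dots> \<le> 2 * (m * ?n) + 2 * (\<eta> * ?n)"
    using qv err[of ?v] by linarith
  finally have main: "\<delta> * ?n * ?n \<le> (2 * m + 2 * \<eta>) * ?n" by (simp add: power2_eq_square algebra_simps)
  \<comment> \<open>The lower bound is quadratic in \<open>?n\<close> and the upper bound linear, so
    one factor cancels.\<close>
  have "\<delta> * ?n \<le> 2 * m + 2 * \<eta>"
  proof (cases "?n = 0")
    case True
    then show ?thesis using m0 \<eta> by (simp only: mult_zero_right)
  next
    case False
    then have "0 < ?n" using ip_nonneg[of d ?v] by linarith
    with main show ?thesis by (rule mult_right_le_imp_le)
  qed
  then have "?n \<le> (2 * m + 2 * \<eta>) / \<delta>" using \<delta> by (simp add: le_divide_eq mult.commute)
  then show ?thesis by (simp add: m_def)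
qed

text \<open>Both regimes are written as one factor model \<open>x = L g + e\<close> with \<open>r = q\<^sub>1 + q\<^sub>2\<close> factors: \<open>L\<close> is the
  block matrix of all loadings, and \<open>g\<close> is the factor vector of the active regime padded with zeros.
  \<open>D1\<close> and \<open>D2\<close> are the padded factor covariances and \<open>\<eta>\<close> bounds the operator norm of the
  error second moment.\<close>

locale factor_break_model =
  fixes \<theta> :: real and p :: "nat \<Rightarrow> nat" and q r :: nat
    and L :: "nat \<Rightarrow> nat \<Rightarrow> nat \<Rightarrow> real" and g e x y u :: "nat \<Rightarrow> nat \<Rightarrow> nat \<Rightarrow> real"
    and \<mu> :: "nat \<Rightarrow> nat \<Rightarrow> real" and S D1 D2 :: "nat \<Rightarrow> nat \<Rightarrow> real"
    and \<eta> :: "nat \<Rightarrow> real" and B :: "nat set" and c :: "nat \<Rightarrow> nat \<Rightarrow> real"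
  assumes theta: "0 < \<theta>" "\<theta> < 1"
    and p_lim: "filterlim p at_top sequentially"
    and x: "\<And>n t i. t \<in> {1..n} \<Longrightarrow> i < p n \<Longrightarrow> x n t i = (\<Sum>k<r. L n k i * g n t k) + e n t i"
    and gram: "\<And>k l. k < r \<Longrightarrow> l < r \<Longrightarrow> (\<lambda>n. ip (p n) (L n k) (L n l) / real (p n)) \<longlonglongrightarrow> S k l"
    and S_dep: "\<And>k l. k < r \<Longrightarrow> l < r \<Longrightarrow> S l k = (\<Sum>b\<in>B. c k b * S l b)"
    and B: "B \<subseteq> {..<r}" "card B \<le> q"
    and fac: "\<And>s k l. 0 \<le> s \<Longrightarrow> s \<le> 1 \<Longrightarrow> k < r \<Longrightarrow> l < r \<Longrightarrow>
      (\<lambda>n. (\<Sum>t\<in>{1..nat \<lfloor>s * real n\<rfloor>}. g n t k * g n t l) / real n)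
        \<longlonglongrightarrow> min s \<theta> * D1 k l + max 0 (s - \<theta>) * D2 k l"
    and D_sym: "\<And>k l. k < r \<Longrightarrow> l < r \<Longrightarrow> D1 k l = D1 l k" "\<And>k l. k < r \<Longrightarrow> l < r \<Longrightarrow> D2 k l = D2 l k"
    and D_nonneg: "\<And>v. 0 \<le> qform r D1 v" "\<And>v. 0 \<le> qform r D2 v"
    and D_pos: "\<exists>\<delta>>0. \<forall>v. \<delta> * ip r v v \<le> \<theta> * qform r D1 v + (1 - \<theta>) * qform r D2 v"
    and D_diff: "(\<Sum>a<r. \<Sum>b<r. \<Sum>a'<r. \<Sum>b'<r.
      (D1 a b - D2 a b) * (D1 a' b' - D2 a' b') * (S a a' * S b b')) \<noteq> 0"
    and err: "\<And>n v. (\<Sum>t\<in>{1..n}. (ip (p n) v (e n t))\<^sup>2) / real n \<le> \<eta> n * ip (p n) v v"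
    and err_nonneg: "\<And>n. 0 \<le> \<eta> n"
    and err_lim: "(\<lambda>n. \<eta> n / real (p n)) \<longlonglongrightarrow> 0"
    and basis: "\<And>n. q \<le> p n \<Longrightarrow> \<exists>w. eigenbasis (p n) (\<lambda>i j. (\<Sum>t\<in>{1..n}. x n t i * x n t j) / real n) (\<mu> n) w"
    and lead: "\<And>n i j. q \<le> p n \<Longrightarrow> i < q \<Longrightarrow> q \<le> j \<Longrightarrow> j < p n \<Longrightarrow> \<mu> n j \<le> \<mu> n i"
    and orth: "\<And>n i j. q \<le> p n \<Longrightarrow> i < q \<Longrightarrow> j < q \<Longrightarrow> ip (p n) (u n i) (u n j) = (if i = j then 1 else 0)"
    and eigen: "\<And>n i j. q \<le> p n \<Longrightarrow> j < q \<Longrightarrow> i < p n \<Longrightarrow>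
      (\<Sum>l<p n. (\<Sum>t\<in>{1..n}. x n t i * x n t l) / real n * u n j l) = \<mu> n j * u n j i"
    and y: "\<And>n t j. q \<le> p n \<Longrightarrow> t \<in> {1..n} \<Longrightarrow> j < q \<Longrightarrow> y n t j = ip (p n) (u n j) (x n t) / sqrt (real (p n))"
begin

section \<open>Asymptotics of residuals, score loadings and score errors\<close>

definition resid :: "nat \<Rightarrow> nat \<Rightarrow> nat \<Rightarrow> real" where
  "resid n k = (\<lambda>i. L n k i - (\<Sum>j<q. ip (p n) (L n k) (u n j) * u n j i))"

text \<open>The matrix \<open>C\<close> of the overview before any limit: row \<open>j\<close>
  belongs to a score, column \<open>k\<close> to a factor.\<close>

definition load :: "nat \<Rightarrow> nat \<Rightarrow> nat \<Rightarrow> real" where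
  "load n j k = ip (p n) (L n k) (u n j) / sqrt (real (p n))"

lemma eventually_p_gt: "\<forall>\<^sub>F n in sequentially. m < p n"
  using p_lim[unfolded filterlim_at_top, rule_format, of "Suc m"] by (simp add: Suc_le_eq)

lemma fac_full: "k < r \<Longrightarrow> l < r \<Longrightarrow>
    (\<lambda>n. (\<Sum>t\<in>{1..n}. g n t k * g n t l) / real n) \<longlonglongrightarrow> \<theta> * D1 k l + (1 - \<theta>) * D2 k l"
  using fac[of 1 k l] theta by (simp add: min_def max_def)

text \<open>A positive definite limit has room to spare: entrywise convergence eventually costs at
  most half of its lower bound, uniformly in \<open>a\<close>.\<close>

lemma factor_lower_bound:
  "\<exists>\<delta>>0. \<forall>\<^sub>F n in sequentially. \<forall>a. \<delta> * ip r a a \<le> (\<Sum>t\<in>{1..n}. (ip r a (g n t))\<^sup>2) / real n"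
proof -
  obtain \<delta> where \<delta>: "\<delta> > 0" "\<And>v. \<delta> * ip r v v \<le> \<theta> * qform r D1 v + (1 - \<theta>) * qform r D2 v"
    using D_pos by blast
  let ?H = "\<lambda>k l. \<theta> * D1 k l + (1 - \<theta>) * D2 k l"
  let ?G = "\<lambda>n k l. (\<Sum>t\<in>{1..n}. g n t k * g n t l) / real n"
  \<comment> \<open>Entrywise errors below \<open>\<beta>\<close> change the quadratic form by at
    most \<open>\<beta> * real r * ip r a a\<close>; the \<open>+ 1\<close> avoids a zero
    denominator when \<open>r = 0\<close>.\<close>
  define \<beta> where "\<beta> = \<delta> / (2 * (real r + 1))"
  have \<beta>: "\<beta> > 0" "\<beta> * real r \<le> \<delta> / 2" using \<delta>(1) by (auto simp: \<beta>_def field_simps)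
  have "\<forall>\<^sub>F n in sequentially. \<forall>k\<in>{..<r}. \<forall>l\<in>{..<r}. \<bar>?G n k l - ?H k l\<bar> < \<beta>"
  proof (intro eventually_ball_finite ballI finite_lessThan)
    fix k l assume "k \<in> {..<r}" "l \<in> {..<r}"
    then show "\<forall>\<^sub>F n in sequentially. \<bar>?G n k l - ?H k l\<bar> < \<beta>"
      using tendstoD[OF fac_full \<beta>(1), of k l] by (simp add: dist_real_def)
  qed
  then have "\<forall>\<^sub>F n in sequentially. \<forall>a. \<delta> / 2 * ip r a a \<le> (\<Sum>t\<in>{1..n}. (ip r a (g n t))\<^sup>2) / real n"
  proof eventually_elim
    case (elim n)
    show ?case
    proof
      fix a
      have "\<bar>qform r (?G n) a - qform r ?H a\<bar> \<le> (\<Sum>k<r. \<Sum>l<r. \<beta> * (((a k)\<^sup>2 + (a l)\<^sup>2) / 2))"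
      proof -
        have eq: "qform r (?G n) a - qform r ?H a = (\<Sum>k<r. \<Sum>l<r. a k * (?G n k l - ?H k l) * a l)"
          unfolding qform_def sum_subtractf[symmetric] by (intro sum.cong refl) (simp only: algebra_simps)
        show ?thesis unfolding eq
        proof (intro order.trans[OF sum_abs] sum_mono)
          fix k l assume kl: "k \<in> {..<r}" "l \<in> {..<r}"
          have "\<bar>a k * (?G n k l - ?H k l) * a l\<bar> = \<bar>?G n k l - ?H k l\<bar> * \<bar>a k * a l\<bar>"
            by (simp only: abs_mult mult_ac)
          also have "\<dots> \<le> \<beta> * (((a k)\<^sup>2 + (a l)\<^sup>2) / 2)"
          proof (intro mult_mono)
            show "\<bar>?G n k l - ?H k l\<bar> \<le> \<beta>" using elim kl by (meson less_imp_le)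
            show "\<bar>a k * a l\<bar> \<le> ((a k)\<^sup>2 + (a l)\<^sup>2) / 2"
              using zero_le_power2[of "a k - a l"] zero_le_power2[of "a k + a l"]
              by (auto simp: abs_if power2_eq_square algebra_simps)
          qed (use \<beta> in auto)
          finally show "\<bar>a k * (?G n k l - ?H k l) * a l\<bar> \<le> \<beta> * (((a k)\<^sup>2 + (a l)\<^sup>2) / 2)" .
        qed
      qed
      also have "\<dots> = \<beta> * real r * ip r a a"
      proof -
        have "(\<Sum>k<r. \<Sum>l<r. (a k)\<^sup>2 + (a l)\<^sup>2) = 2 * real r * ip r a a"
          by (simp add: sum.distrib ip_def power2_eq_square flip: sum_distrib_left)
        then show ?thesis unfolding sum_distrib_left[symmetric] sum_divide_distrib[symmetric] by simp
      qed
      also have "\<dots> \<le> \<delta> / 2 * ip r a a" by (intro mult_right_mono \<beta>(2) ip_nonneg)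
      finally have "qform r ?H a - \<delta> / 2 * ip r a a \<le> qform r (?G n) a" by linarith
      moreover have "qform r ?H a = \<theta> * qform r D1 a + (1 - \<theta>) * qform r D2 a"
        unfolding qform_def sum_distrib_left sum.distrib[symmetric] by (intro sum.cong refl) (simp add: algebra_simps)
      ultimately have "\<delta> / 2 * ip r a a \<le> qform r (?G n) a" using \<delta>(2)[of a] by simp
      then show "\<delta> / 2 * ip r a a \<le> (\<Sum>t\<in>{1..n}. (ip r a (g n t))\<^sup>2) / real n"
        unfolding qform_second_moment .
    qed
  qed
  then show ?thesis using \<delta>(1) by (intro exI[of _ "\<delta> / 2"]) auto
qed

text \<open>The coefficient vector of this combination lies in the kernel of \<open>S\<close>.\<close>

lemma dependent_combination_negligible:
  assumes k: "k < r"
  shows "(\<lambda>n. ip (p n) (\<lambda>i. L n k i - (\<Sum>b\<in>B. c k b * L n b i))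
    (\<lambda>i. L n k i - (\<Sum>b\<in>B. c k b * L n b i)) / real (p n)) \<longlonglongrightarrow> 0"
proof -
  let ?G = "\<lambda>n k l. ip (p n) (L n k) (L n l) / real (p n)"
  have expand: "ip (p n) (\<lambda>i. L n k i - (\<Sum>b\<in>B. c k b * L n b i)) (\<lambda>i. L n k i - (\<Sum>b\<in>B. c k b * L n b i)) / real (p n)
     = (?G n k k - (\<Sum>b\<in>B. c k b * ?G n k b)) - (\<Sum>b\<in>B. c k b * (?G n b k - (\<Sum>b'\<in>B. c k b' * ?G n b b')))" for n
    by (simp add: ip_diff_left ip_diff_right ip_sum_left ip_sum_right diff_divide_distrib sum_divide_distrib
        sum_subtractf right_diff_distrib sum_distrib_left)
  have Br: "b < r" if "b \<in> B" for b using B that by auto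
  have "(\<lambda>n. (?G n k k - (\<Sum>b\<in>B. c k b * ?G n k b)) - (\<Sum>b\<in>B. c k b * (?G n b k - (\<Sum>b'\<in>B. c k b' * ?G n b b'))))
     \<longlonglongrightarrow> (S k k - (\<Sum>b\<in>B. c k b * S k b)) - (\<Sum>b\<in>B. c k b * (S b k - (\<Sum>b'\<in>B. c k b' * S b b')))"
    by (intro tendsto_diff tendsto_sum tendsto_mult tendsto_const gram Br k)
  also have "(S k k - (\<Sum>b\<in>B. c k b * S k b)) - (\<Sum>b\<in>B. c k b * (S b k - (\<Sum>b'\<in>B. c k b' * S b b'))) = 0"
    by (simp add: S_dep[OF k k, symmetric] S_dep[OF k Br, symmetric])
  finally show ?thesis unfolding expand .
qed

text \<open>The bound of \<open>pca_residual_bound\<close> is linear in the error norm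
  \<open>\<eta> n\<close> and the defect \<open>\<zeta> n\<close> of the linear relations. Both are
  of smaller order than \<open>p n\<close>, while \<open>\<gamma>\<close> and
  \<open>\<delta>\<close> stay fixed.\<close>

lemma resid_negligible:
  assumes k: "k < r"
  shows "(\<lambda>n. ip (p n) (resid n k) (resid n k) / real (p n)) \<longlonglongrightarrow> 0"
proof -
  obtain \<delta> where \<delta>: "\<delta> > 0" and low: "\<forall>\<^sub>F n in sequentially. \<forall>a. \<delta> * ip r a a \<le> (\<Sum>t\<in>{1..n}. (ip r a (g n t))\<^sup>2) / real n"
    using factor_lower_bound by blast
  let ?H = "\<lambda>k l. \<theta> * D1 k l + (1 - \<theta>) * D2 k l"
  \<comment> \<open>The limit of the mean squared factor norm, plus 1 so that the averages
    eventually lie below it.\<close>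
  define \<gamma> where "\<gamma> = (\<Sum>k<r. ?H k k) + 1"
  let ?z = "\<lambda>n k i. L n k i - (\<Sum>b\<in>B. c k b * L n b i)"
  \<comment> \<open>Summing over \<open>k\<close> gives one bound for the defects of all
    loadings.\<close>
  define \<zeta> where "\<zeta> = (\<lambda>n. \<Sum>k<r. ip (p n) (?z n k) (?z n k))"
  have \<zeta>0: "0 \<le> \<zeta> n" for n unfolding \<zeta>_def by (intro sum_nonneg ip_nonneg)
  have \<zeta>le: "ip (p n) (?z n k) (?z n k) \<le> \<zeta> n" if "k < r" for n k
    unfolding \<zeta>_def by (rule member_le_sum) (use that in \<open>auto simp: ip_nonneg\<close>)
  have "(\<lambda>n. \<Sum>k<r. ip (p n) (?z n k) (?z n k) / real (p n)) \<longlonglongrightarrow> (\<Sum>k<r. 0)"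
    by (intro tendsto_sum dependent_combination_negligible) auto
  then have \<zeta>lim: "(\<lambda>n. \<zeta> n / real (p n)) \<longlonglongrightarrow> 0" by (simp add: \<zeta>_def sum_divide_distrib)
  have "(\<lambda>n. \<Sum>k<r. (\<Sum>t\<in>{1..n}. g n t k * g n t k) / real n) \<longlonglongrightarrow> (\<Sum>k<r. ?H k k)"
    by (intro tendsto_sum fac_full) auto
  then have "\<forall>\<^sub>F n in sequentially. (\<Sum>k<r. (\<Sum>t\<in>{1..n}. g n t k * g n t k) / real n) < \<gamma>"
    by (rule order_tendstoD) (simp add: \<gamma>_def)
  moreover have "(\<Sum>k<r. (\<Sum>t\<in>{1..n}. g n t k * g n t k) / real n) = (\<Sum>t\<in>{1..n}. \<Sum>k<r. (g n t k)\<^sup>2) / real n" for n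
    unfolding sum_divide_distrib[symmetric] by (subst sum.swap) (simp add: power2_eq_square)
  ultimately have fac': "\<forall>\<^sub>F n in sequentially. (\<Sum>t\<in>{1..n}. \<Sum>k<r. (g n t k)\<^sup>2) / real n < \<gamma>" by (simp only:)
  let ?b = "\<lambda>n. (4 * (real r * \<gamma> * \<zeta> n + \<eta> n) + 2 * \<eta> n) / \<delta>"
  have "\<forall>\<^sub>F n in sequentially. ip (p n) (resid n k) (resid n k) / real (p n) \<le> ?b n / real (p n)"
    using fac' low eventually_p_gt[of q] eventually_gt_at_top[of 0]
  proof eventually_elim
    case (elim n)
    obtain w where w: "eigenbasis (p n) (\<lambda>i j. (\<Sum>t\<in>{1..n}. x n t i * x n t j) / real n) (\<mu> n) w"
      using basis[of n] elim(3) by auto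
    have qn: "q \<le> p n" using elim(3) by simp
    have N: "0 < real n" using elim(4) by simp
    have fB: "finite B" using B(1) finite_subset by blast
    have "ip (p n) (resid n k) (resid n k) \<le> ?b n"
      unfolding resid_def
    proof (rule pca_residual_bound[where T = "{1..n}" and N = "real n" and d = "p n" and r = r and q = q
          and x = "x n" and e = "e n" and g = "g n" and L = "L n" and u = "u n" and \<mu> = "\<mu> n" and w = w
          and c = c and B = B and \<eta> = "\<eta> n" and \<gamma> = \<gamma> and \<delta> = \<delta> and \<zeta> = "\<zeta> n" and k = k])
      show "eigenbasis (p n) (\<lambda>i j. (\<Sum>t\<in>{1..n}. x n t i * x n t j) / real n) (\<mu> n) w" by (rule w)
      show "x n t i = (\<Sum>k<r. L n k i * g n t k) + e n t i" if "t \<in> {1..n}" "i < p n" for t i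
        by (rule x[OF that])
      show "\<mu> n j \<le> \<mu> n i" if "i < q" "q \<le> j" "j < p n" for i j by (rule lead[OF qn that])
      show "ip (p n) (u n i) (u n j) = (if i = j then 1 else 0)" if "i < q" "j < q" for i j by (rule orth[OF qn that])
      show "(\<Sum>l<p n. (\<Sum>t\<in>{1..n}. x n t i * x n t l) / real n * u n j l) = \<mu> n j * u n j i"
        if "j < q" "i < p n" for j i by (rule eigen[OF qn that])
      show "(\<Sum>t\<in>{1..n}. (ip (p n) v (e n t))\<^sup>2) / real n \<le> \<eta> n * ip (p n) v v" for v by (rule err)
      show "(\<Sum>t\<in>{1..n}. \<Sum>k<r. (g n t k)\<^sup>2) / real n \<le> \<gamma>" using elim(1) by simp
      show "\<delta> * ip r a a \<le> (\<Sum>t\<in>{1..n}. (ip r a (g n t))\<^sup>2) / real n" for a using elim(2) by blast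
      show "ip (p n) (\<lambda>i. L n k i - (\<Sum>b\<in>B. c k b * L n b i)) (\<lambda>i. L n k i - (\<Sum>b\<in>B. c k b * L n b i)) \<le> \<zeta> n"
        if "k < r" for k by (rule \<zeta>le[OF that])
    qed (use elim N fB B \<zeta>0 k \<delta> err_nonneg in simp_all)
    then show ?case by (rule divide_right_mono) simp
  qed
  moreover have "?b n / real (p n) = (4 * (real r * \<gamma> * (\<zeta> n / real (p n)) + \<eta> n / real (p n)) + 2 * (\<eta> n / real (p n))) / \<delta>" for n
    by (simp add: add_divide_distrib distrib_left divide_divide_eq_left mult.commute[of \<delta>])
  moreover have "(\<lambda>n. (4 * (real r * \<gamma> * (\<zeta> n / real (p n)) + \<eta> n / real (p n)) + 2 * (\<eta> n / real (p n))) / \<delta>)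
      \<longlonglongrightarrow> (4 * (real r * \<gamma> * 0 + 0) + 2 * 0) / \<delta>"
    by (intro tendsto_divide tendsto_add tendsto_mult tendsto_const \<zeta>lim err_lim) (use \<delta> in auto)
  ultimately have le: "\<forall>\<^sub>F n in sequentially. ip (p n) (resid n k) (resid n k) / real (p n) \<le> ?b n / real (p n)"
    and lim: "(\<lambda>n. ?b n / real (p n)) \<longlonglongrightarrow> 0" by simp_all
  show ?thesis
    by (rule tendsto_sandwich[OF _ le tendsto_const lim]) (simp add: ip_nonneg)
qed

text \<open>Since the \<open>u j\<close> are orthonormal, the inner product of two loadings splits
  into products of their coordinates and an inner product of residuals, which Cauchy-Schwarz makes
  negligible. The Gram matrix converges even where \<open>load\<close> does not.\<close>

lemma load_gram:
  assumes k: "k < r" and l: "l < r"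
  shows "(\<lambda>n. \<Sum>j<q. load n j k * load n j l) \<longlonglongrightarrow> S k l"
proof -
  have "(\<lambda>n. ip (p n) (resid n k) (resid n l) / real (p n)) \<longlonglongrightarrow> 0"
  proof (rule tendsto_rabs_zero_cancel, rule tendsto_sandwich[of "\<lambda>_. 0"])
    have "(\<lambda>n. sqrt (ip (p n) (resid n k) (resid n k) / real (p n) * (ip (p n) (resid n l) (resid n l) / real (p n)))) \<longlonglongrightarrow> sqrt (0 * 0)"
      by (intro tendsto_real_sqrt tendsto_mult resid_negligible k l)
    then show "(\<lambda>n. sqrt (ip (p n) (resid n k) (resid n k) / real (p n) * (ip (p n) (resid n l) (resid n l) / real (p n)))) \<longlonglongrightarrow> 0"
      by simp
    show "\<forall>\<^sub>F n in sequentially. \<bar>ip (p n) (resid n k) (resid n l) / real (p n)\<bar>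
        \<le> sqrt (ip (p n) (resid n k) (resid n k) / real (p n) * (ip (p n) (resid n l) (resid n l) / real (p n)))"
    proof (intro always_eventually allI real_le_rsqrt)
      fix n
      have "(ip (p n) (resid n k) (resid n l))\<^sup>2 / (real (p n))\<^sup>2
          \<le> (ip (p n) (resid n k) (resid n k) * ip (p n) (resid n l) (resid n l)) / (real (p n))\<^sup>2"
        by (intro divide_right_mono ip_Cauchy_Schwarz) simp
      then show "\<bar>ip (p n) (resid n k) (resid n l) / real (p n)\<bar>\<^sup>2
          \<le> ip (p n) (resid n k) (resid n k) / real (p n) * (ip (p n) (resid n l) (resid n l) / real (p n))"
        by (simp add: power_divide power2_eq_square)
    qed
  qed auto
  then have "(\<lambda>n. ip (p n) (L n k) (L n l) / real (p n) - ip (p n) (resid n k) (resid n l) / real (p n)) \<longlonglongrightarrow> S k l - 0"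
    by (intro tendsto_diff gram k l)
  moreover have "\<forall>\<^sub>F n in sequentially. ip (p n) (L n k) (L n l) / real (p n) - ip (p n) (resid n k) (resid n l) / real (p n)
      = (\<Sum>j<q. load n j k * load n j l)"
    using eventually_p_gt[of q]
  proof eventually_elim
    case (elim n)
    have z: "ip (p n) (resid n k) (u n j) = 0" if "j < q" for j
      unfolding resid_def by (rule ip_orth_residual) (use orth elim that in auto)
    have "ip (p n) (resid n k) (resid n l) = ip (p n) (resid n k) (L n l)"
      unfolding resid_def[of n l] by (simp add: ip_diff_right ip_sum_right z)
    also have "\<dots> = ip (p n) (L n k) (L n l) - (\<Sum>j<q. ip (p n) (L n k) (u n j) * ip (p n) (L n l) (u n j))"
      unfolding resid_def[of n k] by (simp add: ip_diff_left ip_sum_left ip_commute[of _ _ "L n l"])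
    finally show ?case using elim
      by (simp add: load_def diff_divide_distrib sum_divide_distrib)
  qed
  ultimately show ?thesis using Lim_transform_eventually by fastforce
qed

text \<open>Supplies the compactness for a convergent subsequence: \<open>u j\<close> is a unit
  vector, and the squared lengths of the loadings over \<open>p n\<close> converge.\<close>

lemma load_bounded: "\<exists>b. \<forall>n j k. q \<le> p n \<longrightarrow> j < q \<longrightarrow> k < r \<longrightarrow> \<bar>load n j k\<bar> \<le> b"
proof -
  have "\<exists>b. \<forall>k<r. \<forall>n. ip (p n) (L n k) (L n k) / real (p n) \<le> b"
  proof -
    have "\<exists>b. \<forall>n. ip (p n) (L n k) (L n k) / real (p n) \<le> b" if "k < r" for k
    proof -
      have "Bseq (\<lambda>n. ip (p n) (L n k) (L n k) / real (p n))"
        using gram[OF that that] by (intro convergent_imp_Bseq) (auto simp: convergent_def)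
      then show ?thesis unfolding Bseq_def real_norm_def by (meson abs_le_D1)
    qed
    then obtain b where b: "\<And>k n. k < r \<Longrightarrow> ip (p n) (L n k) (L n k) / real (p n) \<le> b k" by metis
    have "ip (p n) (L n k) (L n k) / real (p n) \<le> Max (b ` {..<r})" if "k < r" for k n
    proof (rule order.trans[OF b[OF that]])
      show "b k \<le> Max (b ` {..<r})" using that by (intro Max_ge) auto
    qed
    then show ?thesis by blast
  qed
  then obtain b where b: "\<And>k n. k < r \<Longrightarrow> ip (p n) (L n k) (L n k) / real (p n) \<le> b" by blast
  have "\<bar>load n j k\<bar> \<le> sqrt b" if "q \<le> p n" "j < q" "k < r" for n j k
  proof (rule real_le_rsqrt)
    have "\<bar>load n j k\<bar>\<^sup>2 = (ip (p n) (L n k) (u n j))\<^sup>2 / real (p n)"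
      by (simp add: load_def power_divide)
    also have "\<dots> \<le> ip (p n) (L n k) (L n k) * ip (p n) (u n j) (u n j) / real (p n)"
      by (intro divide_right_mono ip_Cauchy_Schwarz) simp
    also have "\<dots> \<le> b" using b[OF that(3)] orth[OF that(1,2,2)] by simp
    finally show "\<bar>load n j k\<bar>\<^sup>2 \<le> b" .
  qed
  then show ?thesis by blast
qed

definition score_error :: "nat \<Rightarrow> nat \<Rightarrow> nat \<Rightarrow> real" where
  "score_error n t j = ip (p n) (u n j) (e n t) / sqrt (real (p n))"

lemma score_decomposition:
  assumes "q \<le> p n" "t \<in> {1..n}" "j < q"
  shows "y n t j = (\<Sum>k<r. load n j k * g n t k) + score_error n t j"
proof -
  have "ip (p n) (u n j) (x n t) = ip (p n) (\<lambda>i. (\<Sum>k<r. g n t k * L n k i) + e n t i) (u n j)"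
    unfolding ip_commute[of _ "u n j"] by (intro ip_cong refl) (simp add: x[OF assms(2)] mult.commute)
  also have "\<dots> = (\<Sum>k<r. g n t k * ip (p n) (L n k) (u n j)) + ip (p n) (u n j) (e n t)"
    by (simp add: ip_add_left ip_sum_left ip_commute[of _ "e n t"])
  finally show ?thesis unfolding y[OF assms]
    by (simp add: load_def score_error_def add_divide_distrib sum_divide_distrib mult.commute)
qed

text \<open>The average is the quadratic form of the error second moment at the unit vector
  \<open>u j\<close>, divided by \<open>p n\<close>; \<open>\<eta> n\<close> bounds that
  form.\<close>

lemma score_error_negligible:
  assumes "j < q"
  shows "(\<lambda>n. (\<Sum>t\<in>{1..n}. (score_error n t j)\<^sup>2) / real n) \<longlonglongrightarrow> 0"
proof (rule tendsto_sandwich[OF _ _ tendsto_const err_lim])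
  show "\<forall>\<^sub>F n in sequentially. (\<Sum>t\<in>{1..n}. (score_error n t j)\<^sup>2) / real n \<le> \<eta> n / real (p n)"
    using eventually_p_gt[of q]
  proof eventually_elim
    case (elim n)
    have "(\<Sum>t\<in>{1..n}. (score_error n t j)\<^sup>2) / real n = ((\<Sum>t\<in>{1..n}. (ip (p n) (u n j) (e n t))\<^sup>2) / real n) / real (p n)"
      by (simp add: score_error_def power_divide sum_divide_distrib mult.commute)
    also have "\<dots> \<le> (\<eta> n * ip (p n) (u n j) (u n j)) / real (p n)" by (intro divide_right_mono err) simp
    finally show ?case using orth[of n j j] assms elim by simp
  qed
qed (auto intro!: always_eventually divide_nonneg_nonneg sum_nonneg)

end

section \<open>Limits of the scores and of the objective\<close>

lemma pos_semidefI:
  assumes "A \<in> carrier_mat d d" "\<And>i j. i < d \<Longrightarrow> j < d \<Longrightarrow> A $$ (i, j) = A $$ (j, i)"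
    and "\<And>v. 0 \<le> qform d (\<lambda>i j. A $$ (i, j)) v"
  shows "pos_semidef d A"
  unfolding pos_semidef_def
proof (intro conjI ballI)
  show "transpose_mat A = A" using assms(1,2) by (intro eq_matI) auto
  fix v :: "real vec" assume "v \<in> carrier_vec d"
  then show "0 \<le> v \<bullet> (A *\<^sub>v v)" using qform_mat[OF assms(1)] assms(3) by simp
qed (use assms in auto)

lemma pos_semidef_convex_combination:
  assumes "pos_semidef d A" "pos_semidef d B" "0 \<le> t" "t \<le> 1"
  shows "pos_semidef d (t \<cdot>\<^sub>m A + (1 - t) \<cdot>\<^sub>m B)"
proof (rule pos_semidefI)
  have A: "A \<in> carrier_mat d d" "transpose_mat A = A" and B: "B \<in> carrier_mat d d" "transpose_mat B = B"
    using assms by (auto simp: pos_semidef_def)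
  show "t \<cdot>\<^sub>m A + (1 - t) \<cdot>\<^sub>m B \<in> carrier_mat d d" using A B by simp
  show "(t \<cdot>\<^sub>m A + (1 - t) \<cdot>\<^sub>m B) $$ (i, j) = (t \<cdot>\<^sub>m A + (1 - t) \<cdot>\<^sub>m B) $$ (j, i)" if "i < d" "j < d" for i j
    using that A B symmetric_mat_index[OF A that] symmetric_mat_index[OF B that] by auto
  fix v :: "nat \<Rightarrow> real"
  have "qform d (\<lambda>i j. (t \<cdot>\<^sub>m A + (1 - t) \<cdot>\<^sub>m B) $$ (i, j)) v
      = t * qform d (\<lambda>i j. A $$ (i, j)) v + (1 - t) * qform d (\<lambda>i j. B $$ (i, j)) v"
    unfolding qform_def sum_distrib_left sum.distrib[symmetric]
    by (intro sum.cong refl) (use A B in \<open>auto simp: algebra_simps\<close>)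
  then show "0 \<le> qform d (\<lambda>i j. (t \<cdot>\<^sub>m A + (1 - t) \<cdot>\<^sub>m B) $$ (i, j)) v"
    using pos_semidef_qform_nonneg[OF assms(1), of v] pos_semidef_qform_nonneg[OF assms(2), of v] assms(3,4) by simp
qed

text \<open>Cauchy-Schwarz. Smallness of \<open>v\<close> is known over the larger set, in the
  application the whole sample, and passes to partial sums because squares are nonnegative.\<close>

lemma cross_sum_tendsto_0:
  fixes u v :: "nat \<Rightarrow> nat \<Rightarrow> real"
  assumes T: "\<And>m. T m \<subseteq> T' m" "\<And>m. finite (T' m)" and N: "\<And>m. 0 \<le> N m"
    and u: "(\<lambda>m. (\<Sum>t\<in>T m. (u m t)\<^sup>2) / N m) \<longlonglongrightarrow> a"
    and v: "(\<lambda>m. (\<Sum>t\<in>T' m. (v m t)\<^sup>2) / N m) \<longlonglongrightarrow> 0"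
  shows "(\<lambda>m. (\<Sum>t\<in>T m. u m t * v m t) / N m) \<longlonglongrightarrow> 0"
proof (rule tendsto_rabs_zero_cancel)
  have lim: "(\<lambda>m. sqrt ((\<Sum>t\<in>T m. (u m t)\<^sup>2) / N m * ((\<Sum>t\<in>T' m. (v m t)\<^sup>2) / N m))) \<longlonglongrightarrow> sqrt (a * 0)"
    by (intro tendsto_real_sqrt tendsto_mult u v)
  have le: "\<forall>\<^sub>F m in sequentially. \<bar>(\<Sum>t\<in>T m. u m t * v m t) / N m\<bar>
     \<le> sqrt ((\<Sum>t\<in>T m. (u m t)\<^sup>2) / N m * ((\<Sum>t\<in>T' m. (v m t)\<^sup>2) / N m))"
  proof (intro always_eventually allI real_le_rsqrt)
    fix m
    have "\<bar>(\<Sum>t\<in>T m. u m t * v m t) / N m\<bar>\<^sup>2 = (\<Sum>t\<in>T m. u m t * v m t)\<^sup>2 / (N m)\<^sup>2"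
      by (simp add: power_divide)
    also have "\<dots> \<le> ((\<Sum>t\<in>T m. (u m t)\<^sup>2) * (\<Sum>t\<in>T m. (v m t)\<^sup>2)) / (N m)\<^sup>2"
      by (intro divide_right_mono sum_Cauchy_Schwarz) simp
    also have "\<dots> \<le> ((\<Sum>t\<in>T m. (u m t)\<^sup>2) * (\<Sum>t\<in>T' m. (v m t)\<^sup>2)) / (N m)\<^sup>2"
      using T by (intro divide_right_mono mult_left_mono sum_mono2 sum_nonneg) auto
    finally show "\<bar>(\<Sum>t\<in>T m. u m t * v m t) / N m\<bar>\<^sup>2 \<le> (\<Sum>t\<in>T m. (u m t)\<^sup>2) / N m * ((\<Sum>t\<in>T' m. (v m t)\<^sup>2) / N m)"
      by (simp add: power2_eq_square)
  qed
  show "(\<lambda>m. \<bar>(\<Sum>t\<in>T m. u m t * v m t) / N m\<bar>) \<longlonglongrightarrow> 0"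
    by (rule tendsto_sandwich[OF _ le tendsto_const lim[unfolded mult_zero_right real_sqrt_zero]]) simp
qed

lemma break_index_over_n_tendsto:
  assumes "0 \<le> s"
  shows "(\<lambda>n. real (break_index s n) / real n) \<longlonglongrightarrow> s"
proof (rule tendsto_sandwich)
  show "(\<lambda>n. s - 1 / real n) \<longlonglongrightarrow> s"
    using tendsto_diff[OF tendsto_const[of s] lim_1_over_n] by simp
  show "\<forall>\<^sub>F n in sequentially. s - 1 / real n \<le> real (break_index s n) / real n"
    using eventually_gt_at_top[of 0]
  proof eventually_elim
    case (elim n)
    have "s * real n - 1 \<le> real (break_index s n)" unfolding break_index_def by linarith
    then have "(s * real n - 1) / real n \<le> real (break_index s n) / real n" by (rule divide_right_mono) simp
    then show ?case using elim by (simp add: diff_divide_distrib)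
  qed
  show "\<forall>\<^sub>F n in sequentially. real (break_index s n) / real n \<le> s"
    using eventually_gt_at_top[of 0]
  proof eventually_elim
    case (elim n)
    have "0 \<le> s * real n" using assms by simp
    then have "real (break_index s n) \<le> s * real n" unfolding break_index_def by linarith
    then show ?case using elim by (simp add: divide_le_eq)
  qed
qed auto

section \<open>Limits of the score moments\<close>

context factor_break_model
begin

text \<open>The matrix \<open>C D C^T\<close>; with \<open>D1\<close> and \<open>D2\<close> it gives
  \<open>V\<^sub>1\<close> and \<open>V\<^sub>2\<close> of the overview.\<close>

definition score_cov :: "(nat \<Rightarrow> nat \<Rightarrow> real) \<Rightarrow> (nat \<Rightarrow> nat \<Rightarrow> real) \<Rightarrow> nat \<Rightarrow> nat \<Rightarrow> real" where
  "score_cov C D i j = (\<Sum>k<r. \<Sum>l<r. C i k * D k l * C j l)"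

text \<open>The limit at \<open>s\<close> of \<open>1 / n\<close> times the sum of \<open>y\<^sub>t y\<^sub>t\<^sup>T\<close> over \<open>t \<le> s n\<close>, for limit loadings \<open>C\<close> of the scores.\<close>

definition cum_cov :: "(nat \<Rightarrow> nat \<Rightarrow> real) \<Rightarrow> real \<Rightarrow> nat \<Rightarrow> nat \<Rightarrow> real" where
  "cum_cov C s i j = min s \<theta> * score_cov C D1 i j + max 0 (s - \<theta>) * score_cov C D2 i j"

lemma score_cov_sym:
  assumes "\<And>k l. k < r \<Longrightarrow> l < r \<Longrightarrow> D k l = D l k"
  shows "score_cov C D i j = score_cov C D j i"
  unfolding score_cov_def by (subst sum.swap) (intro sum.cong refl, use assms in auto)

lemma qform_score_cov: "qform d (score_cov C D) v = qform r D (\<lambda>k. \<Sum>i<d. v i * C i k)"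
proof -
  have "qform d (score_cov C D) v = (\<Sum>i<d. \<Sum>j<d. \<Sum>k<r. \<Sum>l<r. (v i * C i k) * D k l * (v j * C j l))"
    unfolding qform_def score_cov_def sum_distrib_left sum_distrib_right
    by (intro sum.cong refl) (simp add: mult_ac)
  also have "\<dots> = (\<Sum>i<d. \<Sum>k<r. \<Sum>j<d. \<Sum>l<r. (v i * C i k) * D k l * (v j * C j l))"
    by (intro sum.cong refl sum.swap)
  also have "\<dots> = (\<Sum>i<d. \<Sum>k<r. \<Sum>l<r. \<Sum>j<d. (v i * C i k) * D k l * (v j * C j l))"
    by (intro sum.cong refl sum.swap)
  also have "\<dots> = (\<Sum>k<r. \<Sum>i<d. \<Sum>l<r. \<Sum>j<d. (v i * C i k) * D k l * (v j * C j l))"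
    by (rule sum.swap)
  also have "\<dots> = (\<Sum>k<r. \<Sum>l<r. \<Sum>i<d. \<Sum>j<d. (v i * C i k) * D k l * (v j * C j l))"
    by (intro sum.cong refl sum.swap)
  also have "\<dots> = qform r D (\<lambda>k. \<Sum>i<d. v i * C i k)"
    unfolding qform_def by (simp only: sum_distrib_right) (simp only: sum_distrib_left)
  finally show ?thesis .
qed

lemma isCont_cum_cov: "isCont (\<lambda>s. cum_cov C s i j) s"
  unfolding cum_cov_def by (intro continuous_intros)

text \<open>A score is a signal \<open>a\<close> plus an error \<open>h\<close>. The signal products
  converge with the loadings and the factor moments; every sum containing \<open>h\<close> vanishes
  because the errors vanish in mean square.\<close>

lemma score_moment_fixed:
  assumes \<phi>: "filterlim \<phi> at_top sequentially" and q\<phi>: "\<And>m. q \<le> p (\<phi> m)"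
    and C: "\<And>j k. j < q \<Longrightarrow> k < r \<Longrightarrow> (\<lambda>m. load (\<phi> m) j k) \<longlonglongrightarrow> C j k"
    and s: "0 \<le> s" "s \<le> 1" and i: "i < q" and j: "j < q"
  shows "(\<lambda>m. (\<Sum>t\<in>{1..nat \<lfloor>s * real (\<phi> m)\<rfloor>}. y (\<phi> m) t i * y (\<phi> m) t j) / real (\<phi> m)) \<longlonglongrightarrow> cum_cov C s i j"
proof -
  define T where "T = (\<lambda>m. {1..nat \<lfloor>s * real (\<phi> m)\<rfloor>})"
  define a where "a = (\<lambda>j m t. \<Sum>k<r. load (\<phi> m) j k * g (\<phi> m) t k)"
  define h where "h = (\<lambda>j m t. score_error (\<phi> m) t j)"
  have T: "T m \<subseteq> {1..\<phi> m}" for m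
  proof -
    have "nat \<lfloor>s * real (\<phi> m)\<rfloor> \<le> \<phi> m"
      using mult_right_mono[OF s(2), of "real (\<phi> m)"] by (simp add: nat_le_iff floor_le_iff)
    then show ?thesis by (auto simp: T_def)
  qed
  have aa: "(\<lambda>m. (\<Sum>t\<in>T m. a i m t * a j m t) / real (\<phi> m)) \<longlonglongrightarrow> cum_cov C s i j" if "i < q" "j < q" for i j
  proof -
    have "(\<Sum>t\<in>T m. a i m t * a j m t) / real (\<phi> m)
       = (\<Sum>k<r. \<Sum>l<r. load (\<phi> m) i k * ((\<Sum>t\<in>T m. g (\<phi> m) t k * g (\<phi> m) t l) / real (\<phi> m)) * load (\<phi> m) j l)" for m
    proof -
      have "(\<Sum>t\<in>T m. a i m t * a j m t)
         = (\<Sum>t\<in>T m. \<Sum>k<r. \<Sum>l<r. load (\<phi> m) i k * (g (\<phi> m) t k * g (\<phi> m) t l) * load (\<phi> m) j l)"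
        unfolding a_def sum_product by (intro sum.cong refl) (simp add: mult_ac)
      also have "\<dots> = (\<Sum>k<r. \<Sum>t\<in>T m. \<Sum>l<r. load (\<phi> m) i k * (g (\<phi> m) t k * g (\<phi> m) t l) * load (\<phi> m) j l)"
        by (rule sum.swap)
      also have "\<dots> = (\<Sum>k<r. \<Sum>l<r. \<Sum>t\<in>T m. load (\<phi> m) i k * (g (\<phi> m) t k * g (\<phi> m) t l) * load (\<phi> m) j l)"
        by (intro sum.cong refl sum.swap)
      finally show ?thesis
        by (simp add: sum_divide_distrib sum_distrib_left sum_distrib_right)
    qed
    moreover have "(\<lambda>m. \<Sum>k<r. \<Sum>l<r. load (\<phi> m) i k * ((\<Sum>t\<in>T m. g (\<phi> m) t k * g (\<phi> m) t l) / real (\<phi> m)) * load (\<phi> m) j l)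
       \<longlonglongrightarrow> (\<Sum>k<r. \<Sum>l<r. C i k * (min s \<theta> * D1 k l + max 0 (s - \<theta>) * D2 k l) * C j l)"
      unfolding T_def
      by (intro tendsto_sum tendsto_mult C that filterlim_compose[OF fac[OF s] \<phi>]) auto
    moreover have "(\<Sum>k<r. \<Sum>l<r. C i k * (min s \<theta> * D1 k l + max 0 (s - \<theta>) * D2 k l) * C j l) = cum_cov C s i j"
      unfolding cum_cov_def score_cov_def sum_distrib_left sum.distrib[symmetric]
      by (intro sum.cong refl) (simp add: algebra_simps)
    ultimately show ?thesis by simp
  qed
  have hfull: "(\<lambda>m. (\<Sum>t\<in>{1..\<phi> m}. (h j m t)\<^sup>2) / real (\<phi> m)) \<longlonglongrightarrow> 0" if "j < q" for j
    unfolding h_def by (rule filterlim_compose[OF score_error_negligible[OF that] \<phi>])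
  have hT: "(\<lambda>m. (\<Sum>t\<in>T m. (h j m t)\<^sup>2) / real (\<phi> m)) \<longlonglongrightarrow> 0" if "j < q" for j
  proof (rule tendsto_sandwich[OF _ _ tendsto_const hfull[OF that]])
    show "\<forall>\<^sub>F m in sequentially. (\<Sum>t\<in>T m. (h j m t)\<^sup>2) / real (\<phi> m) \<le> (\<Sum>t\<in>{1..\<phi> m}. (h j m t)\<^sup>2) / real (\<phi> m)"
      using T by (intro always_eventually allI divide_right_mono sum_mono2) auto
  qed (auto intro!: always_eventually divide_nonneg_nonneg sum_nonneg)
  \<comment> \<open>The diagonal case of \<open>aa\<close> supplies the convergent mean squares of
    the signal.\<close>
  have ah: "(\<lambda>m. (\<Sum>t\<in>T m. a i m t * h j m t) / real (\<phi> m)) \<longlonglongrightarrow> 0" if "i < q" "j < q" for i j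
    by (rule cross_sum_tendsto_0[OF T _ _ aa[OF that(1,1), folded power2_eq_square] hfull[OF that(2)]]) auto
  have hh: "(\<lambda>m. (\<Sum>t\<in>T m. h i m t * h j m t) / real (\<phi> m)) \<longlonglongrightarrow> 0"
    by (rule cross_sum_tendsto_0[OF T _ _ hT[OF i] hfull[OF j]]) auto
  have "(\<Sum>t\<in>T m. y (\<phi> m) t i * y (\<phi> m) t j) / real (\<phi> m)
     = (\<Sum>t\<in>T m. a i m t * a j m t) / real (\<phi> m) + (\<Sum>t\<in>T m. a i m t * h j m t) / real (\<phi> m)
       + (\<Sum>t\<in>T m. a j m t * h i m t) / real (\<phi> m) + (\<Sum>t\<in>T m. h i m t * h j m t) / real (\<phi> m)" for m
  proof -
    have "(\<Sum>t\<in>T m. y (\<phi> m) t i * y (\<phi> m) t j) = (\<Sum>t\<in>T m. (a i m t + h i m t) * (a j m t + h j m t))"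
    proof (intro sum.cong refl)
      fix t assume "t \<in> T m"
      then have t: "t \<in> {1..\<phi> m}" using T by blast
      show "y (\<phi> m) t i * y (\<phi> m) t j = (a i m t + h i m t) * (a j m t + h j m t)"
        unfolding score_decomposition[OF q\<phi> t i] score_decomposition[OF q\<phi> t j] a_def h_def ..
    qed
    then show ?thesis by (simp add: algebra_simps sum.distrib add_divide_distrib)
  qed
  moreover have "(\<lambda>m. (\<Sum>t\<in>T m. a i m t * a j m t) / real (\<phi> m) + (\<Sum>t\<in>T m. a i m t * h j m t) / real (\<phi> m)
       + (\<Sum>t\<in>T m. a j m t * h i m t) / real (\<phi> m) + (\<Sum>t\<in>T m. h i m t * h j m t) / real (\<phi> m))
     \<longlonglongrightarrow> cum_cov C s i j + 0 + 0 + 0"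
    by (intro tendsto_add aa ah hh i j)
  ultimately show ?thesis unfolding T_def by simp
qed

text \<open>By polarization, \<open>y\<^sub>i y\<^sub>j\<close> is a difference of squares, whose partial sums are monotone.\<close>

lemma score_moment_moving:
  assumes \<phi>: "filterlim \<phi> at_top sequentially" and q\<phi>: "\<And>m. q \<le> p (\<phi> m)" and \<phi>0: "\<And>m. 0 < \<phi> m"
    and C: "\<And>j k. j < q \<Longrightarrow> k < r \<Longrightarrow> (\<lambda>m. load (\<phi> m) j k) \<longlonglongrightarrow> C j k"
    and kk: "\<And>m. kk m \<le> \<phi> m" and lim: "(\<lambda>m. real (kk m) / real (\<phi> m)) \<longlonglongrightarrow> s"
    and i: "i < q" and j: "j < q"
  shows "(\<lambda>m. (\<Sum>t\<in>{1..kk m}. y (\<phi> m) t i * y (\<phi> m) t j) / real (\<phi> m)) \<longlonglongrightarrow> cum_cov C s i j"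
proof -
  note fixed = score_moment_fixed[OF \<phi> q\<phi> C]
  have sym: "cum_cov C s i j = cum_cov C s j i" for s
    unfolding cum_cov_def using score_cov_sym[of D1] score_cov_sym[of D2] D_sym by metis
  \<comment> \<open>\<open>\<sigma>\<close> will be 1 and -1; the two squares then differ by four
    times the product of scores \<open>i\<close> and \<open>j\<close>.\<close>
  define F where "F = (\<lambda>\<sigma> m k. (\<Sum>t\<in>{1..k}. (y (\<phi> m) t i + \<sigma> * y (\<phi> m) t j)\<^sup>2) / real (\<phi> m))"
  define v where "v = (\<lambda>\<sigma> s. cum_cov C s i i + 2 * \<sigma> * cum_cov C s i j + \<sigma>\<^sup>2 * cum_cov C s j j)"
  have Fexp: "F \<sigma> m k = (\<Sum>t\<in>{1..k}. y (\<phi> m) t i * y (\<phi> m) t i) / real (\<phi> m)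
      + 2 * \<sigma> * ((\<Sum>t\<in>{1..k}. y (\<phi> m) t i * y (\<phi> m) t j) / real (\<phi> m))
      + \<sigma>\<^sup>2 * ((\<Sum>t\<in>{1..k}. y (\<phi> m) t j * y (\<phi> m) t j) / real (\<phi> m))" for \<sigma> m k
  proof -
    have "(\<Sum>t\<in>{1..k}. (y (\<phi> m) t i + \<sigma> * y (\<phi> m) t j)\<^sup>2) = (\<Sum>t\<in>{1..k}. y (\<phi> m) t i * y (\<phi> m) t i)
      + 2 * \<sigma> * (\<Sum>t\<in>{1..k}. y (\<phi> m) t i * y (\<phi> m) t j) + \<sigma>\<^sup>2 * (\<Sum>t\<in>{1..k}. y (\<phi> m) t j * y (\<phi> m) t j)"
      unfolding sum_distrib_left sum.distrib[symmetric]
      by (intro sum.cong refl) (simp add: power2_eq_square algebra_simps)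
    then show ?thesis by (simp add: F_def add_divide_distrib)
  qed
  have FF: "(\<lambda>m. F \<sigma> m (kk m)) \<longlonglongrightarrow> v \<sigma> s" for \<sigma>
  proof (rule tendsto_monotone_moving_argument[OF _ _ _ \<phi>0 kk lim])
    show "F \<sigma> m k \<le> F \<sigma> m k'" if "k \<le> k'" for m k k'
      unfolding F_def using that by (intro divide_right_mono sum_mono2) auto
    show "(\<lambda>m. F \<sigma> m (nat \<lfloor>s * real (\<phi> m)\<rfloor>)) \<longlonglongrightarrow> v \<sigma> s" if "0 \<le> s" "s \<le> 1" for s
      unfolding Fexp v_def by (intro tendsto_add tendsto_mult tendsto_const fixed that i j)
    show "isCont (v \<sigma>) s" unfolding v_def by (intro continuous_intros isCont_cum_cov)
  qed
  have "(\<lambda>m. (F 1 m (kk m) - F (-1) m (kk m)) / 4) \<longlonglongrightarrow> (v 1 s - v (-1) s) / 4"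
    by (intro tendsto_divide tendsto_diff FF tendsto_const) simp
  then show ?thesis by (simp add: Fexp v_def)
qed

section \<open>Limits of the objective along a subsequence\<close>

definition block_cov :: "nat \<Rightarrow> nat set \<Rightarrow> real mat" where
  "block_cov n T = mat q q (\<lambda>(i, j). (\<Sum>t\<in>T. y n t i * y n t j) / real (card T))"

text \<open>\<open>qml_objective\<close> at \<open>k / n\<close>, indexed by the integer
  \<open>k\<close> so that the blocks carry no floors.\<close>

definition objective :: "real \<Rightarrow> nat \<Rightarrow> nat \<Rightarrow> real" where
  "objective \<epsilon> n k = real k / real n * ridge_ln_det q \<epsilon> (block_cov n {1..k})
    + (1 - real k / real n) * ridge_ln_det q \<epsilon> (block_cov n {k + 1..n})"

lemma block_cov_pos_semidef: "pos_semidef q (block_cov n T)"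
proof (rule pos_semidefI)
  fix v
  have "qform q (\<lambda>i j. block_cov n T $$ (i, j)) v = qform q (\<lambda>i j. (\<Sum>t\<in>T. y n t i * y n t j) / real (card T)) v"
    unfolding qform_def block_cov_def by (intro sum.cong refl) simp
  also have "\<dots> \<ge> 0" unfolding qform_second_moment by (intro divide_nonneg_nonneg sum_nonneg) auto
  finally show "0 \<le> qform q (\<lambda>i j. block_cov n T $$ (i, j)) v" .
qed (auto simp: block_cov_def mult.commute)

text \<open>\<open>W1\<close> and \<open>W2\<close> are the limiting block averages, prescribed only
  through their products with \<open>s\<close> and \<open>1 - s\<close>: at an endpoint, one of them
  may be any positive semidefinite matrix. The lemma serves twice, as a lower bound at the limit of
  the estimator and as the exact limit at the true break.\<close>

lemma objective_lower_limit:
  assumes \<phi>: "filterlim \<phi> at_top sequentially" and q\<phi>: "\<And>m. q \<le> p (\<phi> m)"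
    and C: "\<And>j k. j < q \<Longrightarrow> k < r \<Longrightarrow> (\<lambda>m. load (\<phi> m) j k) \<longlonglongrightarrow> C j k"
    and kk: "\<And>m. 1 \<le> kk m" "\<And>m. kk m < \<phi> m" and lim: "(\<lambda>m. real (kk m) / real (\<phi> m)) \<longlonglongrightarrow> s"
    and W: "pos_semidef q W1" "pos_semidef q W2"
    and W1: "\<And>i j. i < q \<Longrightarrow> j < q \<Longrightarrow> cum_cov C s i j = s * W1 $$ (i, j)"
    and W2: "\<And>i j. i < q \<Longrightarrow> j < q \<Longrightarrow> cum_cov C 1 i j - cum_cov C s i j = (1 - s) * W2 $$ (i, j)"
    and \<epsilon>: "0 < \<epsilon>"
  shows "\<exists>l. l \<longlonglongrightarrow> s * ridge_ln_det q \<epsilon> W1 + (1 - s) * ridge_ln_det q \<epsilon> W2 \<and>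
    (\<forall>m. l m \<le> objective \<epsilon> (\<phi> m) (kk m)) \<and> (0 < s \<and> s < 1 \<longrightarrow> l = (\<lambda>m. objective \<epsilon> (\<phi> m) (kk m)))"
proof -
  have \<phi>0: "0 < \<phi> m" for m using kk(2)[of m] by linarith
  have kl: "kk m \<le> \<phi> m" for m using kk(2)[of m] by simp
  let ?a = "\<lambda>m. real (kk m) / real (\<phi> m)"
  have a: "0 \<le> ?a m" "0 \<le> 1 - ?a m" for m using kl[of m] \<phi>0[of m] by (auto simp: divide_le_eq)
  \<comment> \<open>Weight times block average is a partial sum over \<open>n\<close>, so even a
    block of vanishing share has a moment limit.\<close>
  have m1: "?a m * block_cov (\<phi> m) {1..kk m} $$ (i, j) = (\<Sum>t\<in>{1..kk m}. y (\<phi> m) t i * y (\<phi> m) t j) / real (\<phi> m)"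
    if "i < q" "j < q" for m i j
    using that kk(1)[of m] by (simp add: block_cov_def)
  have m2: "(1 - ?a m) * block_cov (\<phi> m) {kk m + 1..\<phi> m} $$ (i, j)
     = (\<Sum>t\<in>{1..\<phi> m}. y (\<phi> m) t i * y (\<phi> m) t j) / real (\<phi> m) - (\<Sum>t\<in>{1..kk m}. y (\<phi> m) t i * y (\<phi> m) t j) / real (\<phi> m)"
    if "i < q" "j < q" for m i j
  proof -
    have "{1..\<phi> m} = {1..kk m} \<union> {kk m + 1..\<phi> m}" using kl[of m] by auto
    then have sp: "(\<Sum>t\<in>{1..\<phi> m}. y (\<phi> m) t i * y (\<phi> m) t j)
       = (\<Sum>t\<in>{1..kk m}. y (\<phi> m) t i * y (\<phi> m) t j) + (\<Sum>t\<in>{kk m + 1..\<phi> m}. y (\<phi> m) t i * y (\<phi> m) t j)"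
      by (simp only:) (rule sum.union_disjoint, auto)
    have b: "block_cov (\<phi> m) {kk m + 1..\<phi> m} $$ (i, j)
       = (\<Sum>t\<in>{kk m + 1..\<phi> m}. y (\<phi> m) t i * y (\<phi> m) t j) / (real (\<phi> m) - real (kk m))"
      using that kl[of m] by (simp add: block_cov_def of_nat_diff)
    have "1 - ?a m = (real (\<phi> m) - real (kk m)) / real (\<phi> m)" using \<phi>0[of m] by (simp add: field_simps)
    then show ?thesis unfolding sp b using kk(2)[of m] by (simp add: add_divide_distrib)
  qed
  have lim1: "(\<lambda>m. ?a m * block_cov (\<phi> m) {1..kk m} $$ (i, j)) \<longlonglongrightarrow> s * W1 $$ (i, j)" if "i < q" "j < q" for i j
    unfolding m1[OF that] W1[OF that, symmetric]
    by (rule score_moment_moving[OF \<phi> q\<phi> \<phi>0 C kl lim that])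
  have "(\<lambda>m. real (\<phi> m) / real (\<phi> m)) \<longlonglongrightarrow> 1" using \<phi>0 by (simp add: less_imp_neq[symmetric])
  from score_moment_moving[OF \<phi> q\<phi> \<phi>0 C order_refl this]
  have lim2: "(\<lambda>m. (1 - ?a m) * block_cov (\<phi> m) {kk m + 1..\<phi> m} $$ (i, j)) \<longlonglongrightarrow> (1 - s) * W2 $$ (i, j)" if "i < q" "j < q" for i j
    unfolding m2[OF that] W2[OF that, symmetric]
    by (intro tendsto_diff score_moment_moving[OF \<phi> q\<phi> \<phi>0 C kl lim]) (use that in auto)
  have lim': "(\<lambda>m. 1 - ?a m) \<longlonglongrightarrow> 1 - s" by (intro tendsto_diff tendsto_const lim)
  obtain l1 where l1: "l1 \<longlonglongrightarrow> s * ridge_ln_det q \<epsilon> W1"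
    "\<And>m. l1 m \<le> ?a m * ridge_ln_det q \<epsilon> (block_cov (\<phi> m) {1..kk m})"
    "0 < s \<longrightarrow> l1 = (\<lambda>m. ?a m * ridge_ln_det q \<epsilon> (block_cov (\<phi> m) {1..kk m}))"
    using weighted_ridge_ln_det_lower_limit[of q "\<lambda>m. block_cov (\<phi> m) {1..kk m}" W1 \<epsilon> ?a s]
      block_cov_pos_semidef W(1) \<epsilon> a(1) lim lim1 by blast
  obtain l2 where l2: "l2 \<longlonglongrightarrow> (1 - s) * ridge_ln_det q \<epsilon> W2"
    "\<And>m. l2 m \<le> (1 - ?a m) * ridge_ln_det q \<epsilon> (block_cov (\<phi> m) {kk m + 1..\<phi> m})"
    "0 < 1 - s \<longrightarrow> l2 = (\<lambda>m. (1 - ?a m) * ridge_ln_det q \<epsilon> (block_cov (\<phi> m) {kk m + 1..\<phi> m}))"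
    using weighted_ridge_ln_det_lower_limit[of q "\<lambda>m. block_cov (\<phi> m) {kk m + 1..\<phi> m}" W2 \<epsilon> "\<lambda>m. 1 - ?a m" "1 - s"]
      block_cov_pos_semidef W(2) \<epsilon> a(2) lim' lim2 by blast
  show ?thesis
  proof (intro exI[of _ "\<lambda>m. l1 m + l2 m"] conjI allI impI)
    show "(\<lambda>m. l1 m + l2 m) \<longlonglongrightarrow> s * ridge_ln_det q \<epsilon> W1 + (1 - s) * ridge_ln_det q \<epsilon> W2"
      by (intro tendsto_add l1 l2)
    show "l1 m + l2 m \<le> objective \<epsilon> (\<phi> m) (kk m)" for m
      unfolding objective_def by (intro add_mono l1(2) l2(2))
    show "(\<lambda>m. l1 m + l2 m) = (\<lambda>m. objective \<epsilon> (\<phi> m) (kk m))" if "0 < s \<and> s < 1"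
      unfolding objective_def using l1(3) l2(3) that by simp
  qed
qed

text \<open>Otherwise \<open>C (D1 - D2) C^T\<close> is zero. By \<open>load_gram\<close> the limit
  \<open>C\<close> has Gram matrix \<open>S\<close>, so \<open>sum_squares_congruence\<close>
  identifies the squared norm of this matrix with the sum that is nonzero by
  \<open>D_diff\<close>.\<close>

lemma score_cov_differ:
  assumes \<phi>: "filterlim \<phi> at_top sequentially"
    and C: "\<And>j k. j < q \<Longrightarrow> k < r \<Longrightarrow> (\<lambda>m. load (\<phi> m) j k) \<longlonglongrightarrow> C j k"
  shows "\<exists>i<q. \<exists>j<q. score_cov C D1 i j \<noteq> score_cov C D2 i j"
proof (rule ccontr)
  assume "\<not> ?thesis"
  then have eq: "score_cov C D1 i j = score_cov C D2 i j" if "i < q" "j < q" for i j using that by blast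
  have CC: "(\<Sum>j<q. C j k * C j l) = S k l" if "k < r" "l < r" for k l
  proof (rule LIMSEQ_unique)
    show "(\<lambda>m. \<Sum>j<q. load (\<phi> m) j k * load (\<phi> m) j l) \<longlonglongrightarrow> (\<Sum>j<q. C j k * C j l)"
      by (intro tendsto_sum tendsto_mult C that) auto
    show "(\<lambda>m. \<Sum>j<q. load (\<phi> m) j k * load (\<phi> m) j l) \<longlonglongrightarrow> S k l"
      by (rule filterlim_compose[OF load_gram[OF that] \<phi>])
  qed
  have "(\<Sum>i<q. \<Sum>j<q. (\<Sum>a<r. \<Sum>b<r. C i a * (D1 a b - D2 a b) * C j b)\<^sup>2) = (\<Sum>i<q. \<Sum>j<q. 0)"
  proof (intro sum.cong refl)
    fix i j assume "i \<in> {..<q}" "j \<in> {..<q}"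
    moreover have "(\<Sum>a<r. \<Sum>b<r. C i a * (D1 a b - D2 a b) * C j b) = score_cov C D1 i j - score_cov C D2 i j"
      unfolding score_cov_def sum_subtractf[symmetric] by (intro sum.cong refl) (simp add: algebra_simps)
    ultimately show "(\<Sum>a<r. \<Sum>b<r. C i a * (D1 a b - D2 a b) * C j b)\<^sup>2 = 0" using eq by simp
  qed
  moreover have "(\<Sum>a<r. \<Sum>b<r. \<Sum>a'<r. \<Sum>b'<r. (D1 a b - D2 a b) * (D1 a' b' - D2 a' b') * ((\<Sum>i<q. C i a * C i a') * (\<Sum>j<q. C j b * C j b')))
     = (\<Sum>a<r. \<Sum>b<r. \<Sum>a'<r. \<Sum>b'<r. (D1 a b - D2 a b) * (D1 a' b' - D2 a' b') * (S a a' * S b b'))"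
    by (intro sum.cong refl) (simp add: CC)
  ultimately show False using D_diff sum_squares_congruence[where L = C and D = "\<lambda>a b. D1 a b - D2 a b" and d = q and r = r] by simp
qed

definition limit_cov :: "(nat \<Rightarrow> nat \<Rightarrow> real) \<Rightarrow> (nat \<Rightarrow> nat \<Rightarrow> real) \<Rightarrow> real mat" where
  "limit_cov C D = mat q q (\<lambda>(i, j). score_cov C D i j)"

lemma limit_cov_pos_semidef:
  assumes "\<And>k l. k < r \<Longrightarrow> l < r \<Longrightarrow> D k l = D l k" "\<And>v. 0 \<le> qform r D v"
  shows "pos_semidef q (limit_cov C D)"
proof (rule pos_semidefI)
  show "limit_cov C D $$ (i, j) = limit_cov C D $$ (j, i)" if "i < q" "j < q" for i j
    using that score_cov_sym[OF assms(1)] by (simp add: limit_cov_def)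
  have "qform q (\<lambda>i j. limit_cov C D $$ (i, j)) v = qform q (score_cov C D) v" for v
    unfolding qform_def limit_cov_def by (intro sum.cong refl) simp
  then show "0 \<le> qform q (\<lambda>i j. limit_cov C D $$ (i, j)) v" for v
    unfolding qform_score_cov using assms(2) by simp
qed (simp add: limit_cov_def)

text \<open>When \<open>s\<close> misses \<open>\<theta>\<close>, one limiting block is a proper
  mixture of both regimes and the other can be taken pure. The strict concavity in the mixed block,
  times its share, is the gap.\<close>

lemma limit_objective_gap:
  assumes ne: "limit_cov C D1 \<noteq> limit_cov C D2" and s: "0 \<le> s" "s \<le> 1" "s \<noteq> \<theta>" and \<epsilon>: "0 < \<epsilon>"
  shows "\<exists>W1 W2. pos_semidef q W1 \<and> pos_semidef q W2 \<and>
    (\<forall>i<q. \<forall>j<q. cum_cov C s i j = s * W1 $$ (i, j) \<and> cum_cov C 1 i j - cum_cov C s i j = (1 - s) * W2 $$ (i, j)) \<and>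
    \<theta> * ridge_ln_det q \<epsilon> (limit_cov C D1) + (1 - \<theta>) * ridge_ln_det q \<epsilon> (limit_cov C D2)
      < s * ridge_ln_det q \<epsilon> W1 + (1 - s) * ridge_ln_det q \<epsilon> W2"
proof -
  let ?V1 = "limit_cov C D1" and ?V2 = "limit_cov C D2" and ?R = "ridge_ln_det q \<epsilon>"
  have V1: "pos_semidef q ?V1" by (rule limit_cov_pos_semidef) (use D_sym D_nonneg in auto)
  have V2: "pos_semidef q ?V2" by (rule limit_cov_pos_semidef) (use D_sym D_nonneg in auto)
  have ent: "(t \<cdot>\<^sub>m ?V1 + (1 - t) \<cdot>\<^sub>m ?V2) $$ (i, j) = t * score_cov C D1 i j + (1 - t) * score_cov C D2 i j"
    "?V1 $$ (i, j) = score_cov C D1 i j" "?V2 $$ (i, j) = score_cov C D2 i j" if "i < q" "j < q" for i j t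
    using that by (auto simp: limit_cov_def)
  note conc = ridge_ln_det_strict_concave[OF V1 V2 ne \<epsilon>]
  consider "s < \<theta>" | "\<theta> < s" using s by linarith
  then show ?thesis
  proof cases
    case 1
    \<comment> \<open>The share of the first regime in the block from \<open>s\<close> to 1. At
      \<open>s = 0\<close> the first block has no weight, and \<open>?V1\<close> stands in for
      it.\<close>
    define t where "t = (\<theta> - s) / (1 - s)"
    have s1: "0 < 1 - s" using 1 theta by simp
    have t: "0 < t" "t < 1" "(1 - s) * t = \<theta> - s" "(1 - s) * (1 - t) = 1 - \<theta>"
      using 1 theta s1 by (auto simp: t_def divide_simps)
    let ?W = "t \<cdot>\<^sub>m ?V1 + (1 - t) \<cdot>\<^sub>m ?V2"
    have "(1 - s) * (t * ?R ?V1 + (1 - t) * ?R ?V2) < (1 - s) * ?R ?W"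
      using conc[OF t(1,2)] s1 by (rule mult_strict_left_mono)
    then have "((1 - s) * t) * ?R ?V1 + ((1 - s) * (1 - t)) * ?R ?V2 < (1 - s) * ?R ?W"
      by (simp add: algebra_simps)
    then have gap: "\<theta> * ?R ?V1 + (1 - \<theta>) * ?R ?V2 < s * ?R ?V1 + (1 - s) * ?R ?W"
      unfolding t(3,4) by (simp add: algebra_simps)
    have cum: "cum_cov C s i j = s * ?V1 $$ (i, j) \<and> cum_cov C 1 i j - cum_cov C s i j = (1 - s) * ?W $$ (i, j)"
      if "i < q" "j < q" for i j
    proof
      show "cum_cov C s i j = s * ?V1 $$ (i, j)" using 1 ent[OF that] by (simp add: cum_cov_def)
      have "(1 - s) * ?W $$ (i, j) = ((1 - s) * t) * score_cov C D1 i j + ((1 - s) * (1 - t)) * score_cov C D2 i j"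
        unfolding ent(1)[OF that] by (simp only: distrib_left mult.assoc)
      then show "cum_cov C 1 i j - cum_cov C s i j = (1 - s) * ?W $$ (i, j)"
        unfolding t(3,4) using 1 theta by (simp add: cum_cov_def min_def max_def left_diff_distrib)
    qed
    have psd: "pos_semidef q ?W" by (rule pos_semidef_convex_combination[OF V1 V2]) (use t in auto)
    show ?thesis by (intro exI[of _ ?V1] exI[of _ ?W] conjI[OF V1] conjI[OF psd] conjI[OF _ gap] allI impI cum)
  next
    case 2
    \<comment> \<open>The share of the first regime in the block from 0 to \<open>s\<close>; at
      \<open>s = 1\<close>, \<open>?V2\<close> stands in for the block without weight.\<close>
    define t where "t = \<theta> / s"
    have s0: "0 < s" using 2 theta by simp
    have t: "0 < t" "t < 1" "s * t = \<theta>" "s * (1 - t) = s - \<theta>"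
      using 2 theta s0 by (auto simp: t_def right_diff_distrib)
    let ?W = "t \<cdot>\<^sub>m ?V1 + (1 - t) \<cdot>\<^sub>m ?V2"
    have "s * (t * ?R ?V1 + (1 - t) * ?R ?V2) < s * ?R ?W"
      using conc[OF t(1,2)] s0 by (rule mult_strict_left_mono)
    then have "(s * t) * ?R ?V1 + (s * (1 - t)) * ?R ?V2 < s * ?R ?W"
      by (simp only: distrib_left mult.assoc)
    then have gap: "\<theta> * ?R ?V1 + (1 - \<theta>) * ?R ?V2 < s * ?R ?W + (1 - s) * ?R ?V2"
      unfolding t(3,4) by (simp add: algebra_simps)
    have cum: "cum_cov C s i j = s * ?W $$ (i, j) \<and> cum_cov C 1 i j - cum_cov C s i j = (1 - s) * ?V2 $$ (i, j)"
      if "i < q" "j < q" for i j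
    proof
      have "s * ?W $$ (i, j) = (s * t) * score_cov C D1 i j + (s * (1 - t)) * score_cov C D2 i j"
        unfolding ent(1)[OF that] by (simp only: distrib_left mult.assoc)
      then show "cum_cov C s i j = s * ?W $$ (i, j)"
        unfolding t(3,4) using 2 by (simp add: cum_cov_def)
      show "cum_cov C 1 i j - cum_cov C s i j = (1 - s) * ?V2 $$ (i, j)"
        using 2 theta ent[OF that] by (simp add: cum_cov_def left_diff_distrib)
    qed
    have psd: "pos_semidef q ?W" by (rule pos_semidef_convex_combination[OF V1 V2]) (use t in auto)
    show ?thesis by (intro exI[of _ ?W] exI[of _ ?V2] conjI[OF psd] conjI[OF V2] conjI[OF _ gap] allI impI cum)
  qed
qed

section \<open>Contradiction from a subsequence of minimizers\<close>

lemma break_index_admissible: "\<forall>\<^sub>F n in sequentially. 1 \<le> break_index \<theta> n \<and> break_index \<theta> n < n"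
proof -
  have "\<forall>\<^sub>F n in sequentially. 0 < real (break_index \<theta> n) / real n"
    "\<forall>\<^sub>F n in sequentially. real (break_index \<theta> n) / real n < 1"
    using order_tendstoD[OF break_index_over_n_tendsto[of \<theta>]] theta by auto
  then show ?thesis using eventually_gt_at_top[of 0]
    by eventually_elim (auto simp: zero_less_divide_iff Suc_le_eq)
qed

theorem minimizer_consistent:
  assumes \<epsilon>: "0 < \<epsilon>"
    and K: "\<And>n. 2 \<le> n \<Longrightarrow> q \<le> p n \<Longrightarrow> 1 \<le> K n \<and> K n < n"
    and min: "\<And>n k. 2 \<le> n \<Longrightarrow> q \<le> p n \<Longrightarrow> 1 \<le> k \<Longrightarrow> k < n \<Longrightarrow> objective \<epsilon> n (K n) \<le> objective \<epsilon> n k"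
  shows "(\<lambda>n. real (K n) / real n) \<longlonglongrightarrow> \<theta>"
proof (rule ccontr)
  assume "\<not> ?thesis"
  then obtain \<delta> where \<delta>: "0 < \<delta>" and "\<not> (\<forall>\<^sub>F n in sequentially. dist (real (K n) / real n) \<theta> < \<delta>)"
    unfolding tendsto_iff by blast
  then have "\<exists>\<^sub>F n in sequentially. \<delta> \<le> \<bar>real (K n) / real n - \<theta>\<bar>"
    unfolding not_eventually by (simp add: dist_real_def not_less)
  then have freq: "\<exists>\<^sub>F n in sequentially. \<delta> \<le> \<bar>real (K n) / real n - \<theta>\<bar> \<and>
      (2 \<le> n \<and> q \<le> p n \<and> 1 \<le> break_index \<theta> n \<and> break_index \<theta> n < n)"
  proof (rule frequently_rev_mp)
    show "\<forall>\<^sub>F n in sequentially. \<delta> \<le> \<bar>real (K n) / real n - \<theta>\<bar> \<longrightarrow> \<delta> \<le> \<bar>real (K n) / real n - \<theta>\<bar> \<and>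
      (2 \<le> n \<and> q \<le> p n \<and> 1 \<le> break_index \<theta> n \<and> break_index \<theta> n < n)"
      using eventually_ge_at_top[of 2] eventually_p_gt[of q] break_index_admissible by eventually_elim auto
  qed
  define P where "P = (\<lambda>n. \<delta> \<le> \<bar>real (K n) / real n - \<theta>\<bar> \<and> (2 \<le> n \<and> q \<le> p n \<and> 1 \<le> break_index \<theta> n \<and> break_index \<theta> n < n))"
  have inf: "infinite {n. P n}" using freq by (simp add: P_def frequently_cofinite flip: cofinite_eq_sequentially)
  define \<psi> where "\<psi> = enumerate {n. P n}"
  have \<psi>: "strict_mono \<psi>" "\<And>m. P (\<psi> m)"
    using strict_mono_enumerate[OF inf] enumerate_in_set[OF inf] by (auto simp: \<psi>_def)
  obtain b where b: "\<And>n j k. q \<le> p n \<Longrightarrow> j < q \<Longrightarrow> k < r \<Longrightarrow> \<bar>load n j k\<bar> \<le> b" using load_bounded by blast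
  \<comment> \<open>Loadings and estimator form one finite family, so one extraction suffices.
    Loadings have first index below \<open>q\<close>, which leaves \<open>(q, 0)\<close> free for
    the estimator.\<close>
  define X where "X = (\<lambda>(j, k) m. if j < q then load (\<psi> m) j k else real (K (\<psi> m)) / real (\<psi> m))"
  have "\<exists>\<phi> l. strict_mono (\<phi> :: nat \<Rightarrow> nat) \<and> (\<forall>i\<in>{..<q} \<times> {..<r} \<union> {(q, 0)}. (\<lambda>n. X i (\<phi> n)) \<longlonglongrightarrow> l i)"
  proof (rule convergent_subseq_finite_family[where B = "\<lambda>_. max b 1"])
    fix i m assume "i \<in> {..<q} \<times> {..<r} \<union> {(q, 0)}"
    then consider j k where "i = (j, k)" "j < q" "k < r" | "i = (q, 0)" by auto
    then show "\<bar>X i m\<bar> \<le> max b 1"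
    proof cases
      case 1
      then show ?thesis using b[of "\<psi> m" j k] \<psi>(2)[of m] by (auto simp: X_def P_def)
    next
      case 2
      have "K (\<psi> m) < \<psi> m" using K[of "\<psi> m"] \<psi>(2)[of m] by (auto simp: P_def)
      then have "real (K (\<psi> m)) / real (\<psi> m) \<le> 1" by (simp add: divide_le_eq)
      then show ?thesis using 2 by (simp add: X_def)
    qed
  qed auto
  then obtain \<phi>' l where \<phi>': "strict_mono (\<phi>' :: nat \<Rightarrow> nat)"
    and l: "\<And>i. i \<in> {..<q} \<times> {..<r} \<union> {(q, 0)} \<Longrightarrow> (\<lambda>n. X i (\<phi>' n)) \<longlonglongrightarrow> l i" by blast
  define \<phi> where "\<phi> = (\<lambda>m. \<psi> (\<phi>' m))"
  define C where "C = (\<lambda>j k. l (j, k))"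
  define s where "s = l (q, 0)"
  have P\<phi>: "P (\<phi> m)" for m using \<psi>(2) by (simp add: \<phi>_def)
  have q\<phi>: "q \<le> p (\<phi> m)" and \<phi>2: "2 \<le> \<phi> m" and \<tau>: "1 \<le> break_index \<theta> (\<phi> m)" "break_index \<theta> (\<phi> m) < \<phi> m" for m
    using P\<phi>[of m] by (auto simp: P_def)
  have "strict_mono \<phi>" using \<psi>(1) \<phi>' by (simp add: strict_mono_def \<phi>_def)
  then have \<phi>: "filterlim \<phi> at_top sequentially" by (rule filterlim_subseq)
  have C: "(\<lambda>m. load (\<phi> m) j k) \<longlonglongrightarrow> C j k" if "j < q" "k < r" for j k
    using l[of "(j, k)"] that by (simp add: X_def C_def \<phi>_def)
  have lims: "(\<lambda>m. real (K (\<phi> m)) / real (\<phi> m)) \<longlonglongrightarrow> s"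
    using l[of "(q, 0)"] by (simp add: X_def s_def \<phi>_def)
  have K\<phi>: "1 \<le> K (\<phi> m)" "K (\<phi> m) < \<phi> m" for m using K[OF \<phi>2 q\<phi>] by auto
  have s: "0 \<le> s" "s \<le> 1"
    by (rule LIMSEQ_le_const[OF lims], simp, rule LIMSEQ_le_const2[OF lims])
      (use K\<phi>(2) in \<open>auto simp: divide_le_eq less_imp_le\<close>)
  have "\<delta> \<le> \<bar>s - \<theta>\<bar>"
    by (rule LIMSEQ_le_const[OF tendsto_rabs[OF tendsto_diff[OF lims tendsto_const]]])
      (use P\<phi> in \<open>auto simp: P_def\<close>)
  then have s\<theta>: "s \<noteq> \<theta>" using \<delta> by auto
  have ne: "limit_cov C D1 \<noteq> limit_cov C D2"
  proof
    assume eq: "limit_cov C D1 = limit_cov C D2"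
    obtain i j where "i < q" "j < q" "score_cov C D1 i j \<noteq> score_cov C D2 i j"
      using score_cov_differ[OF \<phi> C] by blast
    then show False using arg_cong[OF eq, of "\<lambda>M. M $$ (i, j)"] by (simp add: limit_cov_def)
  qed
  obtain W1 W2 where W: "pos_semidef q W1" "pos_semidef q W2"
    and W12: "\<And>i j. i < q \<Longrightarrow> j < q \<Longrightarrow> cum_cov C s i j = s * W1 $$ (i, j)"
      "\<And>i j. i < q \<Longrightarrow> j < q \<Longrightarrow> cum_cov C 1 i j - cum_cov C s i j = (1 - s) * W2 $$ (i, j)"
    and gap: "\<theta> * ridge_ln_det q \<epsilon> (limit_cov C D1) + (1 - \<theta>) * ridge_ln_det q \<epsilon> (limit_cov C D2)
      < s * ridge_ln_det q \<epsilon> W1 + (1 - s) * ridge_ln_det q \<epsilon> W2"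
    using limit_objective_gap[OF ne s s\<theta> \<epsilon>] by blast
  obtain la where la: "la \<longlonglongrightarrow> s * ridge_ln_det q \<epsilon> W1 + (1 - s) * ridge_ln_det q \<epsilon> W2"
    "\<And>m. la m \<le> objective \<epsilon> (\<phi> m) (K (\<phi> m))"
    using objective_lower_limit[OF \<phi> q\<phi> C K\<phi> lims W W12 \<epsilon>] by blast
  have "(\<lambda>m. real (break_index \<theta> (\<phi> m)) / real (\<phi> m)) \<longlonglongrightarrow> \<theta>"
    by (rule filterlim_compose[OF break_index_over_n_tendsto \<phi>]) (use theta in simp)
  \<comment> \<open>At the true break the limiting blocks are the two pure regimes, and
    \<open>0 < \<theta> < 1\<close> makes the lower bound the objective itself.\<close>
  from objective_lower_limit[OF \<phi> q\<phi> C \<tau> this limit_cov_pos_semidef limit_cov_pos_semidef _ _ \<epsilon>, of D1 D2 C C]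
  have lb: "(\<lambda>m. objective \<epsilon> (\<phi> m) (break_index \<theta> (\<phi> m)))
      \<longlonglongrightarrow> \<theta> * ridge_ln_det q \<epsilon> (limit_cov C D1) + (1 - \<theta>) * ridge_ln_det q \<epsilon> (limit_cov C D2)"
    using theta D_sym D_nonneg by (auto simp: cum_cov_def limit_cov_def)
  have "s * ridge_ln_det q \<epsilon> W1 + (1 - s) * ridge_ln_det q \<epsilon> W2
      \<le> \<theta> * ridge_ln_det q \<epsilon> (limit_cov C D1) + (1 - \<theta>) * ridge_ln_det q \<epsilon> (limit_cov C D2)"
  proof (rule LIMSEQ_le[OF la(1) lb], intro exI allI impI)
    fix m
    have "objective \<epsilon> (\<phi> m) (K (\<phi> m)) \<le> objective \<epsilon> (\<phi> m) (break_index \<theta> (\<phi> m))"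
      by (rule min[OF \<phi>2 q\<phi> \<tau>])
    with la(2)[of m] show "la m \<le> objective \<epsilon> (\<phi> m) (break_index \<theta> (\<phi> m))" by (rule order.trans)
  qed
  with gap show False by simp
qed

end

section \<open>The two-regime model\<close>

lemma eigenbasis_cong:
  "(\<And>i j. i < n \<Longrightarrow> j < n \<Longrightarrow> A i j = A' i j) \<Longrightarrow> eigenbasis n A \<mu> w \<Longrightarrow> eigenbasis n A' \<mu> w"
  by (simp add: eigenbasis_def)

lemma sum_lessThan_add:
  fixes h :: "nat \<Rightarrow> real"
  shows "(\<Sum>k<a + b. h k) = (\<Sum>k<a. h k) + (\<Sum>k<b. h (a + k))"
  by (induction b) (simp_all add: add.assoc)

definition pad_low :: "nat \<Rightarrow> real mat \<Rightarrow> nat \<Rightarrow> nat \<Rightarrow> real" where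
  "pad_low a A k l = (if k < a \<and> l < a then A $$ (k, l) else 0)"

definition pad_high :: "nat \<Rightarrow> real mat \<Rightarrow> nat \<Rightarrow> nat \<Rightarrow> real" where
  "pad_high a A k l = (if a \<le> k \<and> a \<le> l then A $$ (k - a, l - a) else 0)"

lemma sum_pad_low:
  "(\<Sum>k<a + b. \<Sum>l<a + b. v k * pad_low a A k l * w l) = (\<Sum>k<a. \<Sum>l<a. v k * A $$ (k, l) * w l)"
  by (simp add: sum_lessThan_add pad_low_def)

lemma sum_pad_high:
  "(\<Sum>k<a + b. \<Sum>l<a + b. v k * pad_high a A k l * w l) = (\<Sum>k<b. \<Sum>l<b. v (a + k) * A $$ (k, l) * w (a + l))"
  by (simp add: sum_lessThan_add pad_high_def)

lemma ip_add_dim: "ip (a + b) v w = ip a v w + ip b (\<lambda>k. v (a + k)) (\<lambda>k. w (a + k))"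
  by (simp add: ip_def sum_lessThan_add)

lemma pos_def_imp_pos_semidef: "pos_def d A \<Longrightarrow> pos_semidef d A"
  unfolding pos_def_def pos_semidef_def
  by (metis less_imp_le mult_mat_vec_carrier scalar_prod_left_zero order_refl)

lemma congruence_index:
  assumes "\<Lambda> \<in> carrier_mat d q" "A \<in> carrier_mat q q" "i < d" "j < d"
  shows "(\<Lambda> * A * transpose_mat \<Lambda>) $$ (i, j) = (\<Sum>a<q. \<Sum>b<q. \<Lambda> $$ (i, a) * A $$ (a, b) * \<Lambda> $$ (j, b))"
proof -
  have "(\<Lambda> * A * transpose_mat \<Lambda>) $$ (i, j) = row (\<Lambda> * A) i \<bullet> col (transpose_mat \<Lambda>) j"
    by (rule index_mult_mat(1)) (use assms in auto)
  also have "\<dots> = (\<Sum>b<q. (\<Sum>a<q. \<Lambda> $$ (i, a) * A $$ (a, b)) * \<Lambda> $$ (j, b))"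
    using assms by (simp add: scalar_prod_def atLeast0LessThan)
  also have "\<dots> = (\<Sum>b<q. \<Sum>a<q. \<Lambda> $$ (i, a) * A $$ (a, b) * \<Lambda> $$ (j, b))"
    by (simp add: sum_distrib_right)
  also have "\<dots> = (\<Sum>a<q. \<Sum>b<q. \<Lambda> $$ (i, a) * A $$ (a, b) * \<Lambda> $$ (j, b))" by (rule sum.swap)
  finally show ?thesis .
qed

text \<open>A block average times the block's share of the sample is the block sum over
  \<open>n\<close>; for an empty block both are 0.\<close>

lemma second_moment_block_sum_tendsto:
  assumes mt: "mat_tendsto (\<lambda>n. second_moment d (T n) (f n)) \<Sigma>" and \<Sigma>: "\<Sigma> \<in> carrier_mat d d"
    and T: "\<And>n. finite (T n)" and card: "(\<lambda>n. real (card (T n)) / real n) \<longlonglongrightarrow> \<rho>"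
    and kl: "k < d" "l < d"
  shows "(\<lambda>n. (\<Sum>t\<in>T n. f n t $ k * f n t $ l) / real n) \<longlonglongrightarrow> \<rho> * \<Sigma> $$ (k, l)"
proof -
  have "(\<lambda>n. second_moment d (T n) (f n) $$ (k, l)) \<longlonglongrightarrow> \<Sigma> $$ (k, l)"
    using mt \<Sigma> kl unfolding mat_tendsto_def by auto
  from tendsto_mult[OF card this]
  have "(\<lambda>n. real (card (T n)) / real n * second_moment d (T n) (f n) $$ (k, l)) \<longlonglongrightarrow> \<rho> * \<Sigma> $$ (k, l)" .
  moreover have "real (card (T n)) / real n * second_moment d (T n) (f n) $$ (k, l) = (\<Sum>t\<in>T n. f n t $ k * f n t $ l) / real n" for n
    using T[of n] kl by (cases "card (T n) = 0") (auto simp: second_moment_def)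
  ultimately show ?thesis by (simp only:)
qed

section \<open>Time blocks and the padded factors\<close>

lemma break_index_mono: "a \<le> b \<Longrightarrow> break_index a n \<le> break_index b n"
  unfolding break_index_def by (intro nat_mono floor_mono mult_right_mono) auto

lemma break_index_1 [simp]: "break_index 1 n = n"
  by (simp add: break_index_def)

lemma break_index_0 [simp]: "break_index 0 n = 0"
  by (simp add: break_index_def)

lemma time_block_break_index: "time_block n a b = {break_index a n + 1..break_index b n}"
  by (simp add: time_block_def break_index_def)

lemma card_time_block_tendsto:
  assumes "0 \<le> a" "a \<le> b"
  shows "(\<lambda>n. real (card (time_block n a b)) / real n) \<longlonglongrightarrow> b - a"
proof -
  have "(\<lambda>n. real (break_index b n) / real n - real (break_index a n) / real n) \<longlonglongrightarrow> b - a"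
    using assms by (intro tendsto_diff break_index_over_n_tendsto) auto
  moreover have "real (card (time_block n a b)) = real (break_index b n) - real (break_index a n)" for n
    using break_index_mono[OF assms(2), of n] by (simp add: time_block_break_index of_nat_diff)
  ultimately show ?thesis by (simp add: diff_divide_distrib)
qed

definition regime_factor :: "nat \<Rightarrow> nat \<Rightarrow> (nat \<Rightarrow> real vec) \<Rightarrow> nat \<Rightarrow> nat \<Rightarrow> real" where
  "regime_factor \<tau> a f t k = (if t \<le> \<tau> then (if k < a then f t $ k else 0) else (if k < a then 0 else f t $ (k - a)))"

text \<open>Zero padding makes products across the two groups of factors vanish, so the sum up to
  \<open>s\<close>, split at \<open>\<theta>\<close>, fills two separate diagonal blocks.\<close>

lemma regime_factor_moment:
  assumes \<theta>: "0 < \<theta>" "\<theta> < 1" and \<Sigma>: "\<Sigma>1 \<in> carrier_mat a a" "\<Sigma>2 \<in> carrier_mat b b"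
    and F1: "\<And>s s'. 0 \<le> s \<Longrightarrow> s < s' \<Longrightarrow> s' \<le> \<theta> \<Longrightarrow>
      mat_tendsto (\<lambda>n. second_moment a (time_block n s s') (f n)) \<Sigma>1"
    and F2: "\<And>s s'. \<theta> \<le> s \<Longrightarrow> s < s' \<Longrightarrow> s' \<le> 1 \<Longrightarrow>
      mat_tendsto (\<lambda>n. second_moment b (time_block n s s') (f n)) \<Sigma>2"
    and s: "0 \<le> s" "s \<le> 1" and kl: "k < a + b" "l < a + b"
  shows "(\<lambda>n. (\<Sum>t\<in>{1..break_index s n}. regime_factor (break_index \<theta> n) a (f n) t k * regime_factor (break_index \<theta> n) a (f n) t l) / real n)
    \<longlonglongrightarrow> min s \<theta> * pad_low a \<Sigma>1 k l + max 0 (s - \<theta>) * pad_high a \<Sigma>2 k l"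
proof -
  let ?g = "\<lambda>n. regime_factor (break_index \<theta> n) a (f n)"
  have low: "(\<lambda>n. (\<Sum>t\<in>{1..break_index s n}. ?g n t k * ?g n t l) / real n) \<longlonglongrightarrow> s * pad_low a \<Sigma>1 k l"
    if s: "0 \<le> s" "s \<le> \<theta>" for s
  \<comment> \<open>\<open>F1\<close> requires an interval of positive length; at 0 the sum is
    empty.\<close>
  proof (cases "s = 0")
    case False
    have g: "(\<Sum>t\<in>{1..break_index s n}. ?g n t k * ?g n t l)
       = (if k < a \<and> l < a then (\<Sum>t\<in>time_block n 0 s. f n t $ k * f n t $ l) else 0)" for n
      using break_index_mono[OF s(2), of n]
      by (auto simp: regime_factor_def time_block_break_index intro!: sum.cong sum.neutral)
    show ?thesis
    proof (cases "k < a \<and> l < a")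
      case True
      have "(\<lambda>n. (\<Sum>t\<in>time_block n 0 s. f n t $ k * f n t $ l) / real n) \<longlonglongrightarrow> (s - 0) * \<Sigma>1 $$ (k, l)"
        using False s True
        by (intro second_moment_block_sum_tendsto[OF F1 \<Sigma>(1)] card_time_block_tendsto) (auto simp: time_block_def)
      then show ?thesis unfolding g using True by (simp add: pad_low_def)
    next
      case False
      then show ?thesis unfolding g by (simp only: if_False) (auto simp: pad_low_def)
    qed
  qed simp
  show ?thesis
  proof (cases "s \<le> \<theta>")
    case True
    then show ?thesis using low[OF s(1) True] by simp
  next
    case False
    have split: "{1..break_index s n} = {1..break_index \<theta> n} \<union> time_block n \<theta> s" for n
      using break_index_mono[of \<theta> s n] False by (auto simp: time_block_break_index)
    have sp: "(\<Sum>t\<in>{1..break_index s n}. ?g n t k * ?g n t l)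
       = (\<Sum>t\<in>{1..break_index \<theta> n}. ?g n t k * ?g n t l) + (\<Sum>t\<in>time_block n \<theta> s. ?g n t k * ?g n t l)" for n
      unfolding split by (rule sum.union_disjoint) (auto simp: time_block_break_index)
    have hi: "(\<Sum>t\<in>time_block n \<theta> s. ?g n t k * ?g n t l)
       = (if a \<le> k \<and> a \<le> l then (\<Sum>t\<in>time_block n \<theta> s. f n t $ (k - a) * f n t $ (l - a)) else 0)" for n
      by (auto simp: regime_factor_def time_block_break_index intro!: sum.cong sum.neutral)
    have lim: "(\<lambda>n. (if a \<le> k \<and> a \<le> l then (\<Sum>t\<in>time_block n \<theta> s. f n t $ (k - a) * f n t $ (l - a)) else 0) / real n)
       \<longlonglongrightarrow> (s - \<theta>) * pad_high a \<Sigma>2 k l"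
    proof (cases "a \<le> k \<and> a \<le> l")
      case True
      have "(\<lambda>n. (\<Sum>t\<in>time_block n \<theta> s. f n t $ (k - a) * f n t $ (l - a)) / real n) \<longlonglongrightarrow> (s - \<theta>) * \<Sigma>2 $$ (k - a, l - a)"
        using False s \<theta> True kl
        by (intro second_moment_block_sum_tendsto[OF F2 \<Sigma>(2)] card_time_block_tendsto) (auto simp: time_block_def)
      then show ?thesis using True by (simp add: pad_high_def)
    qed (auto simp: pad_high_def)
    have "(\<lambda>n. (\<Sum>t\<in>{1..break_index s n}. ?g n t k * ?g n t l) / real n)
       \<longlonglongrightarrow> \<theta> * pad_low a \<Sigma>1 k l + (s - \<theta>) * pad_high a \<Sigma>2 k l"
      unfolding sp hi add_divide_distrib by (intro tendsto_add low lim) (use \<theta> in auto)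
    then show ?thesis using False by simp
  qed
qed

lemma hcat_index:
  assumes "A \<in> carrier_mat d a" "B \<in> carrier_mat d b" "i < d"
  shows "k < a \<Longrightarrow> hcat A B $$ (i, k) = A $$ (i, k)" "k < b \<Longrightarrow> hcat A B $$ (i, a + k) = B $$ (i, k)"
  using assms by (auto simp: hcat_def)

text \<open>Both signal covariances are congruences of the joint loading matrix, so their difference
  has the form \<open>L D L^T\<close> to which \<open>sum_squares_congruence\<close>
  applies.\<close>

lemma signal_difference_index:
  assumes A: "A \<in> carrier_mat d a" and B: "B \<in> carrier_mat d b"
    and \<Sigma>: "\<Sigma>1 \<in> carrier_mat a a" "\<Sigma>2 \<in> carrier_mat b b" and ij: "i < d" "j < d"
  shows "(A * \<Sigma>1 * transpose_mat A - B * \<Sigma>2 * transpose_mat B) $$ (i, j)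
    = (\<Sum>k<a + b. \<Sum>l<a + b. hcat A B $$ (i, k) * (pad_low a \<Sigma>1 k l - pad_high a \<Sigma>2 k l) * hcat A B $$ (j, l))"
proof -
  have "(A * \<Sigma>1 * transpose_mat A - B * \<Sigma>2 * transpose_mat B) $$ (i, j)
     = (A * \<Sigma>1 * transpose_mat A) $$ (i, j) - (B * \<Sigma>2 * transpose_mat B) $$ (i, j)"
    using assms by (simp del: index_mult_mat(1))
  also have "\<dots> = (\<Sum>k<a. \<Sum>l<a. hcat A B $$ (i, k) * \<Sigma>1 $$ (k, l) * hcat A B $$ (j, l))
     - (\<Sum>k<b. \<Sum>l<b. hcat A B $$ (i, a + k) * \<Sigma>2 $$ (k, l) * hcat A B $$ (j, a + l))"
    unfolding congruence_index[OF A \<Sigma>(1) ij] congruence_index[OF B \<Sigma>(2) ij]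
    by (intro arg_cong2[where f = "(-)"] sum.cong refl) (auto simp: hcat_index[OF A B] ij)
  also have "\<dots> = (\<Sum>k<a + b. \<Sum>l<a + b. hcat A B $$ (i, k) * pad_low a \<Sigma>1 k l * hcat A B $$ (j, l))
     - (\<Sum>k<a + b. \<Sum>l<a + b. hcat A B $$ (i, k) * pad_high a \<Sigma>2 k l * hcat A B $$ (j, l))"
    by (simp only: sum_pad_low sum_pad_high)
  also have "\<dots> = (\<Sum>k<a + b. \<Sum>l<a + b. hcat A B $$ (i, k) * (pad_low a \<Sigma>1 k l - pad_high a \<Sigma>2 k l) * hcat A B $$ (j, l))"
    unfolding sum_subtractf[symmetric] by (intro sum.cong refl) (simp add: algebra_simps)
  finally show ?thesis .
qed

theorem corollary32:
  fixes \<theta> \<epsilon> :: real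
    and p :: "nat \<Rightarrow> nat"
    and q\<^sub>1 q\<^sub>2 q :: nat
    and \<Lambda>\<^sub>1 \<Lambda>\<^sub>2 :: "nat \<Rightarrow> real mat"
    and f e x y :: "nat \<Rightarrow> nat \<Rightarrow> real vec"
    and \<Sigma>\<^sub>\<Lambda> \<Sigma>F\<^sub>1 \<Sigma>F\<^sub>2 :: "real mat"
    and U :: "nat \<Rightarrow> real mat"
    and \<theta>hat :: "nat \<Rightarrow> real"
  assumes theta: "0 < \<theta>" "\<theta> < 1"
    and p_lim: "filterlim p at_top sequentially"
    \<comment> \<open>the model; index 1 is the regime up to the break, index 2 the one after it\<close>
    and Lam1: "\<And>n. \<Lambda>\<^sub>1 n \<in> carrier_mat (p n) q\<^sub>1"
    and Lam2: "\<And>n. \<Lambda>\<^sub>2 n \<in> carrier_mat (p n) q\<^sub>2"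
    and f1: "\<And>n t. t \<in> {1..break_index \<theta> n} \<Longrightarrow> f n t \<in> carrier_vec q\<^sub>1"
    and f2: "\<And>n t. t \<in> {break_index \<theta> n + 1..n} \<Longrightarrow> f n t \<in> carrier_vec q\<^sub>2"
    and e: "\<And>n t. t \<in> {1..n} \<Longrightarrow> e n t \<in> carrier_vec (p n)"
    and x1: "\<And>n t. t \<in> {1..break_index \<theta> n} \<Longrightarrow> x n t = \<Lambda>\<^sub>1 n *\<^sub>v f n t + e n t"
    and x2: "\<And>n t. t \<in> {break_index \<theta> n + 1..n} \<Longrightarrow> x n t = \<Lambda>\<^sub>2 n *\<^sub>v f n t + e n t"
    \<comment> \<open>(F1)\<close>
    and F1_psd: "pos_semidef (q\<^sub>1 + q\<^sub>2) \<Sigma>\<^sub>\<Lambda>"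
    and F1_lim: "mat_tendsto (\<lambda>n. (1 / real (p n)) \<cdot>\<^sub>m
          (transpose_mat (hcat (\<Lambda>\<^sub>1 n) (\<Lambda>\<^sub>2 n)) * hcat (\<Lambda>\<^sub>1 n) (\<Lambda>\<^sub>2 n))) \<Sigma>\<^sub>\<Lambda>"
    and q: "q = mat_rank \<Sigma>\<^sub>\<Lambda>"
    \<comment> \<open>(F2)\<close>
    and F2_pd: "pos_def q\<^sub>1 \<Sigma>F\<^sub>1" "pos_def q\<^sub>2 \<Sigma>F\<^sub>2"
    and F2_1: "\<And>a b. 0 \<le> a \<Longrightarrow> a < b \<Longrightarrow> b \<le> \<theta> \<Longrightarrow>
          mat_tendsto (\<lambda>n. second_moment q\<^sub>1 (time_block n a b) (f n)) \<Sigma>F\<^sub>1"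
    and F2_2: "\<And>c d. \<theta> \<le> c \<Longrightarrow> c < d \<Longrightarrow> d \<le> 1 \<Longrightarrow>
          mat_tendsto (\<lambda>n. second_moment q\<^sub>2 (time_block n c d) (f n)) \<Sigma>F\<^sub>2"
    \<comment> \<open>(F3)\<close>
    and F3: "liminf (\<lambda>n. ereal (1 / real (p n) *
          frob_norm (\<Lambda>\<^sub>1 n * \<Sigma>F\<^sub>1 * transpose_mat (\<Lambda>\<^sub>1 n) - \<Lambda>\<^sub>2 n * \<Sigma>F\<^sub>2 * transpose_mat (\<Lambda>\<^sub>2 n)))) > 0"
    \<comment> \<open>(F4)\<close>
    and F4: "\<And>a b. 0 \<le> a \<Longrightarrow> a < b \<Longrightarrow> b \<le> 1 \<Longrightarrow>
          (\<lambda>n. 1 / real (p n) * op_norm (second_moment (p n) (time_block n a b) (e n))) \<longlonglongrightarrow> 0"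
    \<comment> \<open>PCA scores\<close>
    and U: "\<And>n. q \<le> p n \<Longrightarrow> leading_eigenvectors (p n) q (second_moment (p n) {1..n} (x n)) (U n)"
    and y: "\<And>n t. t \<in> {1..n} \<Longrightarrow> y n t = pca_score (p n) (U n) (x n) t"
    \<comment> \<open>untrimmed regularized QML estimators\<close>
    and eps: "0 < \<epsilon>"
    and theta_hat: "\<And>n. 2 \<le> n \<Longrightarrow> q \<le> p n \<Longrightarrow>
          is_arg_min (qml_objective q \<epsilon> n (y n)) (\<lambda>\<nu>. \<nu> \<in> break_candidates n) (\<theta>hat n)"
  shows "\<theta>hat \<longlonglongrightarrow> \<theta>"
proof -
  define r where "r = q\<^sub>1 + q\<^sub>2"
  define H where "H = (\<lambda>n. hcat (\<Lambda>\<^sub>1 n) (\<Lambda>\<^sub>2 n))"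
  have H: "H n \<in> carrier_mat (p n) r" for n
    using Lam1[of n] Lam2[of n] by (auto simp: H_def hcat_def r_def)
  have S\<Lambda>: "\<Sigma>\<^sub>\<Lambda> \<in> carrier_mat r r" using F1_psd by (simp add: pos_semidef_def r_def)
  have \<Sigma>F: "\<Sigma>F\<^sub>1 \<in> carrier_mat q\<^sub>1 q\<^sub>1" "\<Sigma>F\<^sub>2 \<in> carrier_mat q\<^sub>2 q\<^sub>2"
    using F2_pd by (auto simp: pos_def_def)
  have xc: "dim_vec (x n t) = p n" if "t \<in> {1..n}" for n t
    using that x1[of t n] x2[of t n] e[OF that] by (cases "t \<le> break_index \<theta> n") simp_all
  define L where "L = (\<lambda>n k i. H n $$ (i, k))"
  define g where "g = (\<lambda>n. regime_factor (break_index \<theta> n) q\<^sub>1 (f n))"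
  define D1 where "D1 = pad_low q\<^sub>1 \<Sigma>F\<^sub>1"
  define D2 where "D2 = pad_high q\<^sub>1 \<Sigma>F\<^sub>2"
  define \<eta> where "\<eta> = (\<lambda>n. op_norm (second_moment (p n) {1..n} (e n)))"
  \<comment> \<open>Here the rank enters: \<open>q\<close> columns of the limit Gram matrix generate
    the others.\<close>
  obtain B c where B: "B \<subseteq> {..<r}" "card B = q"
    and c: "\<And>k l. k < r \<Longrightarrow> l < r \<Longrightarrow> \<Sigma>\<^sub>\<Lambda> $$ (l, k) = (\<Sum>b\<in>B. c k b * \<Sigma>\<^sub>\<Lambda> $$ (l, b))"
    using mat_rank_column_basis[OF S\<Lambda>] unfolding q by blast
  have "\<forall>n. \<exists>\<mu> :: nat \<Rightarrow> real. q \<le> p n \<longrightarrow>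
      char_poly (second_moment (p n) {1..n} (x n)) = (\<Prod>j<p n. [:- \<mu> j, 1:]) \<and>
      (\<forall>i<q. \<forall>j\<in>{q..<p n}. \<mu> j \<le> \<mu> i) \<and>
      (\<forall>j<q. second_moment (p n) {1..n} (x n) *\<^sub>v col (U n) j = \<mu> j \<cdot>\<^sub>v col (U n) j)"
    using U unfolding leading_eigenvectors_def by blast
  then obtain \<mu> :: "nat \<Rightarrow> nat \<Rightarrow> real" where \<mu>: "\<And>n. q \<le> p n \<Longrightarrow>
      char_poly (second_moment (p n) {1..n} (x n)) = (\<Prod>j<p n. [:- \<mu> n j, 1:]) \<and>
      (\<forall>i<q. \<forall>j\<in>{q..<p n}. \<mu> n j \<le> \<mu> n i) \<and>
      (\<forall>j<q. second_moment (p n) {1..n} (x n) *\<^sub>v col (U n) j = \<mu> n j \<cdot>\<^sub>v col (U n) j)"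
    by metis
  have Uc: "U n \<in> carrier_mat (p n) q" and UU: "transpose_mat (U n) * U n = 1\<^sub>m q" if "q \<le> p n" for n
    using U[OF that] by (auto simp: leading_eigenvectors_def)
  have gram: "(\<lambda>n. ip (p n) (L n k) (L n l) / real (p n)) \<longlonglongrightarrow> \<Sigma>\<^sub>\<Lambda> $$ (k, l)" if "k < r" "l < r" for k l
  proof -
    have "(\<lambda>n. ((1 / real (p n)) \<cdot>\<^sub>m (transpose_mat (H n) * H n)) $$ (k, l)) \<longlonglongrightarrow> \<Sigma>\<^sub>\<Lambda> $$ (k, l)"
      using F1_lim S\<Lambda> that unfolding mat_tendsto_def H_def by auto
    moreover have "((1 / real (p n)) \<cdot>\<^sub>m (transpose_mat (H n) * H n)) $$ (k, l) = ip (p n) (L n k) (L n l) / real (p n)" for n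
      using H[of n] that by (simp add: scalar_prod_def atLeast0LessThan ip_def L_def)
    ultimately show ?thesis by simp
  qed
  interpret factor_break_model \<theta> p q r L g "\<lambda>n t i. e n t $ i" "\<lambda>n t i. x n t $ i" "\<lambda>n t j. y n t $ j"
    "\<lambda>n j i. U n $$ (i, j)" \<mu> "\<lambda>k l. \<Sigma>\<^sub>\<Lambda> $$ (k, l)" D1 D2 \<eta> B c
  proof
    show "0 < \<theta>" "\<theta> < 1" by (rule theta)+
    show "filterlim p at_top sequentially" by (rule p_lim)
    show "x n t $ i = (\<Sum>k<r. L n k i * g n t k) + e n t $ i" if t: "t \<in> {1..n}" and i: "i < p n" for n t i
    proof (cases "t \<le> break_index \<theta> n")
      case True
      then have "f n t \<in> carrier_vec q\<^sub>1" using f1 t by auto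
      then have "x n t $ i = (\<Sum>k<q\<^sub>1. \<Lambda>\<^sub>1 n $$ (i, k) * f n t $ k) + e n t $ i"
        using True t i x1[of t n] e[OF t] Lam1[of n] by (simp add: scalar_prod_def atLeast0LessThan)
      then show ?thesis using True i
        by (simp add: r_def sum_lessThan_add L_def g_def regime_factor_def H_def hcat_index[OF Lam1 Lam2])
    next
      case False
      then have "f n t \<in> carrier_vec q\<^sub>2" using f2 t by auto
      then have "x n t $ i = (\<Sum>k<q\<^sub>2. \<Lambda>\<^sub>2 n $$ (i, k) * f n t $ k) + e n t $ i"
        using False t i x2[of t n] e[OF t] Lam2[of n] by (simp add: scalar_prod_def atLeast0LessThan)
      then show ?thesis using False i
        by (simp add: r_def sum_lessThan_add L_def g_def regime_factor_def H_def hcat_index[OF Lam1 Lam2])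
    qed
    show "(\<lambda>n. ip (p n) (L n k) (L n l) / real (p n)) \<longlonglongrightarrow> \<Sigma>\<^sub>\<Lambda> $$ (k, l)" if "k < r" "l < r" for k l
      by (rule gram[OF that])
    show "\<Sigma>\<^sub>\<Lambda> $$ (l, k) = (\<Sum>b\<in>B. c k b * \<Sigma>\<^sub>\<Lambda> $$ (l, b))" if "k < r" "l < r" for k l
      by (rule c[OF that])
    show "B \<subseteq> {..<r}" "card B \<le> q" using B by auto
    show "(\<lambda>n. (\<Sum>t\<in>{1..nat \<lfloor>s * real n\<rfloor>}. g n t k * g n t l) / real n)
        \<longlonglongrightarrow> min s \<theta> * D1 k l + max 0 (s - \<theta>) * D2 k l" if "0 \<le> s" "s \<le> 1" "k < r" "l < r" for s k l
      unfolding g_def D1_def D2_def break_index_def[of s, symmetric]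
      by (rule regime_factor_moment[OF theta \<Sigma>F F2_1 F2_2 that(1,2) that(3,4)[unfolded r_def]])
    show "D1 k l = D1 l k" "D2 k l = D2 l k" if "k < r" "l < r" for k l
      using that F2_pd symmetric_mat_index[OF \<Sigma>F(1)] symmetric_mat_index[OF \<Sigma>F(2)]
      by (auto simp: D1_def D2_def pad_low_def pad_high_def pos_def_def r_def)
    have qD1: "qform r D1 v = qform q\<^sub>1 (\<lambda>i j. \<Sigma>F\<^sub>1 $$ (i, j)) v" for v
      unfolding qform_def r_def D1_def by (rule sum_pad_low)
    have qD2: "qform r D2 v = qform q\<^sub>2 (\<lambda>i j. \<Sigma>F\<^sub>2 $$ (i, j)) (\<lambda>k. v (q\<^sub>1 + k))" for v
      unfolding qform_def r_def D2_def by (rule sum_pad_high)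
    show "0 \<le> qform r D1 v" "0 \<le> qform r D2 v" for v
      unfolding qD1 qD2 by (intro pos_semidef_qform_nonneg pos_def_imp_pos_semidef F2_pd)+
    obtain \<delta>1 \<delta>2 where \<delta>: "\<delta>1 > 0" "\<delta>2 > 0"
      "\<And>v. \<delta>1 * ip q\<^sub>1 v v \<le> qform q\<^sub>1 (\<lambda>i j. \<Sigma>F\<^sub>1 $$ (i, j)) v"
      "\<And>v. \<delta>2 * ip q\<^sub>2 v v \<le> qform q\<^sub>2 (\<lambda>i j. \<Sigma>F\<^sub>2 $$ (i, j)) v"
      using pos_def_lower_bound[OF F2_pd(1)] pos_def_lower_bound[OF F2_pd(2)] by blast
    show "\<exists>\<delta>>0. \<forall>v. \<delta> * ip r v v \<le> \<theta> * qform r D1 v + (1 - \<theta>) * qform r D2 v"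
    proof (intro exI[of _ "min (\<theta> * \<delta>1) ((1 - \<theta>) * \<delta>2)"] conjI allI)
      show "0 < min (\<theta> * \<delta>1) ((1 - \<theta>) * \<delta>2)" using \<delta> theta by simp
      fix v :: "nat \<Rightarrow> real"
      let ?v = "\<lambda>k. v (q\<^sub>1 + k)" and ?m = "min (\<theta> * \<delta>1) ((1 - \<theta>) * \<delta>2)"
      have "?m * ip r v v = ?m * ip q\<^sub>1 v v + ?m * ip q\<^sub>2 ?v ?v"
        unfolding r_def ip_add_dim by (rule distrib_left)
      also have "\<dots> \<le> (\<theta> * \<delta>1) * ip q\<^sub>1 v v + ((1 - \<theta>) * \<delta>2) * ip q\<^sub>2 ?v ?v"
        by (intro add_mono mult_right_mono ip_nonneg) auto
      also have "\<dots> = \<theta> * (\<delta>1 * ip q\<^sub>1 v v) + (1 - \<theta>) * (\<delta>2 * ip q\<^sub>2 ?v ?v)" by simp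
      also have "\<dots> \<le> \<theta> * qform r D1 v + (1 - \<theta>) * qform r D2 v"
        unfolding qD1 qD2 using theta by (intro add_mono mult_left_mono \<delta>) auto
      finally show "?m * ip r v v \<le> \<theta> * qform r D1 v + (1 - \<theta>) * qform r D2 v" .
    qed
    show "(\<Sum>a<r. \<Sum>b<r. \<Sum>a'<r. \<Sum>b'<r.
      (D1 a b - D2 a b) * (D1 a' b' - D2 a' b') * (\<Sigma>\<^sub>\<Lambda> $$ (a, a') * \<Sigma>\<^sub>\<Lambda> $$ (b, b'))) \<noteq> 0" (is "?K \<noteq> 0")
    proof
      \<comment> \<open>\<open>?K\<close> is the limit of the squared Frobenius distance in (F3)
        after scaling by \<open>1 / p\<close>; if it were 0, so would be the limit inferior.\<close>
      assume K0: "?K = 0"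
      let ?\<Delta> = "\<lambda>n. \<Lambda>\<^sub>1 n * \<Sigma>F\<^sub>1 * transpose_mat (\<Lambda>\<^sub>1 n) - \<Lambda>\<^sub>2 n * \<Sigma>F\<^sub>2 * transpose_mat (\<Lambda>\<^sub>2 n)"
      let ?G = "\<lambda>n. \<Sum>a<r. \<Sum>b<r. \<Sum>a'<r. \<Sum>b'<r. (D1 a b - D2 a b) * (D1 a' b' - D2 a' b') *
         ((ip (p n) (L n a) (L n a') / real (p n)) * (ip (p n) (L n b) (L n b') / real (p n)))"
      have "1 / real (p n) * frob_norm (?\<Delta> n) = sqrt (?G n)" for n
      proof -
        have "(\<Sum>i<dim_row (?\<Delta> n). \<Sum>j<dim_col (?\<Delta> n). (?\<Delta> n $$ (i, j))\<^sup>2)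
           = (\<Sum>i<p n. \<Sum>j<p n. (\<Sum>a<r. \<Sum>b<r. H n $$ (i, a) * (D1 a b - D2 a b) * H n $$ (j, b))\<^sup>2)"
          using Lam1[of n] Lam2[of n] \<Sigma>F unfolding r_def H_def D1_def D2_def
          by (intro sum.cong arg_cong[where f = "\<lambda>z. z\<^sup>2"] signal_difference_index) auto
        also have "\<dots> = (\<Sum>a<r. \<Sum>b<r. \<Sum>a'<r. \<Sum>b'<r. (D1 a b - D2 a b) * (D1 a' b' - D2 a' b') *
            (ip (p n) (L n a) (L n a') * ip (p n) (L n b) (L n b')))"
          unfolding sum_squares_congruence ip_def L_def ..
        finally have "frob_norm (?\<Delta> n) = sqrt (\<Sum>a<r. \<Sum>b<r. \<Sum>a'<r. \<Sum>b'<r. (D1 a b - D2 a b) * (D1 a' b' - D2 a' b') *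
            (ip (p n) (L n a) (L n a') * ip (p n) (L n b) (L n b')))"
          unfolding frob_norm_def by (rule arg_cong)
        moreover have "?G n = (\<Sum>a<r. \<Sum>b<r. \<Sum>a'<r. \<Sum>b'<r. (D1 a b - D2 a b) * (D1 a' b' - D2 a' b') *
            (ip (p n) (L n a) (L n a') * ip (p n) (L n b) (L n b'))) / (real (p n))\<^sup>2"
          by (simp add: sum_divide_distrib power2_eq_square)
        ultimately show ?thesis by (simp add: real_sqrt_divide)
      qed
      moreover have "(\<lambda>n. sqrt (?G n)) \<longlonglongrightarrow> sqrt ?K"
        by (intro tendsto_real_sqrt tendsto_sum tendsto_mult tendsto_const gram) auto
      ultimately have "(\<lambda>n. ereal (1 / real (p n) * frob_norm (?\<Delta> n))) \<longlonglongrightarrow> ereal 0"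
        using K0 by (intro tendsto_ereal) simp
      from lim_imp_Liminf[OF _ this] F3 show False by simp
    qed
    show "(\<Sum>t\<in>{1..n}. (ip (p n) v (\<lambda>i. e n t $ i))\<^sup>2) / real n \<le> \<eta> n * ip (p n) v v" for n v
    proof -
      have "(\<Sum>t\<in>{1..n}. (ip (p n) v (\<lambda>i. e n t $ i))\<^sup>2) / real n = qform (p n) (\<lambda>i j. second_moment (p n) {1..n} (e n) $$ (i, j)) v"
        unfolding qform_second_moment[symmetric] by (simp add: qform_def second_moment_def)
      also have "\<dots> \<le> \<eta> n * ip (p n) v v" unfolding \<eta>_def by (rule qform_le_op_norm) (simp add: second_moment_def)
      finally show ?thesis .
    qed
    show "0 \<le> \<eta> n" for n unfolding \<eta>_def by (rule op_norm_nonneg)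
    show "(\<lambda>n. \<eta> n / real (p n)) \<longlonglongrightarrow> 0"
      using F4[of 0 1] by (simp add: \<eta>_def time_block_break_index)
    have M: "second_moment (p n) {1..n} (x n) \<in> carrier_mat (p n) (p n)"
      "transpose_mat (second_moment (p n) {1..n} (x n)) = second_moment (p n) {1..n} (x n)" for n
      by (auto simp: second_moment_def mult.commute intro!: eq_matI)
    show "\<exists>w. eigenbasis (p n) (\<lambda>i j. (\<Sum>t\<in>{1..n}. x n t $ i * x n t $ j) / real n) (\<mu> n) w" if qn: "q \<le> p n" for n
    proof -
      obtain w where "eigenbasis (p n) (\<lambda>i j. second_moment (p n) {1..n} (x n) $$ (i, j)) (\<mu> n) w"
        using eigenbasis_of_char_poly[OF M] \<mu>[OF qn] by blast
      then have "eigenbasis (p n) (\<lambda>i j. (\<Sum>t\<in>{1..n}. x n t $ i * x n t $ j) / real n) (\<mu> n) w"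
        by (rule eigenbasis_cong[rotated]) (simp add: second_moment_def)
      then show ?thesis by blast
    qed
    show "\<mu> n j \<le> \<mu> n i" if "q \<le> p n" "i < q" "q \<le> j" "j < p n" for n i j
      using \<mu>[OF that(1)] that by auto
    show "ip (p n) (\<lambda>l. U n $$ (l, i)) (\<lambda>l. U n $$ (l, j)) = (if i = j then 1 else 0)"
      if "q \<le> p n" "i < q" "j < q" for n i j
      using arg_cong[OF UU[OF that(1)], of "\<lambda>M. M $$ (i, j)"] Uc[OF that(1)] that
      by (simp add: scalar_prod_def atLeast0LessThan ip_def)
    show "(\<Sum>l<p n. (\<Sum>t\<in>{1..n}. x n t $ i * x n t $ l) / real n * U n $$ (l, j)) = \<mu> n j * U n $$ (i, j)"
      if "q \<le> p n" "j < q" "i < p n" for n i j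
    proof -
      have "second_moment (p n) {1..n} (x n) *\<^sub>v col (U n) j = \<mu> n j \<cdot>\<^sub>v col (U n) j"
        using \<mu>[OF that(1)] that(2) by blast
      from arg_cong[OF this, of "\<lambda>z. z $ i"] show ?thesis
        using Uc[OF that(1)] that by (simp add: scalar_prod_def atLeast0LessThan second_moment_def)
    qed
    show "y n t $ j = ip (p n) (\<lambda>i. U n $$ (i, j)) (\<lambda>i. x n t $ i) / sqrt (real (p n))"
      if "q \<le> p n" "t \<in> {1..n}" "j < q" for n t j
      using Uc[OF that(1)] xc[OF that(2)] that
      by (simp add: y[OF that(2)] pca_score_def scalar_prod_def atLeast0LessThan ip_def)
  qed
  have obj: "qml_objective q \<epsilon> n (y n) (real k / real n) = objective \<epsilon> n k" if "1 \<le> k" "k < n" for n k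
  proof -
    \<comment> \<open>\<open>k / n * n\<close> is exactly \<open>k\<close>, so taking floors changes
      nothing.\<close>
    have "time_block n 0 (real k / real n) = {1..k}" "time_block n (real k / real n) 1 = {k + 1..n}"
      using that by (auto simp: time_block_def)
    then show ?thesis
      by (simp add: qml_objective_def objective_def block_cov_def ridge_ln_det_def second_moment_def)
  qed
  \<comment> \<open>The numerator of the estimator is recovered. Below \<open>n = 2\<close> there
    are no candidates, hence the guard.\<close>
  have "\<exists>k. 2 \<le> n \<longrightarrow> q \<le> p n \<longrightarrow> 1 \<le> k \<and> k < n \<and> \<theta>hat n = real k / real n" for n
  proof (cases "2 \<le> n \<and> q \<le> p n")
    case True
    then have "\<theta>hat n \<in> break_candidates n" using theta_hat[of n] by (simp add: is_arg_min_def)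
    then obtain k where "\<theta>hat n = real k / real n" "1 \<le> k" "k \<le> n - 1" by (auto simp: break_candidates_def)
    then show ?thesis using True by (intro exI[of _ k]) auto
  qed auto
  then obtain K where K: "\<And>n. 2 \<le> n \<Longrightarrow> q \<le> p n \<Longrightarrow> 1 \<le> K n \<and> K n < n \<and> \<theta>hat n = real (K n) / real n" by metis
  have "(\<lambda>n. real (K n) / real n) \<longlonglongrightarrow> \<theta>"
  proof (rule minimizer_consistent[OF eps])
    show "1 \<le> K n \<and> K n < n" if "2 \<le> n" "q \<le> p n" for n using K[OF that] by blast
    show "objective \<epsilon> n (K n) \<le> objective \<epsilon> n k" if n: "2 \<le> n" "q \<le> p n" and k: "1 \<le> k" "k < n" for n k
    proof -
      have "real k / real n \<in> break_candidates n" using k unfolding break_candidates_def by force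
      then have "\<not> qml_objective q \<epsilon> n (y n) (real k / real n) < qml_objective q \<epsilon> n (y n) (\<theta>hat n)"
        using theta_hat[OF n] by (auto simp: is_arg_min_def)
      then show ?thesis using K[OF n] obj[OF k] obj[of "K n" n] by simp
    qed
  qed
  \<comment> \<open>For \<open>n < 2\<close> or \<open>p n < q\<close>, finitely many cases in all,
    the estimator is unconstrained, so the two sequences agree only eventually.\<close>
  moreover have "\<forall>\<^sub>F n in sequentially. real (K n) / real n = \<theta>hat n"
    using eventually_ge_at_top[of 2] eventually_p_gt[of q] by eventually_elim (use K in auto)
  ultimately show ?thesis by (rule Lim_transform_eventually)
qed

end
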